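(* Let $p,q \in [1,\infty]$ be such that either $2 \leq p < q \leq \infty$ or $1 \leq q < p \leq 2$. Then there exists a symbol $m: \mathbb{Z}^2 \rightarrow \mathbb{C}$ such that $m \in \mathcal{M}^{cb}_p$ but $m \notin \mathcal{M}_q$.
   Context: Let $H=\ell_2(\mathbb{Z})$ with its standard orthonormal basis $(f_j)_{j\in\mathbb{Z}}$; operators $x$ on $H$ are identified with matrices $(x_{i,j})_{i,j\in\mathbb{Z}}$. For $1\le p<\infty$, $\mathcal{S}_p=\mathcal{S}_p(H)$ is the Schatten class of operators $x\in\mathcal{B}(H)$ with $\|x\|_p:=\mathrm{Tr}(|x|^p)^{1/p}<\infty$; $\mathcal{S}_\infty$ is the space of compact operators with the operator norm $\|\cdot\|_\infty$. Write $\mathcal{S}_p^s=\mathcal{S}_p(\mathbb{C}^s)$, and let $\mathcal{S}_p^s\otimes\mathcal{S}_p$ denote the $L_p$-tensor product, i.e. the $p$-norm closure of the algebraic tensor product inside $\mathcal{S}_p(\mathbb{C}^s\otimes H)$. A symbol is a function $m:\mathbb{Z}\times\mathbb{Z}\to\mathbb{C}$. It is an $L_p$-Schur multiplier if the map $(x_{i,j})_{i,j}\mapsto (m(i,j)x_{i,j})_{i,j}$ on finitely supported matrices extends to a bounded linear map $M_m:\mathcal{S}_p\to\mathcal{S}_p$. The set of all such symbols is $\mathcal{M}_p$, with norm $\|m\|_{\mathcal{M}_p}=\|M_m\|_{\mathcal{B}(\mathcal{S}_p)}$. The set $\mathcal{M}_p^{cb}\subseteq\mathcal{M}_p$ consists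 of those $m\in\mathcal{M}_p$ for which $M_m$ is completely bounded, i.e. $\|m\|_{\mathcal{M}_p^{cb}}:=\sup_{s\in\mathbb{N}_{\ge1}}\|\mathrm{id}_s\otimes M_m:\mathcal{S}_p^s\otimes\mathcal{S}_p\to\mathcal{S}_p^s\otimes\mathcal{S}_p\|<\infty$. *)

theory Defs
  imports "HOL-Analysis.Analysis"
begin

text \<open>
  The Hilbert space with orthonormal basis indexed by a set \<open>A\<close> is rendered as the set of
  square-summable functions vanishing outside \<open>A\<close>, and operators on it are identified with their
  matrices, which vanish outside \<open>A \<times> A\<close>.  The spaces needed are \<open>A = UNIV :: int set\<close>,
  \<open>A = {..<s} :: nat set\<close> and \<open>A = {..<s} \<times> UNIV :: (nat \<times> int) set\<close> for the tensor product of the two.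
\<close>

type_synonym 'i mat = "'i \<Rightarrow> 'i \<Rightarrow> complex"

section \<open>Bounded operators\<close>

definition ell2 :: "'i set \<Rightarrow> ('i \<Rightarrow> complex) set" where
  "ell2 A = {v. (\<forall>i. i \<notin> A \<longrightarrow> v i = 0) \<and> (\<lambda>i. (cmod (v i))\<^sup>2) summable_on A}"

definition ell2_norm :: "'i set \<Rightarrow> ('i \<Rightarrow> complex) \<Rightarrow> real" where
  "ell2_norm A v = sqrt (\<Sum>\<^sub>\<infinity>i\<in>A. (cmod (v i))\<^sup>2)"

definition mat_vec :: "'i set \<Rightarrow> 'i mat \<Rightarrow> ('i \<Rightarrow> complex) \<Rightarrow> ('i \<Rightarrow> complex)" where
  "mat_vec A x v = (\<lambda>i. \<Sum>\<^sub>\<infinity>j\<in>A. x i j * v j)"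

definition bounded_ops :: "'i set \<Rightarrow> 'i mat set" where
  "bounded_ops A = {x. (\<forall>i j. i \<notin> A \<or> j \<notin> A \<longrightarrow> x i j = 0) \<and>
     (\<exists>C. \<forall>v\<in>ell2 A. (\<forall>i\<in>A. (\<lambda>j. x i j * v j) summable_on A) \<and>
        mat_vec A x v \<in> ell2 A \<and> ell2_norm A (mat_vec A x v) \<le> C * ell2_norm A v)}"

definition op_norm :: "'i set \<Rightarrow> 'i mat \<Rightarrow> real" where
  "op_norm A x = (SUP v\<in>{v\<in>ell2 A. ell2_norm A v \<le> 1}. ell2_norm A (mat_vec A x v))"

definition compact_ops :: "'i set \<Rightarrow> 'i mat set" where
  "compact_ops A = {x \<in> bounded_ops A.
     \<forall>v :: nat \<Rightarrow> 'i \<Rightarrow> complex. (\<forall>n. v n \<in> ell2 A \<and> ell2_norm A (v n) \<le> 1) \<longrightarrow>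
       (\<exists>r w. strict_mono r \<and> w \<in> ell2 A \<and>
          (\<lambda>n. ell2_norm A (\<lambda>i. mat_vec A x (v (r n)) i - w i)) \<longlonglongrightarrow> 0)}"

definition mat_mult :: "'i set \<Rightarrow> 'i mat \<Rightarrow> 'i mat \<Rightarrow> 'i mat" where
  "mat_mult A x y = (\<lambda>i j. \<Sum>\<^sub>\<infinity>k\<in>A. x i k * y k j)"

definition mat_adjoint :: "'i mat \<Rightarrow> 'i mat" where
  "mat_adjoint x = (\<lambda>i j. cnj (x j i))"

definition mat_id :: "'i set \<Rightarrow> 'i mat" where
  "mat_id A = (\<lambda>i j. if i = j \<and> i \<in> A then 1 else 0)"

primrec mat_power :: "'i set \<Rightarrow> 'i mat \<Rightarrow> nat \<Rightarrow> 'i mat" where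
  "mat_power A x 0 = mat_id A"
| "mat_power A x (Suc n) = mat_mult A x (mat_power A x n)"

definition mat_poly :: "'i set \<Rightarrow> real poly \<Rightarrow> 'i mat \<Rightarrow> 'i mat" where
  "mat_poly A P x = (\<lambda>i j. \<Sum>k\<le>degree P. complex_of_real (coeff P k) * mat_power A x k i j)"

section \<open>Schatten classes\<close>

text \<open>
  Continuous functional calculus of a positive operator \<open>a\<close>, whose spectrum is contained in the
  interval from \<open>0\<close> to its norm: \<open>f(a)\<close> is the limit in operator norm of \<open>P\<^sub>n(a)\<close> for any
  polynomials \<open>P\<^sub>n\<close> converging to \<open>f\<close> uniformly on that interval.
\<close>

definition pos_fun_calc :: "'i set \<Rightarrow> (real \<Rightarrow> real) \<Rightarrow> 'i mat \<Rightarrow> 'i mat" where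
  "pos_fun_calc A f a = (THE b. b \<in> bounded_ops A \<and>
     (\<forall>P :: nat \<Rightarrow> real poly.
        uniform_limit {0..op_norm A a} (\<lambda>n t. poly (P n) t) f sequentially \<longrightarrow>
        (\<lambda>n. op_norm A (\<lambda>i j. mat_poly A (P n) a i j - b i j)) \<longlonglongrightarrow> 0))"

definition op_abs :: "'i set \<Rightarrow> 'i mat \<Rightarrow> 'i mat" where
  "op_abs A x = pos_fun_calc A sqrt (mat_mult A (mat_adjoint x) x)"

definition abs_powr :: "'i set \<Rightarrow> real \<Rightarrow> 'i mat \<Rightarrow> 'i mat" where
  "abs_powr A p x = pos_fun_calc A (\<lambda>t. t powr p) (op_abs A x)"

definition pos_trace :: "'i set \<Rightarrow> 'i mat \<Rightarrow> ennreal" where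
  "pos_trace A a = (\<Sum>\<^sub>\<infinity>i\<in>A. ennreal (Re (a i i)))"

definition schatten_norm :: "'i set \<Rightarrow> ennreal \<Rightarrow> 'i mat \<Rightarrow> ennreal" where
  "schatten_norm A p x =
     (if x \<notin> bounded_ops A then \<infinity>
      else if p = \<infinity> then ennreal (op_norm A x)
      else if pos_trace A (abs_powr A (enn2real p) x) = \<infinity> then \<infinity>
      else ennreal (enn2real (pos_trace A (abs_powr A (enn2real p) x)) powr (1 / enn2real p)))"

definition schatten_class :: "'i set \<Rightarrow> ennreal \<Rightarrow> 'i mat set" where
  "schatten_class A p =
     (if p = \<infinity> then compact_ops A else {x \<in> bounded_ops A. schatten_norm A p x < \<infinity>})"

section \<open>Schur multipliers\<close>

definition linear_map_on :: "'i mat set \<Rightarrow> ('i mat \<Rightarrow> 'i mat) \<Rightarrow> bool" where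
  "linear_map_on V T \<longleftrightarrow>
     (\<forall>x\<in>V. \<forall>y\<in>V. T (\<lambda>i j. x i j + y i j) = (\<lambda>i j. T x i j + T y i j)) \<and>
     (\<forall>x\<in>V. \<forall>c. T (\<lambda>i j. c * x i j) = (\<lambda>i j. c * T x i j))"

definition map_norm :: "('i mat \<Rightarrow> ennreal) \<Rightarrow> 'i mat set \<Rightarrow> ('i mat \<Rightarrow> 'i mat) \<Rightarrow> ennreal" where
  "map_norm N V T = (SUP x\<in>{x\<in>V. N x \<le> 1}. N (T x))"

text \<open>
  The extensional function space makes the extension unique as a HOL function, since finitely
  supported matrices are dense in every Schatten class.
\<close>

definition is_schur_map ::
    "ennreal \<Rightarrow> (int \<times> int \<Rightarrow> complex) \<Rightarrow> (int mat \<Rightarrow> int mat) \<Rightarrow> bool" where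
  "is_schur_map p m T \<longleftrightarrow>
     T \<in> schatten_class UNIV p \<rightarrow>\<^sub>E schatten_class UNIV p \<and>
     linear_map_on (schatten_class UNIV p) T \<and>
     map_norm (schatten_norm UNIV p) (schatten_class UNIV p) T < \<infinity> \<and>
     (\<forall>x. finite {(i, j). x i j \<noteq> 0} \<longrightarrow> T x = (\<lambda>i j. m (i, j) * x i j))"

definition schur_multipliers :: "ennreal \<Rightarrow> (int \<times> int \<Rightarrow> complex) set" where
  "schur_multipliers p = {m. \<exists>T. is_schur_map p m T}"

definition schur_map :: "ennreal \<Rightarrow> (int \<times> int \<Rightarrow> complex) \<Rightarrow> int mat \<Rightarrow> int mat" where
  "schur_map p m = (THE T. is_schur_map p m T)"

section \<open>Complete boundedness\<close>

definition tensor_mat :: "'k mat \<Rightarrow> 'i mat \<Rightarrow> ('k \<times> 'i) mat" where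
  "tensor_mat a b = (\<lambda>(k, i) (l, j). a k l * b i j)"

definition alg_tensor :: "'k mat set \<Rightarrow> 'i mat set \<Rightarrow> ('k \<times> 'i) mat set" where
  "alg_tensor V W = {x. \<exists>(n :: nat) a b. (\<forall>r<n. a r \<in> V \<and> b r \<in> W) \<and>
     x = (\<lambda>\<mu> \<nu>. \<Sum>r<n. tensor_mat (a r) (b r) \<mu> \<nu>)}"

definition schatten_tensor :: "nat \<Rightarrow> ennreal \<Rightarrow> (nat \<times> int) mat set" where
  "schatten_tensor s p = {x \<in> schatten_class ({..<s} \<times> UNIV) p.
     \<forall>\<epsilon>>0. \<exists>y \<in> alg_tensor (schatten_class {..<s} p) (schatten_class UNIV p).
       schatten_norm ({..<s} \<times> UNIV) p (\<lambda>\<mu> \<nu>. x \<mu> \<nu> - y \<mu> \<nu>) < ennreal \<epsilon>}"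

text \<open>
  The map \<open>id\<^sub>s \<otimes> T\<close> applies \<open>T\<close> to each of the \<open>s \<times> s\<close> blocks; the lemma below records its
  values on elementary tensors.
\<close>

definition amplify :: "('i mat \<Rightarrow> 'i mat) \<Rightarrow> ('k \<times> 'i) mat \<Rightarrow> ('k \<times> 'i) mat" where
  "amplify T x = (\<lambda>(k, i) (l, j). T (\<lambda>i' j'. x (k, i') (l, j')) i j)"

lemma amplify_tensor_mat:
  assumes "linear_map_on V T" and "b \<in> V"
  shows "amplify T (tensor_mat a b) = tensor_mat a (T b)"
  using assms by (auto simp: amplify_def tensor_mat_def linear_map_on_def fun_eq_iff)

definition schur_cb_norm :: "ennreal \<Rightarrow> (int \<times> int \<Rightarrow> complex) \<Rightarrow> ennreal" where
  "schur_cb_norm p m = (SUP s\<in>{1..}.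
     map_norm (schatten_norm ({..<s} \<times> UNIV) p) (schatten_tensor s p) (amplify (schur_map p m)))"

definition cb_schur_multipliers :: "ennreal \<Rightarrow> (int \<times> int \<Rightarrow> complex) set" where
  "cb_schur_multipliers p = {m \<in> schur_multipliers p. schur_cb_norm p m < \<infinity>}"

end

theory Submission
  imports Defs
begin

text \<open>
  The symbol is block diagonal.  On the block of size \<open>n\<close> it is \<open>n powr (- \<bar>1/2 - 1/p\<bar>)\<close> times the
  matrix \<open>F\<^sub>n\<close> of \<open>n\<close>-th roots of unity, whose entries have modulus 1 and whose columns are orthogonal.

  Schur multiplication by \<open>F\<^sub>n\<close> maps the conjugate of \<open>F\<^sub>n\<close>, whose \<open>n\<close> singular values are all equal to
  \<open>sqrt n\<close>, to the all-ones matrix, whose only nonzero singular value is \<open>n\<close>; and it maps the all-ones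
  matrix to \<open>F\<^sub>n\<close>.  Comparing the norms shows that it has norm at least \<open>n powr \<bar>1/2 - 1/q\<bar>\<close> on the
  Schatten class of exponent \<open>q\<close>.  The normalised blocks thus have norm at least \<open>n powr \<bar>1/p - 1/q\<bar>\<close>,
  since \<open>p\<close> lies between 2 and \<open>q\<close>, and the symbol is not a multiplier (lemmas \<open>not_multiplier_large\<close>,
  \<open>not_multiplier_infinity\<close>, \<open>not_multiplier_small\<close>).

  On the Schatten class of exponent \<open>p\<close> the bound \<open>n powr \<bar>1/2 - 1/p\<bar>\<close> is also an upper bound, and
  matrix coefficients make no difference (\<open>schatten_sum_single_block\<close>).  Within one column, Schur
  multiplication by \<open>F\<^sub>n\<close> is multiplication by a diagonal unitary matrix from the left, which does not
  change the norm of the column.  If \<open>x\<close> has the \<open>n\<close> (block) columns \<open>x\<^sub>j\<close> and \<open>p \<ge> 2\<close>, then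
  \<open>\<Sum>\<^sub>j \<parallel>x\<^sub>j\<parallel>\<^sup>p \<le> \<parallel>x\<parallel>\<^sup>p \<le> n powr (p/2 - 1) * \<Sum>\<^sub>j \<parallel>x\<^sub>j\<parallel>\<^sup>p\<close>; for \<open>p \<le> 2\<close> both inequalities are reversed.  The
  first one is Peierls' inequality for \<open>x\<^sup>* x\<close>, the second one is Peierls' inequality for
  \<open>x x\<^sup>* = \<Sum>\<^sub>j x\<^sub>j x\<^sub>j\<^sup>*\<close> together with the comparison of power means.
  Blocks of different sizes are put together by pinching (\<open>schatten_sum_block_multiplier\<close>).

  All of this concerns finite matrices, for which \<open>schatten_sum\<close> is the sum of the \<open>p\<close>-th powers of the
  singular values.  The link with the functional calculus is \<open>trace_powr_eq_schatten_sup\<close>: the trace of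
  the \<open>p\<close>-th power of the absolute value of a bounded matrix is the supremum of \<open>schatten_sum\<close> over its
  finite sections.  It rests on the columnwise convergence of functions of the Gram matrices of finite
  sections (\<open>gram_conv_abs_powr\<close>).  Finally, the multiplier is determined by its values on finitely
  supported matrices because finite sections converge in the Schatten norm (\<open>finite_sections_dense\<close>);
  hence \<open>schur_map\<close> is entrywise multiplication, and so is its amplification.
\<close>

section \<open>Jensen inequalities for powers\<close>

lemma powr_ge_tangent:
  fixes r u :: real assumes "1 \<le> r" "0 \<le> u"
  shows "1 + r * (u - 1) \<le> u powr r"
proof (cases "u = 0")
  case False
  with assms have u: "u > 0" by simp
  have "r * 1 powr (r - 1) * (u - 1) \<le> u powr r - 1 powr r"
  proof (rule convex_on_imp_above_tangent[OF powr_convex[OF assms(1)]])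
    show "((\<lambda>x. x powr r) has_real_derivative r * 1 powr (r - 1)) (at 1 within {0<..})"
      by (rule has_field_derivative_at_within) (auto intro!: derivative_eq_intros)
  qed (use u in \<open>auto simp: interior_open\<close>)
  then show ?thesis by simp
qed (use assms in auto)

lemma powr_le_tangent:
  fixes r u :: real assumes "0 < r" "r \<le> 1" "0 \<le> u"
  shows "u powr r \<le> 1 + r * (u - 1)"
proof -
  have "1 + (1/r) * (u powr r - 1) \<le> (u powr r) powr (1/r)"
    by (rule powr_ge_tangent) (use assms in auto)
  also have "\<dots> = u" using assms by (simp add: powr_powr)
  finally show ?thesis using assms by (simp add: field_simps)
qed

text \<open>
  The weights may sum to less than 1 because \<open>t powr r\<close> vanishes at 0.  This admits orthonormal
  families that are not complete.
\<close>

lemma sum_powr_Jensen: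
  fixes w t :: "'k \<Rightarrow> real"
  assumes "1 \<le> r" and w: "\<And>k. k \<in> K \<Longrightarrow> 0 \<le> w k" and t: "\<And>k. k \<in> K \<Longrightarrow> 0 \<le> t k"
    and W: "(\<Sum>k\<in>K. w k) \<le> 1"
  shows "(\<Sum>k\<in>K. w k * t k) powr r \<le> (\<Sum>k\<in>K. w k * t k powr r)"
proof -
  define s where "s = (\<Sum>k\<in>K. w k * t k)"
  have s0: "s \<ge> 0" unfolding s_def by (intro sum_nonneg mult_nonneg_nonneg w t)
  show ?thesis
  proof (cases "s = 0")
    case True then show ?thesis unfolding s_def[symmetric] by (auto intro!: sum_nonneg mult_nonneg_nonneg w)
  next
    case False
    with s0 have s: "s > 0" by simp
    have "(\<Sum>k\<in>K. w k * (s powr r * (1 + r * (t k / s - 1)))) \<le> (\<Sum>k\<in>K. w k * t k powr r)"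
    proof (intro sum_mono mult_left_mono w)
      fix k assume k: "k \<in> K"
      have "s powr r * (1 + r * (t k / s - 1)) \<le> s powr r * (t k / s) powr r"
        by (intro mult_left_mono powr_ge_tangent) (use t k s assms in auto)
      also have "\<dots> = t k powr r" using s t k by (simp add: powr_divide)
      finally show "s powr r * (1 + r * (t k / s - 1)) \<le> t k powr r" .
    qed
    also have "(\<Sum>k\<in>K. w k * (s powr r * (1 + r * (t k / s - 1))))
        = s powr r * ((\<Sum>k\<in>K. w k) * (1 - r) + r / s * (\<Sum>k\<in>K. w k * t k))"
      by (simp add: sum_distrib_left sum_distrib_right sum.distrib sum_subtractf algebra_simps)
    also have "\<dots> = s powr r * ((\<Sum>k\<in>K. w k) * (1 - r) + r)"
      using s by (simp add: s_def[symmetric])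
    finally have *: "s powr r * ((\<Sum>k\<in>K. w k) * (1 - r) + r) \<le> (\<Sum>k\<in>K. w k * t k powr r)" .
    have "(1 - (\<Sum>k\<in>K. w k)) * (r - 1) \<ge> 0" using assms(1) W by simp
    then have "1 \<le> (\<Sum>k\<in>K. w k) * (1 - r) + r" by (simp add: algebra_simps)
    then have "s powr r * 1 \<le> s powr r * ((\<Sum>k\<in>K. w k) * (1 - r) + r)"
      by (intro mult_left_mono) auto
    with * show ?thesis unfolding s_def by linarith
  qed
qed

lemma sum_powr_Jensen_concave:
  fixes w t :: "'k \<Rightarrow> real"
  assumes "0 < r" "r \<le> 1" and w: "\<And>k. k \<in> K \<Longrightarrow> 0 \<le> w k" and t: "\<And>k. k \<in> K \<Longrightarrow> 0 \<le> t k"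
    and W: "(\<Sum>k\<in>K. w k) = 1"
  shows "(\<Sum>k\<in>K. w k * t k powr r) \<le> (\<Sum>k\<in>K. w k * t k) powr r"
proof -
  have "(\<Sum>k\<in>K. w k * t k powr r) powr (1/r) \<le> (\<Sum>k\<in>K. w k * (t k powr r) powr (1/r))"
    by (rule sum_powr_Jensen) (use assms in auto)
  also have "\<dots> = (\<Sum>k\<in>K. w k * t k)"
    using assms by (intro sum.cong) (auto simp: powr_powr)
  finally have "((\<Sum>k\<in>K. w k * t k powr r) powr (1/r)) powr r \<le> (\<Sum>k\<in>K. w k * t k) powr r"
    by (intro powr_mono2) (use assms in auto)
  moreover have "(\<Sum>k\<in>K. w k * t k powr r) \<ge> 0" using w by (auto intro!: sum_nonneg)
  ultimately show ?thesis using assms by (simp add: powr_powr)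
qed

section \<open>Inner products over finite index sets\<close>

definition ip :: "'i set \<Rightarrow> ('i \<Rightarrow> complex) \<Rightarrow> ('i \<Rightarrow> complex) \<Rightarrow> complex" where
  "ip C v w = (\<Sum>i\<in>C. cnj (v i) * w i)"

definition nsq :: "'i set \<Rightarrow> ('i \<Rightarrow> complex) \<Rightarrow> real" where
  "nsq C v = (\<Sum>i\<in>C. (cmod (v i))\<^sup>2)"

definition fmv :: "'i set \<Rightarrow> 'i mat \<Rightarrow> ('i \<Rightarrow> complex) \<Rightarrow> 'i \<Rightarrow> complex" where
  "fmv C x v = (\<lambda>i. \<Sum>j\<in>C. x i j * v j)"

definition orthonormal :: "'k set \<Rightarrow> 'i set \<Rightarrow> ('k \<Rightarrow> 'i \<Rightarrow> complex) \<Rightarrow> bool" where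
  "orthonormal K C v \<longleftrightarrow> (\<forall>k\<in>K. \<forall>l\<in>K. ip C (v k) (v l) = (if k = l then 1 else 0))"

lemma ip_self: "ip C v v = of_real (nsq C v)"
  unfolding ip_def nsq_def by (simp only: of_real_sum complex_norm_square) (simp add: mult.commute)

lemma ip_cnj: "cnj (ip C v w) = ip C w v"
  unfolding ip_def by (simp add: mult.commute)

lemma cmod_ip_commute: "cmod (ip C v w) = cmod (ip C w v)"
  by (metis ip_cnj complex_mod_cnj)

lemma nsq_nonneg [simp]: "0 \<le> nsq C v"
  unfolding nsq_def by (simp add: sum_nonneg)

lemma nsq_cong: "(\<And>i. i \<in> C \<Longrightarrow> v i = w i) \<Longrightarrow> nsq C v = nsq C w"
  unfolding nsq_def by simp

lemma ip_cong: "(\<And>i. i \<in> C \<Longrightarrow> v i = v' i) \<Longrightarrow> (\<And>i. i \<in> C \<Longrightarrow> w i = w' i) \<Longrightarrow> ip C v w = ip C v' w'"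
  unfolding ip_def by simp

lemma fmv_cong: "(\<And>j. j \<in> C \<Longrightarrow> v j = w j) \<Longrightarrow> fmv C x v = fmv C x w"
  unfolding fmv_def by (auto intro!: ext sum.cong)

lemma ip_sum_right: "ip C u (\<lambda>j. \<Sum>k\<in>K. c k * v k j) = (\<Sum>k\<in>K. c k * ip C u (v k))"
  unfolding ip_def by (simp add: sum_distrib_left mult.left_commute mult.assoc) (rule sum.swap)

lemma ip_sum_left: "ip C (\<lambda>j. \<Sum>k\<in>K. c k * v k j) u = (\<Sum>k\<in>K. cnj (c k) * ip C (v k) u)"
  by (subst ip_cnj[symmetric], subst ip_sum_right) (simp add: ip_cnj)

lemma ip_scale_right: "ip C u (\<lambda>j. c * v j) = c * ip C u v"
  unfolding ip_def by (simp add: sum_distrib_left mult.left_commute)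

lemma ip_add_scale_right: "ip C u (\<lambda>j. v j + c * w j) = ip C u v + c * ip C u w"
  unfolding ip_def by (simp add: sum_distrib_left sum.distrib algebra_simps)

lemma fmv_sum: "fmv C x (\<lambda>j. \<Sum>k\<in>K. c k * v k j) = (\<lambda>i. \<Sum>k\<in>K. c k * fmv C x (v k) i)"
  unfolding fmv_def by (rule ext) (simp add: sum_distrib_left mult.left_commute mult.assoc, rule sum.swap)

lemma fmv_scale: "fmv C x (\<lambda>j. c * v j) = (\<lambda>i. c * fmv C x v i)"
  unfolding fmv_def by (rule ext) (simp add: sum_distrib_left mult.left_commute)

lemma fmv_add_scale: "fmv C x (\<lambda>j. v j + c * w j) = (\<lambda>i. fmv C x v i + c * fmv C x w i)"
  unfolding fmv_def by (rule ext) (simp add: sum_distrib_left sum.distrib algebra_simps)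

lemma nsq_scale: "nsq C (\<lambda>j. c * v j) = (cmod c)\<^sup>2 * nsq C v"
  unfolding nsq_def by (simp add: sum_distrib_left norm_mult power_mult_distrib)

lemma nsq_add_scale:
  "nsq C (\<lambda>j. v j + c * w j) = nsq C v + 2 * Re (c * ip C v w) + (cmod c)\<^sup>2 * nsq C w"
proof -
  have "(cmod (a + c * b))\<^sup>2 = (cmod a)\<^sup>2 + 2 * Re (c * (cnj a * b)) + (cmod c)\<^sup>2 * (cmod b)\<^sup>2" for a b
    by (simp only: cmod_power2) (simp add: algebra_simps power2_eq_square)
  then show ?thesis unfolding nsq_def ip_def
    by (simp add: sum.distrib sum_distrib_left)
qed

lemma ip_fmv_adjoint: "ip R u (fmv C x v) = ip C (fmv R (mat_adjoint x) u) v"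
  unfolding ip_def fmv_def mat_adjoint_def
  by (simp add: sum_distrib_left sum_distrib_right mult.assoc mult.left_commute mult.commute) (subst sum.swap, simp)

lemma mat_adjoint_adjoint [simp]: "mat_adjoint (mat_adjoint x) = x"
  unfolding mat_adjoint_def by simp

lemma nsq_sum_orthogonal:
  assumes "finite K" and o: "\<And>k l. k \<in> K \<Longrightarrow> l \<in> K \<Longrightarrow> k \<noteq> l \<Longrightarrow> ip C (v k) (v l) = 0"
  shows "nsq C (\<lambda>i. \<Sum>k\<in>K. c k * v k i) = (\<Sum>k\<in>K. (cmod (c k))\<^sup>2 * nsq C (v k))"
proof -
  have "complex_of_real (nsq C (\<lambda>i. \<Sum>k\<in>K. c k * v k i)) = (\<Sum>k\<in>K. cnj (c k) * (\<Sum>l\<in>K. c l * ip C (v k) (v l)))"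
    unfolding ip_self[symmetric] ip_sum_left by (simp only: ip_sum_right)
  also have "\<dots> = (\<Sum>k\<in>K. cnj (c k) * (\<Sum>l\<in>K. if l = k then c k * ip C (v k) (v k) else 0))"
    by (intro sum.cong refl arg_cong[where f="\<lambda>t. _ * t"]) (auto simp: o)
  also have "\<dots> = complex_of_real (\<Sum>k\<in>K. (cmod (c k))\<^sup>2 * nsq C (v k))"
  proof -
    have cc: "cnj z * (z * a) = (of_real (cmod z))\<^sup>2 * a" for z a :: complex
      by (metis complex_norm_square mult.commute mult.assoc of_real_power)
    show ?thesis using assms(1) by (simp add: ip_self cc)
  qed
  finally show ?thesis by (simp only: of_real_eq_iff)
qed

lemma orthonormalD:
  "orthonormal K C v \<Longrightarrow> k \<in> K \<Longrightarrow> l \<in> K \<Longrightarrow> k \<noteq> l \<Longrightarrow> ip C (v k) (v l) = 0"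
  "orthonormal K C v \<Longrightarrow> k \<in> K \<Longrightarrow> nsq C (v k) = 1"
  unfolding orthonormal_def by (auto, metis ip_self of_real_eq_1_iff)

lemma nsq_sum_orthonormal:
  assumes "finite K" "orthonormal K C v"
  shows "nsq C (\<lambda>i. \<Sum>k\<in>K. c k * v k i) = (\<Sum>k\<in>K. (cmod (c k))\<^sup>2)"
  by (subst nsq_sum_orthogonal) (use assms in \<open>auto simp: orthonormalD\<close>)

lemma bessel_residue:
  assumes "finite K" "orthonormal K C v"
  shows "nsq C (\<lambda>i. w i - (\<Sum>k\<in>K. ip C (v k) w * v k i)) = nsq C w - (\<Sum>k\<in>K. (cmod (ip C (v k) w))\<^sup>2)"
proof -
  have "nsq C (\<lambda>i. w i + (-1) * (\<Sum>k\<in>K. ip C (v k) w * v k i)) =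
     nsq C w + 2 * Re ((-1) * ip C w (\<lambda>i. \<Sum>k\<in>K. ip C (v k) w * v k i))
      + (cmod (-1))\<^sup>2 * nsq C (\<lambda>i. \<Sum>k\<in>K. ip C (v k) w * v k i)"
    by (rule nsq_add_scale)
  moreover have "ip C (v k) w * ip C w (v k) = of_real ((cmod (ip C (v k) w))\<^sup>2)" for k
    by (metis ip_cnj complex_norm_square)
  ultimately show ?thesis
    using assms by (simp add: ip_sum_right nsq_sum_orthonormal flip: of_real_sum)
qed

lemma bessel:
  assumes "finite K" "orthonormal K C v"
  shows "(\<Sum>k\<in>K. (cmod (ip C (v k) w))\<^sup>2) \<le> nsq C w"
  using bessel_residue[OF assms, of w] nsq_nonneg[of C] by (smt (verit))

lemma ip_indicator: "finite C \<Longrightarrow> i \<in> C \<Longrightarrow> ip C v (\<lambda>j. if j = i then 1 else 0) = cnj (v i)"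
  unfolding ip_def by (simp add: if_distrib cong: if_cong)

lemma nsq_indicator: "finite C \<Longrightarrow> i \<in> C \<Longrightarrow> nsq C (\<lambda>j. if j = i then 1 else 0) = 1"
  unfolding nsq_def by (simp add: if_distrib[of cmod] if_distrib[of "\<lambda>t. t\<^sup>2"] cong: if_cong)

lemma bessel_coord:
  assumes "finite K" "finite C" "orthonormal K C v" "i \<in> C"
  shows "(\<Sum>k\<in>K. (cmod (v k i))\<^sup>2) \<le> 1"
  using bessel[OF assms(1,3), of "\<lambda>j. if j = i then 1 else 0"] assms by (simp add: ip_indicator nsq_indicator)

lemma nsq_eq_0: "finite C \<Longrightarrow> nsq C v = 0 \<Longrightarrow> i \<in> C \<Longrightarrow> v i = 0"
  unfolding nsq_def by (subst (asm) sum_nonneg_eq_0_iff) auto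

text \<open>
  In \<open>\<Sum>\<^sub>i \<Sum>\<^sub>k \<bar>v\<^sub>k(i)\<bar>\<^sup>2 = card C\<close> each of the \<open>card C\<close> inner sums is at most 1 by Bessel's inequality,
  hence equal to 1.  Completeness follows: the coordinate vectors lie in the span of \<open>v\<close>.
\<close>

lemma orthonormal_complete_coord:
  assumes "finite K" "finite C" "orthonormal K C v" "card K = card C" "i \<in> C"
  shows "(\<Sum>k\<in>K. (cmod (v k i))\<^sup>2) = 1"
proof -
  have "(\<Sum>i\<in>C. \<Sum>k\<in>K. (cmod (v k i))\<^sup>2) = (\<Sum>k\<in>K. nsq C (v k))"
    unfolding nsq_def by (rule sum.swap)
  also have "\<dots> = (\<Sum>i\<in>C. 1)" using assms by (simp add: orthonormalD)
  finally have "(\<Sum>i\<in>C. 1 - (\<Sum>k\<in>K. (cmod (v k i))\<^sup>2)) = 0" by (simp add: sum_subtractf)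
  then show ?thesis
    by (subst (asm) sum_nonneg_eq_0_iff) (use assms bessel_coord[OF assms(1-3)] in auto)
qed

lemma orthonormal_kernel:
  assumes "finite K" "finite C" "orthonormal K C v" "card K = card C" "i \<in> C" "j \<in> C"
  shows "(\<Sum>k\<in>K. v k i * cnj (v k j)) = (if i = j then 1 else 0)"
proof -
  let ?w = "\<lambda>i. if i = j then 1 else 0 :: complex"
  have "nsq C (\<lambda>i. ?w i - (\<Sum>k\<in>K. ip C (v k) ?w * v k i)) = 0"
    using bessel_residue[OF assms(1,3), of ?w] orthonormal_complete_coord[OF assms(1-4), of j] assms
    by (simp add: ip_indicator nsq_indicator)
  from nsq_eq_0[OF assms(2) this assms(5)] show ?thesis
    using assms by (simp add: ip_indicator mult.commute)
qed

lemma orthonormal_expand: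
  assumes "finite K" "finite C" "orthonormal K C v" "card K = card C" "i \<in> C"
  shows "(\<Sum>k\<in>K. ip C (v k) w * v k i) = w i"
proof -
  have "(\<Sum>k\<in>K. ip C (v k) w * v k i) = (\<Sum>j\<in>C. w j * (\<Sum>k\<in>K. v k i * cnj (v k j)))"
    unfolding ip_def by (simp add: sum_distrib_left sum_distrib_right mult_ac) (rule sum.swap)
  also have "\<dots> = (\<Sum>j\<in>C. w j * (if i = j then 1 else 0))"
    by (intro sum.cong refl) (simp add: orthonormal_kernel[OF assms(1-5)])
  also have "\<dots> = w i" using assms by (simp add: if_distrib cong: if_cong)
  finally show ?thesis .
qed

lemma parseval:
  assumes "finite K" "finite C" "orthonormal K C v" "card K = card C"
  shows "(\<Sum>k\<in>K. (cmod (ip C (v k) w))\<^sup>2) = nsq C w"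
  using nsq_sum_orthonormal[OF assms(1,3), of "\<lambda>k. ip C (v k) w"] orthonormal_expand[OF assms, of _ w]
  by (metis (no_types, lifting) nsq_cong)

lemma cauchy_schwarz: assumes "finite C" shows "(cmod (ip C v w))\<^sup>2 \<le> nsq C v * nsq C w"
proof -
  have le: "cmod (ip C v w) \<le> (\<Sum>i\<in>C. cmod (v i) * cmod (w i))"
    unfolding ip_def by (rule order_trans[OF norm_sum]) (simp add: norm_mult)
  have "(\<Sum>i\<in>C. cmod (v i) * cmod (w i))\<^sup>2 \<le> nsq C v * nsq C w"
    unfolding nsq_def by (rule Cauchy_Schwarz_ineq_sum)
  then show ?thesis using power_mono[OF le, of 2] by simp
qed

section \<open>Right singular bases\<close>

text \<open>
  Equivalently, \<open>v\<close> is an orthonormal eigenbasis of \<open>y\<^sup>* y\<close>, where \<open>y\<close> is the submatrix of \<open>x\<close> with rows \<open>R\<close> and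
  columns \<open>C\<close>; the eigenvalue of \<open>v k\<close> is \<open>nsq R (fmv C x (v k))\<close>.
\<close>

definition right_singular :: "'i set \<Rightarrow> 'i set \<Rightarrow> 'i mat \<Rightarrow> ('i \<Rightarrow> 'i \<Rightarrow> complex) \<Rightarrow> bool" where
  "right_singular R C x v \<longleftrightarrow> orthonormal C C v \<and>
     (\<forall>k\<in>C. \<forall>l\<in>C. k \<noteq> l \<longrightarrow> ip R (fmv C x (v k)) (fmv C x (v l)) = 0)"

text \<open>
  The squared norms of the projections of the coordinate vectors to the span of \<open>v\<close> sum to
  \<open>n < card C\<close>, so one of the coordinate vectors does not lie in the span.
\<close>

lemma orthogonal_vector_exists:
  assumes "finite C" "orthonormal {..<n} C v" "n < card C"
  shows "\<exists>w. (\<forall>i. i \<notin> C \<longrightarrow> w i = 0) \<and> nsq C w = 1 \<and> (\<forall>l<n. ip C (v l) w = 0)"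
proof -
  have "(\<Sum>i\<in>C. \<Sum>k<n. (cmod (v k i))\<^sup>2) = (\<Sum>k<n. nsq C (v k))"
    unfolding nsq_def by (rule sum.swap)
  also have "\<dots> = n" using assms by (simp add: orthonormalD)
  also have "\<dots> < (\<Sum>i\<in>C. 1)" using assms by simp
  finally obtain i where i: "i \<in> C" "(\<Sum>k<n. (cmod (v k i))\<^sup>2) < 1"
    by (metis (no_types, lifting) not_le sum_mono)
  let ?e = "\<lambda>j. if j = i then 1 else 0 :: complex"
  define w where "w = (\<lambda>j. ?e j - (\<Sum>k<n. ip C (v k) ?e * v k j))"
  have pos: "nsq C w > 0" unfolding w_def
    using bessel_residue[of "{..<n}" C v ?e] assms i by (simp add: ip_indicator nsq_indicator)
  have orth: "ip C (v l) w = 0" if "l < n" for l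
  proof -
    have "ip C (v l) (\<lambda>j. ?e j + (-1) * (\<Sum>k<n. ip C (v k) ?e * v k j))
        = ip C (v l) ?e - (\<Sum>k<n. ip C (v k) ?e * ip C (v l) (v k))"
      by (subst ip_add_scale_right, subst ip_sum_right) simp
    also have "(\<Sum>k<n. ip C (v k) ?e * ip C (v l) (v k)) = (\<Sum>k<n. if k = l then ip C (v k) ?e else 0)"
      using assms(2) that by (intro sum.cong) (auto simp: orthonormal_def)
    also have "\<dots> = ip C (v l) ?e" using that by simp
    finally show ?thesis by (simp add: w_def)
  qed
  define z where "z = (\<lambda>j. if j \<in> C then of_real (1 / sqrt (nsq C w)) * w j else 0)"
  have "nsq C z = nsq C (\<lambda>j. of_real (1 / sqrt (nsq C w)) * w j)" by (rule nsq_cong) (simp add: z_def)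
  also have "\<dots> = 1" using pos by (subst nsq_scale) (simp add: norm_divide power_divide)
  finally have 1: "nsq C z = 1" .
  have "ip C (v l) z = ip C (v l) (\<lambda>j. of_real (1 / sqrt (nsq C w)) * w j)" for l
    by (rule ip_cong) (simp_all add: z_def)
  then have "ip C (v l) z = 0" if "l < n" for l using orth[OF that] by (simp only: ip_scale_right) simp
  with 1 show ?thesis by (intro exI[of _ z]) (auto simp: z_def)
qed

lemma compact_unit_sphere:
  assumes "finite C"
  shows "compact {w. (\<forall>i. i \<notin> C \<longrightarrow> w i = 0) \<and> nsq C w = 1 \<and> (\<forall>l<n. ip C (v l) w = 0)}" (is "compact ?S")
proof -
  let ?P = "PiE UNIV (\<lambda>i. if i \<in> C then cball 0 1 else {0}) :: ('a \<Rightarrow> complex) set"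
  have "compactin (product_topology (\<lambda>i. euclidean) UNIV) ?P"
    by (subst compactin_PiE) auto
  then have cP: "compact ?P" by (simp add: euclidean_product_topology)
  have coord: "continuous_on UNIV (\<lambda>w::'a \<Rightarrow> complex. w i)" for i
    by (rule continuous_on_product_coordinates)
  have c1: "closed {w::'a \<Rightarrow> complex. w i = 0}" for i
    by (rule closed_Collect_eq[OF coord continuous_on_const])
  have c2: "closed {w::'a \<Rightarrow> complex. nsq C w = 1}" unfolding nsq_def
    by (rule closed_Collect_eq) (intro continuous_intros coord)+
  have c3: "closed {w::'a \<Rightarrow> complex. ip C (v l) w = 0}" for l unfolding ip_def
    by (rule closed_Collect_eq) (intro continuous_intros coord)+
  have eq: "?S = (\<Inter>i\<in>-C. {w. w i = 0}) \<inter> {w. nsq C w = 1} \<inter> (\<Inter>l\<in>{..<n}. {w. ip C (v l) w = 0})"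
    by auto
  have "closed ?S" unfolding eq by (intro closed_Int closed_INT ballI c1 c2 c3)
  moreover have "?S \<subseteq> ?P"
  proof
    fix w assume w: "w \<in> ?S"
    have "cmod (w i) \<le> 1" if "i \<in> C" for i
    proof -
      have "(cmod (w i))\<^sup>2 \<le> nsq C w" unfolding nsq_def using assms that by (intro member_le_sum) auto
      with w show ?thesis by (simp add: power2_le_iff_abs_le abs_square_le_1)
    qed
    with w show "w \<in> ?P" by auto
  qed
  ultimately show ?thesis using compact_Int_closed[OF cP, of ?S] by (simp only: Int_absorb1)
qed

text \<open>
  A unit vector maximising \<open>\<parallel>x w\<parallel>\<close> among those orthogonal to the vectors already chosen: at a maximum the
  first-order change of \<open>\<parallel>x w\<parallel>\<^sup>2\<close> in every admissible direction vanishes.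
\<close>

lemma singular_vector_exists:
  assumes fC: "finite C" and on: "orthonormal {..<n} C v" and n: "n < card C"
  shows "\<exists>w0. nsq C w0 = 1 \<and> (\<forall>l<n. ip C (v l) w0 = 0) \<and>
    (\<forall>w. (\<forall>l<n. ip C (v l) w = 0) \<and> ip C w0 w = 0 \<longrightarrow> ip R (fmv C x w0) (fmv C x w) = 0)"
proof -
  define S where "S = {w. (\<forall>i. i \<notin> C \<longrightarrow> w i = 0) \<and> nsq C w = 1 \<and> (\<forall>l<n. ip C (v l) w = 0)}"
  have coord: "continuous_on S (\<lambda>w::'a \<Rightarrow> complex. w i)" for i
    by (rule continuous_on_subset[OF continuous_on_product_coordinates]) simp
  have "continuous_on S (\<lambda>w. nsq R (fmv C x w))"
    unfolding nsq_def fmv_def by (intro continuous_intros coord)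
  note cont = this
  have ne: "S \<noteq> {}" using orthogonal_vector_exists[OF assms] unfolding S_def by blast
  have cS: "compact S" unfolding S_def by (rule compact_unit_sphere[OF fC])
  obtain w0 where w0: "w0 \<in> S" and max: "\<And>w. w \<in> S \<Longrightarrow> nsq R (fmv C x w) \<le> nsq R (fmv C x w0)"
    using continuous_attains_sup[OF cS ne cont] by blast
  define \<mu> where "\<mu> = nsq R (fmv C x w0)"
  have bound: "nsq R (fmv C x u) \<le> \<mu> * nsq C u" if u: "\<forall>l<n. ip C (v l) u = 0" "nsq C u > 0" for u
  proof -
    define z where "z = (\<lambda>j. if j \<in> C then of_real (1 / sqrt (nsq C u)) * u j else 0)"
    have z1: "nsq C z = nsq C (\<lambda>j. of_real (1 / sqrt (nsq C u)) * u j)" by (rule nsq_cong) (simp add: z_def)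
    have "ip C (v l) z = ip C (v l) (\<lambda>j. of_real (1 / sqrt (nsq C u)) * u j)" for l
      by (rule ip_cong) (simp_all add: z_def)
    then have "ip C (v l) z = 0" if "l < n" for l using u that by (simp only: ip_scale_right) simp
    moreover have "nsq C z = 1" unfolding z1 using u by (subst nsq_scale) (simp add: norm_divide power_divide)
    ultimately have "z \<in> S" unfolding S_def by (auto simp: z_def)
    from max[OF this] have "nsq R (fmv C x z) \<le> \<mu>" by (simp add: \<mu>_def)
    moreover have "fmv C x z = fmv C x (\<lambda>j. of_real (1 / sqrt (nsq C u)) * u j)"
      by (rule fmv_cong) (simp add: z_def)
    moreover have "nsq R (fmv C x (\<lambda>j. of_real (1 / sqrt (nsq C u)) * u j)) = nsq R (fmv C x u) / nsq C u"
      using u by (simp only: fmv_scale nsq_scale) (simp add: norm_divide power_divide)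
    ultimately have "nsq R (fmv C x u) / nsq C u \<le> \<mu>" by simp
    then show ?thesis using u by (simp add: field_simps)
  qed
  have "ip R (fmv C x w0) (fmv C x w) = 0" if w: "\<forall>l<n. ip C (v l) w = 0" "ip C w0 w = 0" for w
  proof (rule ccontr)
    define g where "g = ip R (fmv C x w0) (fmv C x w)"
    assume "ip R (fmv C x w0) (fmv C x w) \<noteq> 0"
    then have g: "cmod g > 0" by (simp add: g_def)
    define B where "B = \<mu> * nsq C w - nsq R (fmv C x w)"
    \<comment> \<open>Moving from \<open>w0\<close> in the direction \<open>cnj g * w\<close> would increase the quotient at first order.\<close>
    have key: "2 \<le> t * B" if t: "t > 0" for t :: real
    proof -
      define c where "c = of_real t * cnj g"
      let ?u = "\<lambda>j. w0 j + c * w j"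
      have n0: "nsq C ?u = 1 + (cmod c)\<^sup>2 * nsq C w"
        using w0 w by (simp add: nsq_add_scale S_def)
      then have "nsq C ?u > 0" by (simp add: add_pos_nonneg)
      moreover have "\<forall>l<n. ip C (v l) ?u = 0" using w0 w by (simp add: ip_add_scale_right S_def)
      ultimately have "nsq R (fmv C x ?u) \<le> \<mu> * nsq C ?u" by (rule bound[rotated])
      then have "\<mu> + 2 * Re (c * g) + (cmod c)\<^sup>2 * nsq R (fmv C x w) \<le> \<mu> * (1 + (cmod c)\<^sup>2 * nsq C w)"
        unfolding n0 by (simp only: fmv_add_scale nsq_add_scale \<mu>_def g_def)
      then have "2 * Re (c * g) \<le> (cmod c)\<^sup>2 * B" by (simp add: B_def algebra_simps)
      moreover have "Re (c * g) = t * (cmod g)\<^sup>2"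
        unfolding c_def cmod_power2 by (simp add: algebra_simps power2_eq_square)
      moreover have "(cmod c)\<^sup>2 = t\<^sup>2 * (cmod g)\<^sup>2" by (simp add: c_def norm_mult power_mult_distrib)
      ultimately have "(t * (cmod g)\<^sup>2) * 2 \<le> (t * (cmod g)\<^sup>2) * (t * B)" by (simp add: power2_eq_square algebra_simps)
      then show ?thesis using t g by (subst (asm) mult_le_cancel_left_pos) auto
    qed
    have "2 \<le> 1 / (\<bar>B\<bar> + 1) * B" by (rule key) (simp add: add_nonneg_pos)
    moreover have "1 / (\<bar>B\<bar> + 1) * B \<le> 1" by (simp add: field_simps)
    ultimately show False by linarith
  qed
  with w0 show ?thesis unfolding S_def by blast
qed

text \<open>
  Vectors are chosen greedily; the image of each one is orthogonal to the images of all vectors that can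
  still be chosen later.
\<close>

theorem right_singular_exists:
  assumes fC: "finite C"
  shows "\<exists>v. right_singular R C x v"
proof -
  have "\<exists>v. orthonormal {..<n} C v \<and> (\<forall>k<n. \<forall>w. (\<forall>l\<le>k. ip C (v l) w = 0) \<longrightarrow>
      ip R (fmv C x (v k)) (fmv C x w) = 0)" if "n \<le> card C" for n using that
  proof (induction n)
    case 0 show ?case by (auto simp: orthonormal_def)
  next
    case (Suc n)
    then obtain v where v: "orthonormal {..<n} C v" "\<And>k w. k < n \<Longrightarrow> (\<forall>l\<le>k. ip C (v l) w = 0) \<Longrightarrow>
      ip R (fmv C x (v k)) (fmv C x w) = 0" by auto
    from singular_vector_exists[OF fC v(1), of R x] Suc.prems obtain w0 where
      w0: "nsq C w0 = 1" "\<And>l. l < n \<Longrightarrow> ip C (v l) w0 = 0"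
       "\<And>w. (\<forall>l<n. ip C (v l) w = 0) \<Longrightarrow> ip C w0 w = 0 \<Longrightarrow> ip R (fmv C x w0) (fmv C x w) = 0" by auto
    have w0': "ip C w0 (v l) = 0" if "l < n" for l using w0(2)[OF that] by (metis complex_cnj_zero ip_cnj)
    show ?case
    proof (intro exI[of _ "v(n := w0)"] conjI allI impI)
      show "orthonormal {..<Suc n} C (v(n := w0))"
        using v(1) orthonormalD(2)[OF v(1)] w0(1,2) w0' by (auto simp: orthonormal_def less_Suc_eq ip_self)
      fix k w assume k: "k < Suc n" and w: "\<forall>l\<le>k. ip C ((v(n := w0)) l) w = 0"
      show "ip R (fmv C x ((v(n := w0)) k)) (fmv C x w) = 0"
      proof (cases "k = n")
        case True with w show ?thesis by (auto intro!: w0(3) dest: spec[of _ n]) (metis less_imp_le_nat less_not_refl)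
      next
        case False with k w show ?thesis by (auto intro!: v(2))
      qed
    qed
  qed
  from this[OF order_refl] obtain v where v: "orthonormal {..<card C} C v"
     "\<And>k w. k < card C \<Longrightarrow> (\<forall>l\<le>k. ip C (v l) w = 0) \<Longrightarrow> ip R (fmv C x (v k)) (fmv C x w) = 0" by auto
  obtain h where h: "bij_betw h C {..<card C}" using fC by (metis ex_bij_betw_finite_nat atLeast0LessThan)
  then have inj: "inj_on h C" and im: "\<And>k. k \<in> C \<Longrightarrow> h k < card C" by (auto simp: bij_betw_def)
  have lt: "ip R (fmv C x (v k)) (fmv C x (v l)) = 0" if "k < l" "l < card C" for k l
    using that v(1) by (intro v(2)) (auto simp: orthonormal_def)
  have ne: "ip R (fmv C x (v k)) (fmv C x (v l)) = 0" if "k \<noteq> l" "k < card C" "l < card C" for k l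
    using lt[of k l] lt[of l k] that by (metis complex_cnj_zero ip_cnj linorder_neqE_nat)
  have "right_singular R C x (\<lambda>k. v (h k))"
    unfolding right_singular_def orthonormal_def
    using v(1) inj im by (auto simp: orthonormal_def inj_on_def intro!: ne)
  then show ?thesis by blast
qed

section \<open>Powers of singular values\<close>

definition sbasis :: "'i set \<Rightarrow> 'i set \<Rightarrow> 'i mat \<Rightarrow> 'i \<Rightarrow> 'i \<Rightarrow> complex" where
  "sbasis R C x = (SOME v. right_singular R C x v)"

text \<open>
  The squares of the singular values of the \<open>R \<times> C\<close> submatrix.
\<close>

definition sq_sval :: "'i set \<Rightarrow> 'i set \<Rightarrow> 'i mat \<Rightarrow> 'i \<Rightarrow> real" where
  "sq_sval R C x k = nsq R (fmv C x (sbasis R C x k))"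

text \<open>
  The \<open>p\<close>-th power of the Schatten norm of the \<open>R \<times> C\<close> submatrix.
\<close>

definition schatten_sum :: "real \<Rightarrow> 'i set \<Rightarrow> 'i set \<Rightarrow> 'i mat \<Rightarrow> real" where
  "schatten_sum p R C x = (\<Sum>k\<in>C. sq_sval R C x k powr (p/2))"

text \<open>
  The matrix \<open>f(y\<^sup>* y)\<close> for the \<open>R \<times> C\<close> submatrix \<open>y\<close> of \<open>x\<close>.  Here \<open>f\<close> is an arbitrary function, and
  \<open>gram_fun_eq\<close> shows that the chosen eigenbasis does not matter.
\<close>

definition gram_fun :: "(real \<Rightarrow> real) \<Rightarrow> 'i set \<Rightarrow> 'i set \<Rightarrow> 'i mat \<Rightarrow> 'i mat" where
  "gram_fun f R C x i j = (if i \<in> C \<and> j \<in> C then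
     \<Sum>k\<in>C. of_real (f (sq_sval R C x k)) * sbasis R C x k i * cnj (sbasis R C x k j) else 0)"

lemma sbasis: "finite C \<Longrightarrow> right_singular R C x (sbasis R C x)"
  unfolding sbasis_def by (rule someI_ex[OF right_singular_exists])

lemma sq_sval_nonneg [simp]: "0 \<le> sq_sval R C x k"
  by (simp add: sq_sval_def)

lemma schatten_sum_nonneg [simp]: "0 \<le> schatten_sum p R C x"
  by (simp add: schatten_sum_def sum_nonneg)

lemma right_singular_orthonormal: "right_singular R C x v \<Longrightarrow> orthonormal C C v"
  by (simp add: right_singular_def)

lemma right_singular_gram:
  assumes "finite C" "right_singular R C x v" "k \<in> C"
  shows "ip R (fmv C x (v k)) (fmv C x w) = of_real (nsq R (fmv C x (v k))) * ip C (v k) w"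
proof -
  have on: "orthonormal C C v" using assms by (simp add: right_singular_def)
  have "fmv C x w = fmv C x (\<lambda>i. \<Sum>l\<in>C. ip C (v l) w * v l i)"
    by (rule fmv_cong) (simp add: orthonormal_expand[OF assms(1,1) on])
  then have "ip R (fmv C x (v k)) (fmv C x w) = (\<Sum>l\<in>C. ip C (v l) w * ip R (fmv C x (v k)) (fmv C x (v l)))"
    by (simp add: fmv_sum ip_sum_right)
  also have "\<dots> = (\<Sum>l\<in>C. if l = k then ip C (v k) w * ip R (fmv C x (v k)) (fmv C x (v k)) else 0)"
    using assms by (intro sum.cong) (auto simp: right_singular_def)
  also have "\<dots> = of_real (nsq R (fmv C x (v k))) * ip C (v k) w"
    using assms by (simp add: ip_self mult.commute)
  finally show ?thesis .
qed

lemma nsq_fmv_expand: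
  assumes "finite C" "right_singular R C x v"
  shows "nsq R (fmv C x w) = (\<Sum>l\<in>C. (cmod (ip C (v l) w))\<^sup>2 * nsq R (fmv C x (v l)))"
proof -
  have on: "orthonormal C C v" using assms by (simp add: right_singular_def)
  have "fmv C x w = fmv C x (\<lambda>i. \<Sum>l\<in>C. ip C (v l) w * v l i)"
    by (rule fmv_cong) (simp add: orthonormal_expand[OF assms(1,1) on])
  then have "nsq R (fmv C x w) = nsq R (\<lambda>i. \<Sum>l\<in>C. ip C (v l) w * fmv C x (v l) i)"
    by (simp add: fmv_sum)
  also have "\<dots> = (\<Sum>l\<in>C. (cmod (ip C (v l) w))\<^sup>2 * nsq R (fmv C x (v l)))"
    using assms by (intro nsq_sum_orthogonal) (auto simp: right_singular_def)
  finally show ?thesis .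
qed

text \<open>
  Eigenvectors of a hermitian matrix for different eigenvalues are orthogonal.
\<close>

lemma right_singular_match:
  assumes "finite C" "right_singular R C x v" "right_singular R C x w" "k \<in> C" "l \<in> C"
  shows "ip C (w l) (v k) = 0 \<or> nsq R (fmv C x (v k)) = nsq R (fmv C x (w l))"
proof -
  have "ip R (fmv C x (w l)) (fmv C x (v k)) = cnj (ip R (fmv C x (v k)) (fmv C x (w l)))"
    by (simp add: ip_cnj)
  then have "of_real (nsq R (fmv C x (w l))) * ip C (w l) (v k)
     = of_real (nsq R (fmv C x (v k))) * ip C (w l) (v k)"
    using assms by (simp add: right_singular_gram ip_cnj)
  then show ?thesis by auto
qed

lemma gram_fun_eq:
  assumes "finite C" "right_singular R C x v" "i \<in> C" "j \<in> C"
  shows "gram_fun f R C x i j = (\<Sum>k\<in>C. of_real (f (nsq R (fmv C x (v k)))) * v k i * cnj (v k j))"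
proof -
  let ?w = "sbasis R C x"
  have w: "right_singular R C x ?w" by (rule sbasis[OF assms(1)])
  note on = right_singular_orthonormal[OF assms(2)] right_singular_orthonormal[OF w]
  have "(\<Sum>k\<in>C. of_real (f (nsq R (fmv C x (v k)))) * v k i * cnj (v k j))
     = (\<Sum>k\<in>C. of_real (f (nsq R (fmv C x (v k)))) * (\<Sum>l\<in>C. ip C (?w l) (v k) * ?w l i) * cnj (v k j))"
    by (intro sum.cong refl) (simp add: orthonormal_expand[OF assms(1,1) on(2)] assms)
  also have "\<dots> = (\<Sum>k\<in>C. \<Sum>l\<in>C. (of_real (f (nsq R (fmv C x (v k)))) * ip C (?w l) (v k)) * ?w l i * cnj (v k j))"
    by (simp add: sum_distrib_left sum_distrib_right mult_ac)
  also have "\<dots> = (\<Sum>k\<in>C. \<Sum>l\<in>C. (of_real (f (sq_sval R C x l)) * ip C (?w l) (v k)) * ?w l i * cnj (v k j))"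
  proof (intro sum.cong refl)
    fix k l assume "k \<in> C" "l \<in> C"
    with right_singular_match[OF assms(1,2) w]
    show "(of_real (f (nsq R (fmv C x (v k)))) * ip C (?w l) (v k)) * ?w l i * cnj (v k j)
      = (of_real (f (sq_sval R C x l)) * ip C (?w l) (v k)) * ?w l i * cnj (v k j)"
      unfolding sq_sval_def by fastforce
  qed
  also have "\<dots> = (\<Sum>l\<in>C. of_real (f (sq_sval R C x l)) * ?w l i * cnj (\<Sum>k\<in>C. ip C (v k) (?w l) * v k j))"
    by (subst sum.swap) (simp add: sum_distrib_left sum_distrib_right mult_ac ip_cnj)
  also have "\<dots> = gram_fun f R C x i j"
    unfolding gram_fun_def using assms by (simp add: orthonormal_expand[OF assms(1,1) on(1)])
  finally show ?thesis by simp
qed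

lemma gram_fun_trace:
  assumes "finite C" "right_singular R C x v"
  shows "(\<Sum>i\<in>C. gram_fun f R C x i i) = of_real (\<Sum>k\<in>C. f (nsq R (fmv C x (v k))))"
proof -
  have "(\<Sum>i\<in>C. gram_fun f R C x i i) = (\<Sum>i\<in>C. \<Sum>k\<in>C. of_real (f (nsq R (fmv C x (v k)))) * (cnj (v k i) * v k i))"
    by (intro sum.cong refl) (simp add: gram_fun_eq[OF assms] mult_ac)
  also have "\<dots> = (\<Sum>k\<in>C. of_real (f (nsq R (fmv C x (v k)))) * ip C (v k) (v k))"
    by (subst sum.swap) (simp add: ip_def sum_distrib_left)
  also have "\<dots> = of_real (\<Sum>k\<in>C. f (nsq R (fmv C x (v k))))"
    using orthonormalD(2)[OF right_singular_orthonormal[OF assms(2)]] by (simp add: ip_self)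
  finally show ?thesis .
qed

lemma schatten_sum_eq:
  assumes "finite C" "right_singular R C x v"
  shows "schatten_sum p R C x = (\<Sum>k\<in>C. nsq R (fmv C x (v k)) powr (p/2))"
proof -
  have "complex_of_real (schatten_sum p R C x) = of_real (\<Sum>k\<in>C. nsq R (fmv C x (v k)) powr (p/2))"
    using gram_fun_trace[OF assms, of "\<lambda>t. t powr (p/2)"] gram_fun_trace[OF assms(1) sbasis[OF assms(1)], of "\<lambda>t. t powr (p/2)" R x]
    by (simp add: schatten_sum_def sq_sval_def)
  then show ?thesis by (simp only: of_real_eq_iff)
qed

lemma schatten_sum_trace:
  assumes "finite C" shows "schatten_sum p R C x = (\<Sum>i\<in>C. Re (gram_fun (\<lambda>t. t powr (p/2)) R C x i i))"
  using arg_cong[OF gram_fun_trace[OF assms sbasis[OF assms], of "\<lambda>t. t powr (p/2)" R x], of Re]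
  by (simp add: schatten_sum_def sq_sval_def)

section \<open>Peierls inequalities\<close>

text \<open>
  Peierls' inequality.  The number \<open>\<parallel>x u\<^sub>k\<parallel>\<^sup>2\<close> is an average of the eigenvalues of \<open>x\<^sup>* x\<close> with the
  weights \<open>\<bar>\<langle>v\<^sub>l, u\<^sub>k\<rangle>\<bar>\<^sup>2\<close>; Jensen's inequality is applied for each \<open>k\<close>, and Bessel's inequality bounds the
  weights summed over \<open>k\<close>.
\<close>

lemma schatten_sum_ge_orthonormal:
  assumes "2 \<le> p" "finite C" "finite K" "orthonormal K C u"
  shows "(\<Sum>k\<in>K. nsq R (fmv C x (u k)) powr (p/2)) \<le> schatten_sum p R C x"
proof -
  let ?v = "sbasis R C x"
  have v: "right_singular R C x ?v" by (rule sbasis[OF assms(2)])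
  note on = right_singular_orthonormal[OF v]
  have "(\<Sum>k\<in>K. nsq R (fmv C x (u k)) powr (p/2))
      \<le> (\<Sum>k\<in>K. \<Sum>l\<in>C. (cmod (ip C (?v l) (u k)))\<^sup>2 * sq_sval R C x l powr (p/2))"
  proof (rule sum_mono)
    fix k assume k: "k \<in> K"
    have "(\<Sum>l\<in>C. (cmod (ip C (?v l) (u k)))\<^sup>2) \<le> 1"
      using bessel[OF assms(2) on, of "u k"] orthonormalD(2)[OF assms(4) k] by simp
    then show "nsq R (fmv C x (u k)) powr (p/2) \<le> (\<Sum>l\<in>C. (cmod (ip C (?v l) (u k)))\<^sup>2 * sq_sval R C x l powr (p/2))"
      unfolding nsq_fmv_expand[OF assms(2) v, of "u k"] sq_sval_def
      by (intro sum_powr_Jensen) (use assms in auto)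
  qed
  also have "\<dots> = (\<Sum>l\<in>C. (\<Sum>k\<in>K. (cmod (ip C (u k) (?v l)))\<^sup>2) * sq_sval R C x l powr (p/2))"
    by (subst sum.swap) (simp add: sum_distrib_right cmod_ip_commute[of C "?v _"])
  also have "\<dots> \<le> (\<Sum>l\<in>C. 1 * sq_sval R C x l powr (p/2))"
  proof (intro sum_mono mult_right_mono)
    fix l assume "l \<in> C"
    then show "(\<Sum>k\<in>K. (cmod (ip C (u k) (?v l)))\<^sup>2) \<le> 1"
      using bessel[OF assms(3,4), of "?v l"] orthonormalD(2)[OF on] by simp
  qed simp
  finally show ?thesis by (simp add: schatten_sum_def)
qed

text \<open>
  The concave counterpart.  Here the family has to be complete, so that the weights sum to 1 in both
  indices.
\<close>

lemma schatten_sum_le_orthonormal: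
  assumes "0 < p" "p \<le> 2" "finite C" "orthonormal C C u"
  shows "schatten_sum p R C x \<le> (\<Sum>k\<in>C. nsq R (fmv C x (u k)) powr (p/2))"
proof -
  let ?v = "sbasis R C x"
  have v: "right_singular R C x ?v" by (rule sbasis[OF assms(3)])
  note on = right_singular_orthonormal[OF v]
  have "schatten_sum p R C x = (\<Sum>l\<in>C. (\<Sum>k\<in>C. (cmod (ip C (u k) (?v l)))\<^sup>2) * sq_sval R C x l powr (p/2))"
    unfolding schatten_sum_def
    by (intro sum.cong refl) (simp add: parseval[OF assms(3,3,4)] orthonormalD(2)[OF on])
  also have "\<dots> = (\<Sum>k\<in>C. \<Sum>l\<in>C. (cmod (ip C (?v l) (u k)))\<^sup>2 * sq_sval R C x l powr (p/2))"
    by (subst sum.swap) (simp add: sum_distrib_right cmod_ip_commute[of C "?v _"])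
  also have "\<dots> \<le> (\<Sum>k\<in>C. nsq R (fmv C x (u k)) powr (p/2))"
  proof (rule sum_mono)
    fix k assume k: "k \<in> C"
    have "(\<Sum>l\<in>C. (cmod (ip C (?v l) (u k)))\<^sup>2) = 1"
      using parseval[OF assms(3,3) on, of "u k"] orthonormalD(2)[OF assms(4) k] by simp
    then show "(\<Sum>l\<in>C. (cmod (ip C (?v l) (u k)))\<^sup>2 * sq_sval R C x l powr (p/2)) \<le> nsq R (fmv C x (u k)) powr (p/2)"
      unfolding nsq_fmv_expand[OF assms(3) v, of "u k"] sq_sval_def
      by (intro sum_powr_Jensen_concave) (use assms in auto)
  qed
  finally show ?thesis .
qed

section \<open>Left and right singular vectors\<close>

text \<open>
  Since \<open>x\<close> intertwines \<open>x\<^sup>* x\<close> and \<open>x x\<^sup>*\<close>, its matrix with respect to right and left singular bases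
  only connects vectors with the same eigenvalue.
\<close>

lemma cross_match:
  assumes "finite R" "finite C" and w: "right_singular R C x w" and y: "right_singular C R (mat_adjoint x) y"
    and l: "l \<in> C" and m: "m \<in> R"
  shows "ip R (y m) (fmv C x (w l)) = 0 \<or>
    (nsq C (fmv R (mat_adjoint x) (y m)) = nsq R (fmv C x (w l)) \<and> nsq R (fmv C x (w l)) > 0)"
proof -
  let ?c = "ip R (y m) (fmv C x (w l))"
  let ?\<mu> = "nsq R (fmv C x (w l))" and ?\<nu> = "nsq C (fmv R (mat_adjoint x) (y m))"
  have c: "ip C (w l) (fmv R (mat_adjoint x) (y m)) = cnj ?c"
    by (subst ip_cnj[symmetric]) (simp add: ip_fmv_adjoint)
  have e1: "ip R (fmv C x (w l)) (fmv C x (fmv R (mat_adjoint x) (y m))) = of_real ?\<mu> * cnj ?c"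
    by (simp only: right_singular_gram[OF assms(2) w l] c)
  have e2: "ip R (fmv C x (w l)) (fmv C x (fmv R (mat_adjoint x) (y m)))
      = cnj (ip C (fmv R (mat_adjoint x) (y m)) (fmv R (mat_adjoint x) (fmv C x (w l))))"
    by (simp add: ip_cnj ip_fmv_adjoint)
  have e3: "ip C (fmv R (mat_adjoint x) (y m)) (fmv R (mat_adjoint x) (fmv C x (w l))) = of_real ?\<nu> * ?c"
    by (simp only: right_singular_gram[OF assms(1) y m])
  have "of_real ?\<mu> * cnj ?c = of_real ?\<nu> * cnj ?c"
    using e1 unfolding e2 e3 by (simp only: complex_cnj_mult complex_cnj_complex_of_real)
  then have "?c = 0 \<or> ?\<nu> = ?\<mu>" by auto
  moreover have "?c = 0" if "?\<mu> = 0"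
    using cauchy_schwarz[OF assms(1), of "y m" "fmv C x (w l)"] that by simp
  moreover have "?\<mu> = 0 \<or> ?\<mu> > 0" using nsq_nonneg[of R "fmv C x (w l)"] by (auto simp: less_le)
  ultimately show ?thesis by blast
qed

lemma cross_sums:
  assumes "finite R" "finite C" and w: "right_singular R C x w" and y: "right_singular C R (mat_adjoint x) y"
  shows "(\<Sum>m\<in>R. (cmod (ip R (y m) (fmv C x (w l))))\<^sup>2) = nsq R (fmv C x (w l))"
    and "(\<Sum>l\<in>C. (cmod (ip R (y m) (fmv C x (w l))))\<^sup>2) = nsq C (fmv R (mat_adjoint x) (y m))"
proof -
  show "(\<Sum>m\<in>R. (cmod (ip R (y m) (fmv C x (w l))))\<^sup>2) = nsq R (fmv C x (w l))"
    by (rule parseval[OF assms(1,1) right_singular_orthonormal[OF y] refl])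
  have "(\<Sum>l\<in>C. (cmod (ip C (w l) (fmv R (mat_adjoint x) (y m))))\<^sup>2) = nsq C (fmv R (mat_adjoint x) (y m))"
    by (rule parseval[OF assms(2,2) right_singular_orthonormal[OF w] refl])
  then show "(\<Sum>l\<in>C. (cmod (ip R (y m) (fmv C x (w l))))\<^sup>2) = nsq C (fmv R (mat_adjoint x) (y m))"
    by (simp add: ip_fmv_adjoint[of R "y m"] cmod_ip_commute[of C "fmv R _ _"])
qed

text \<open>
  Both sides are equal to the sum of \<open>t powr (p/2 - 1) * \<bar>\<langle>y\<^sub>m, x w\<^sub>l\<rangle>\<bar>\<^sup>2\<close> over all pairs, where \<open>t\<close> is the
  common eigenvalue of the pair.
\<close>

lemma schatten_sum_adjoint:
  assumes "finite R" "finite C"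
  shows "schatten_sum p C R (mat_adjoint x) = schatten_sum p R C x"
proof -
  let ?w = "sbasis R C x" and ?y = "sbasis C R (mat_adjoint x)"
  let ?\<mu> = "sq_sval R C x" and ?\<nu> = "sq_sval C R (mat_adjoint x)"
  let ?c = "\<lambda>m l. (cmod (ip R (?y m) (fmv C x (?w l))))\<^sup>2"
  have w: "right_singular R C x ?w" and y: "right_singular C R (mat_adjoint x) ?y"
    using assms by (auto intro: sbasis)
  note cs = cross_sums[OF assms w y, folded sq_sval_def]
  note cm = cross_match[OF assms w y, folded sq_sval_def]
  have pw: "t powr (p/2) = t powr (p/2 - 1) * t" if "t \<ge> 0" for t :: real
    using that by (cases "t = 0") (auto simp: powr_diff)
  have "schatten_sum p R C x = (\<Sum>l\<in>C. \<Sum>m\<in>R. ?\<mu> l powr (p/2 - 1) * ?c m l)"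
    unfolding schatten_sum_def
    by (intro sum.cong refl) (simp only: sum_distrib_left[symmetric] cs, simp only: pw sq_sval_nonneg)
  also have "\<dots> = (\<Sum>l\<in>C. \<Sum>m\<in>R. ?\<nu> m powr (p/2 - 1) * ?c m l)"
    using cm by (intro sum.cong refl) (metis mult_zero_right norm_zero zero_power2)
  also have "\<dots> = (\<Sum>m\<in>R. \<Sum>l\<in>C. ?\<nu> m powr (p/2 - 1) * ?c m l)" by (rule sum.swap)
  also have "\<dots> = schatten_sum p C R (mat_adjoint x)"
    unfolding schatten_sum_def
    by (intro sum.cong refl) (simp only: sum_distrib_left[symmetric] cs, simp only: pw sq_sval_nonneg)
  finally show ?thesis by simp
qed

text \<open>
  In terms of absolute values this reads \<open>\<bar>\<langle>u, x v\<rangle>\<bar>\<^sup>2 \<le> \<langle>v, \<bar>x\<bar> v\<rangle> * \<langle>u, \<bar>x\<^sup>*\<bar> u\<rangle>\<close>.  It is the Cauchy-Schwarz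
  inequality after replacing \<open>v\<close> by \<open>\<bar>x\<bar> powr (-1/2)\<close> applied to \<open>v\<close> and \<open>u\<close> by \<open>\<bar>x\<^sup>*\<bar> powr (1/2)\<close>
  applied to \<open>u\<close>, which does not change \<open>\<langle>u, x v\<rangle>\<close>; in terms of the eigenvalues of \<open>x\<^sup>* x\<close> these are fourth
  roots.
\<close>

lemma mixed_schwarz:
  assumes "finite R" "finite C" and w: "right_singular R C x w" and y: "right_singular C R (mat_adjoint x) y"
  shows "(cmod (ip R u (fmv C x v)))\<^sup>2 \<le>
     (\<Sum>l\<in>C. (cmod (ip C (w l) v))\<^sup>2 * sqrt (nsq R (fmv C x (w l)))) *
     (\<Sum>m\<in>R. (cmod (ip R (y m) u))\<^sup>2 * sqrt (nsq C (fmv R (mat_adjoint x) (y m))))"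
proof -
  define \<mu> where "\<mu> l = nsq R (fmv C x (w l))" for l
  define \<nu> where "\<nu> m = nsq C (fmv R (mat_adjoint x) (y m))" for m
  define a where "a l = ip C (w l) v" for l
  define b where "b m = ip R (y m) u" for m
  define v' where "v' = (\<lambda>i. \<Sum>l\<in>C. (of_real (\<mu> l powr (-1/4)) * a l) * w l i)"
  define u' where "u' = (\<lambda>i. \<Sum>m\<in>R. (of_real (\<nu> m powr (1/4)) * b m) * y m i)"
  note onw = right_singular_orthonormal[OF w] and ony = right_singular_orthonormal[OF y]
  have \<mu>0: "\<mu> l \<ge> 0" "\<nu> m \<ge> 0" for l m by (auto simp: \<mu>_def \<nu>_def)
  have "ip R u (fmv C x v) = ip R (\<lambda>i. \<Sum>m\<in>R. b m * y m i) (fmv C x (\<lambda>i. \<Sum>l\<in>C. a l * w l i))"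
  proof (rule ip_cong)
    show "u i = (\<Sum>m\<in>R. b m * y m i)" if "i \<in> R" for i
      using orthonormal_expand[OF assms(1,1) ony refl that] by (simp add: b_def)
    have "fmv C x v = fmv C x (\<lambda>i. \<Sum>l\<in>C. a l * w l i)"
      by (rule fmv_cong) (simp add: a_def orthonormal_expand[OF assms(2,2) onw])
    then show "fmv C x v i = fmv C x (\<lambda>i. \<Sum>l\<in>C. a l * w l i) i" for i by simp
  qed
  also have "\<dots> = (\<Sum>m\<in>R. cnj (b m) * (\<Sum>l\<in>C. a l * ip R (y m) (fmv C x (w l))))"
    unfolding fmv_sum ip_sum_left ip_sum_right ..
  also have "\<dots> = (\<Sum>m\<in>R. cnj (of_real (\<nu> m powr (1/4)) * b m) *
      (\<Sum>l\<in>C. (of_real (\<mu> l powr (-1/4)) * a l) * ip R (y m) (fmv C x (w l))))"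
    unfolding sum_distrib_left
  proof (intro sum.cong refl)
    fix m l assume "m \<in> R" "l \<in> C"
    with cross_match[OF assms] have "ip R (y m) (fmv C x (w l)) = 0 \<or> \<nu> m = \<mu> l \<and> \<mu> l > 0"
      unfolding \<mu>_def \<nu>_def by blast
    moreover have "complex_of_real (t powr (1/4)) * of_real (t powr (-1/4)) = 1" if "t > 0" for t
      using that unfolding of_real_mult[symmetric] powr_add[symmetric] by simp
    ultimately show "cnj (b m) * (a l * ip R (y m) (fmv C x (w l))) = cnj (of_real (\<nu> m powr (1/4)) * b m) *
      ((of_real (\<mu> l powr (-1/4)) * a l) * ip R (y m) (fmv C x (w l)))"
      by (elim disjE) (simp, simp add: mult_ac)
  qed
  also have "\<dots> = ip R u' (fmv C x v')"
    unfolding u'_def v'_def fmv_sum ip_sum_left ip_sum_right ..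
  finally have eq: "ip R u (fmv C x v) = ip R u' (fmv C x v')" .
  have nv: "nsq R (fmv C x v') = (\<Sum>l\<in>C. (cmod (a l))\<^sup>2 * sqrt (\<mu> l))"
  proof -
    have "nsq R (fmv C x v') = (\<Sum>l\<in>C. (cmod (of_real (\<mu> l powr (-1/4)) * a l))\<^sup>2 * \<mu> l)"
      unfolding v'_def fmv_sum \<mu>_def
      by (rule nsq_sum_orthogonal) (use assms w in \<open>auto simp: right_singular_def\<close>)
    also have "\<dots> = (\<Sum>l\<in>C. (cmod (a l))\<^sup>2 * sqrt (\<mu> l))"
    proof (intro sum.cong refl)
      fix l
      have "(t powr (-1/4))\<^sup>2 * t = sqrt t" if "t \<ge> 0" for t :: real
      proof (cases "t = 0")
        case False
        with that have "(t powr (-1/4))\<^sup>2 * t powr 1 = t powr (1/2)"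
          unfolding power2_eq_square powr_add[symmetric] by simp
        with that False show ?thesis by (simp add: powr_half_sqrt)
      qed simp
      from this[OF \<mu>0(1)[of l]] show "(cmod (of_real (\<mu> l powr (-1/4)) * a l))\<^sup>2 * \<mu> l = (cmod (a l))\<^sup>2 * sqrt (\<mu> l)"
        by (simp add: norm_mult power_mult_distrib mult_ac)
    qed
    finally show ?thesis .
  qed
  have nu: "nsq R u' = (\<Sum>m\<in>R. (cmod (b m))\<^sup>2 * sqrt (\<nu> m))"
  proof -
    have "nsq R u' = (\<Sum>m\<in>R. (cmod (of_real (\<nu> m powr (1/4)) * b m))\<^sup>2)"
      unfolding u'_def by (rule nsq_sum_orthonormal[OF assms(1) ony])
    also have "\<dots> = (\<Sum>m\<in>R. (cmod (b m))\<^sup>2 * sqrt (\<nu> m))"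
    proof (intro sum.cong refl)
      fix m
      have "(t powr (1/4))\<^sup>2 = sqrt t" if "t \<ge> 0" for t :: real
        using that unfolding power2_eq_square powr_add[symmetric] by (simp add: powr_half_sqrt)
      from this[OF \<mu>0(2)[of m]] show "(cmod (of_real (\<nu> m powr (1/4)) * b m))\<^sup>2 = (cmod (b m))\<^sup>2 * sqrt (\<nu> m)"
        by (simp add: norm_mult power_mult_distrib mult_ac)
    qed
    finally show ?thesis .
  qed
  show ?thesis
    using cauchy_schwarz[OF assms(1), of u' "fmv C x v'"]
    unfolding eq[symmetric] nv nu a_def b_def \<mu>_def \<nu>_def by (simp add: mult.commute)
qed

lemma sqrt_powr: "t \<ge> 0 \<Longrightarrow> (sqrt t) powr p = t powr (p/2)" for t :: real
  by (simp add: powr_half_sqrt[symmetric] powr_powr)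

text \<open>
  The mixed Schwarz inequality is raised to the power \<open>p/2\<close>, the product is bounded by an arithmetic mean
  and Jensen's inequality is applied to each factor.  The sums over \<open>k\<close> are not yet estimated, because
  families supported on a part of the index set allow a better bound than 1.
\<close>

lemma bilinear_sum_le:
  assumes p: "1 \<le> p" and fin: "finite R" "finite C" "finite K"
    and w: "right_singular R C x w" and y: "right_singular C R (mat_adjoint x) y"
    and v: "orthonormal K C v" and u: "orthonormal K R u"
  shows "(\<Sum>k\<in>K. cmod (ip R (u k) (fmv C x (v k))) powr p) \<le>
     ((\<Sum>l\<in>C. (\<Sum>k\<in>K. (cmod (ip C (v k) (w l)))\<^sup>2) * nsq R (fmv C x (w l)) powr (p/2)) +
      (\<Sum>m\<in>R. (\<Sum>k\<in>K. (cmod (ip R (u k) (y m)))\<^sup>2) * nsq C (fmv R (mat_adjoint x) (y m)) powr (p/2))) / 2"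
proof -
  define \<mu> where "\<mu> l = nsq R (fmv C x (w l))" for l
  define \<nu> where "\<nu> m = nsq C (fmv R (mat_adjoint x) (y m))" for m
  have \<mu>0: "\<mu> l \<ge> 0" "\<nu> m \<ge> 0" for l m by (auto simp: \<mu>_def \<nu>_def)
  have "cmod (ip R (u k) (fmv C x (v k))) powr p \<le>
      ((\<Sum>l\<in>C. (cmod (ip C (w l) (v k)))\<^sup>2 * \<mu> l powr (p/2)) +
       (\<Sum>m\<in>R. (cmod (ip R (y m) (u k)))\<^sup>2 * \<nu> m powr (p/2))) / 2" if k: "k \<in> K" for k
  proof -
    define a where "a = (\<Sum>l\<in>C. (cmod (ip C (w l) (v k)))\<^sup>2 * sqrt (\<mu> l))"
    define b where "b = (\<Sum>m\<in>R. (cmod (ip R (y m) (u k)))\<^sup>2 * sqrt (\<nu> m))"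
    have ab: "a \<ge> 0" "b \<ge> 0" unfolding a_def b_def by (auto intro!: sum_nonneg mult_nonneg_nonneg simp: \<mu>0)
    let ?z = "cmod (ip R (u k) (fmv C x (v k)))"
    have "?z\<^sup>2 \<le> a * b" using mixed_schwarz[OF fin(1,2) w y, of "u k" "v k"] by (simp add: a_def b_def \<mu>_def \<nu>_def)
    then have "(?z\<^sup>2) powr (p/2) \<le> (a * b) powr (p/2)" using p by (intro powr_mono2) auto
    also have "(?z\<^sup>2) powr (p/2) = ?z powr p" by (subst sqrt_powr[symmetric]) auto
    also have "(a * b) powr (p/2) = a powr (p/2) * b powr (p/2)" using ab by (simp add: powr_mult)
    also have "\<dots> \<le> ((a powr (p/2))\<^sup>2 + (b powr (p/2))\<^sup>2) / 2"
      using sum_squares_bound[of "a powr (p/2)" "b powr (p/2)"] by simp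
    also have "\<dots> = (a powr p + b powr p) / 2"
      unfolding power2_eq_square powr_add[symmetric] by simp
    also have "a powr p \<le> (\<Sum>l\<in>C. (cmod (ip C (w l) (v k)))\<^sup>2 * sqrt (\<mu> l) powr p)"
      unfolding a_def
    proof (rule sum_powr_Jensen[OF p])
      show "(\<Sum>l\<in>C. (cmod (ip C (w l) (v k)))\<^sup>2) \<le> 1"
        using bessel[OF fin(2) right_singular_orthonormal[OF w], of "v k"] orthonormalD(2)[OF v k] by simp
    qed (auto simp: \<mu>0)
    also have "b powr p \<le> (\<Sum>m\<in>R. (cmod (ip R (y m) (u k)))\<^sup>2 * sqrt (\<nu> m) powr p)"
      unfolding b_def
    proof (rule sum_powr_Jensen[OF p])
      show "(\<Sum>m\<in>R. (cmod (ip R (y m) (u k)))\<^sup>2) \<le> 1"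
        using bessel[OF fin(1) right_singular_orthonormal[OF y], of "u k"] orthonormalD(2)[OF u k] by simp
    qed (auto simp: \<mu>0)
    finally show ?thesis by (simp add: sqrt_powr \<mu>0)
  qed
  then have "(\<Sum>k\<in>K. cmod (ip R (u k) (fmv C x (v k))) powr p) \<le>
    (\<Sum>k\<in>K. ((\<Sum>l\<in>C. (cmod (ip C (w l) (v k)))\<^sup>2 * \<mu> l powr (p/2)) +
       (\<Sum>m\<in>R. (cmod (ip R (y m) (u k)))\<^sup>2 * \<nu> m powr (p/2))) / 2)" by (rule sum_mono)
  also have "\<dots> = ((\<Sum>k\<in>K. \<Sum>l\<in>C. (cmod (ip C (w l) (v k)))\<^sup>2 * \<mu> l powr (p/2)) +
       (\<Sum>k\<in>K. \<Sum>m\<in>R. (cmod (ip R (y m) (u k)))\<^sup>2 * \<nu> m powr (p/2))) / 2"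
    by (simp add: sum.distrib sum_divide_distrib[symmetric])
  also have "(\<Sum>k\<in>K. \<Sum>l\<in>C. (cmod (ip C (w l) (v k)))\<^sup>2 * \<mu> l powr (p/2))
      = (\<Sum>l\<in>C. (\<Sum>k\<in>K. (cmod (ip C (v k) (w l)))\<^sup>2) * \<mu> l powr (p/2))"
    by (subst sum.swap) (simp add: sum_distrib_right cmod_ip_commute[of C "w _"])
  also have "(\<Sum>k\<in>K. \<Sum>m\<in>R. (cmod (ip R (y m) (u k)))\<^sup>2 * \<nu> m powr (p/2))
      = (\<Sum>m\<in>R. (\<Sum>k\<in>K. (cmod (ip R (u k) (y m)))\<^sup>2) * \<nu> m powr (p/2))"
    by (subst sum.swap) (simp add: sum_distrib_right cmod_ip_commute[of R "y _"])
  finally show ?thesis by (simp add: \<mu>_def \<nu>_def)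
qed

lemma le_half_sum: "t \<le> (a + b) / 2 \<Longrightarrow> a \<le> P \<Longrightarrow> b \<le> P \<Longrightarrow> t \<le> (P::real)"
  by (simp add: field_simps)

lemma schatten_sum_ge_bilinear:
  assumes p: "1 \<le> p" and fin: "finite R" "finite C" "finite K"
    and v: "orthonormal K C v" and u: "orthonormal K R u"
  shows "(\<Sum>k\<in>K. cmod (ip R (u k) (fmv C x (v k))) powr p) \<le> schatten_sum p R C x"
proof -
  let ?w = "sbasis R C x" and ?y = "sbasis C R (mat_adjoint x)"
  have w: "right_singular R C x ?w" and y: "right_singular C R (mat_adjoint x) ?y"
    using fin by (auto intro: sbasis)
  have A: "(\<Sum>l\<in>C. (\<Sum>k\<in>K. (cmod (ip C (v k) (?w l)))\<^sup>2) * nsq R (fmv C x (?w l)) powr (p/2))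
      \<le> (\<Sum>l\<in>C. 1 * nsq R (fmv C x (?w l)) powr (p/2))"
  proof (intro sum_mono mult_right_mono)
    fix l assume "l \<in> C"
    then show "(\<Sum>k\<in>K. (cmod (ip C (v k) (?w l)))\<^sup>2) \<le> 1"
      using bessel[OF fin(3) v, of "?w l"] orthonormalD(2)[OF right_singular_orthonormal[OF w]] by simp
  qed simp
  have B: "(\<Sum>m\<in>R. (\<Sum>k\<in>K. (cmod (ip R (u k) (?y m)))\<^sup>2) * nsq C (fmv R (mat_adjoint x) (?y m)) powr (p/2))
      \<le> (\<Sum>m\<in>R. 1 * nsq C (fmv R (mat_adjoint x) (?y m)) powr (p/2))"
  proof (intro sum_mono mult_right_mono)
    fix l assume "l \<in> R"
    then show "(\<Sum>k\<in>K. (cmod (ip R (u k) (?y l)))\<^sup>2) \<le> 1"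
      using bessel[OF fin(3) u, of "?y l"] orthonormalD(2)[OF right_singular_orthonormal[OF y]] by simp
  qed simp
  have "schatten_sum p R C x = (\<Sum>l\<in>C. 1 * nsq R (fmv C x (?w l)) powr (p/2))"
       "schatten_sum p R C x = (\<Sum>m\<in>R. 1 * nsq C (fmv R (mat_adjoint x) (?y m)) powr (p/2))"
    using schatten_sum_adjoint[OF fin(1,2), of p x] by (simp_all add: schatten_sum_def sq_sval_def)
  note A' = A[folded this(1)] and B' = B[folded this(2)]
  from le_half_sum[OF bilinear_sum_le[OF p fin w y v u] A' B'] show ?thesis .
qed

text \<open>
  Together with \<open>schatten_sum_ge_bilinear\<close> this describes \<open>schatten_sum\<close> as a maximum over pairs of
  orthonormal families.  Monotonicity, subadditivity up to a constant and pinching are read off from it for all \<open>p \<ge> 1\<close> at once.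
\<close>

lemma schatten_sum_attained:
  fixes x :: "'i mat"
  assumes "finite R" "finite C"
  obtains K u v where "finite K" "orthonormal K C v" "orthonormal K R u"
    "schatten_sum p R C x = (\<Sum>k\<in>(K::'i set). cmod (ip R (u k) (fmv C x (v k))) powr p)"
proof -
  let ?v = "sbasis R C x" and ?\<mu> = "sq_sval R C x"
  define K where "K = {k \<in> C. ?\<mu> k > 0}"
  define u where "u k = (\<lambda>i. of_real (1 / sqrt (?\<mu> k)) * fmv C x (?v k) i)" for k
  have v: "right_singular R C x ?v" by (rule sbasis[OF assms(2)])
  have uip: "ip R (u k) z = of_real (1 / sqrt (?\<mu> k)) * ip R (fmv C x (?v k)) z" for k z
    by (subst ip_cnj[symmetric]) (simp add: u_def ip_scale_right ip_cnj del: of_real_divide)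
  have 1: "orthonormal K C ?v" using right_singular_orthonormal[OF v] by (auto simp: orthonormal_def K_def)
  have 2: "orthonormal K R u"
    unfolding orthonormal_def
  proof (intro ballI)
    fix k l assume kl: "k \<in> K" "l \<in> K"
    have "ip R (u k) (u l) = of_real (1 / sqrt (?\<mu> k)) * (of_real (1 / sqrt (?\<mu> l)) * ip R (fmv C x (?v k)) (fmv C x (?v l)))"
      unfolding uip unfolding u_def ip_scale_right by (rule refl)
    also have "of_real (1 / sqrt (?\<mu> k)) * (of_real (1 / sqrt (?\<mu> l)) * ip R (fmv C x (?v k)) (fmv C x (?v l))) = (if k = l then 1 else 0)"
      (is "?L = _")
    proof (cases "k = l")
      case True
      then have "?L = of_real (1 / sqrt (?\<mu> k) * (1 / sqrt (?\<mu> k) * ?\<mu> k))"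
        by (simp only: True ip_self sq_sval_def of_real_mult)
      also have "1 / sqrt (?\<mu> k) * (1 / sqrt (?\<mu> k) * ?\<mu> k) = 1" using kl by (simp add: K_def)
      finally show ?thesis using True by simp
    next
      case False with kl v show ?thesis by (simp add: right_singular_def K_def)
    qed
    finally show "ip R (u k) (u l) = (if k = l then 1 else 0)" .
  qed
  have "cmod (ip R (u k) (fmv C x (?v k))) powr p = ?\<mu> k powr (p/2)" if "k \<in> K" for k
  proof -
    have "ip R (u k) (fmv C x (?v k)) = of_real (1 / sqrt (?\<mu> k) * ?\<mu> k)"
      unfolding uip by (simp add: ip_self sq_sval_def)
    also have "1 / sqrt (?\<mu> k) * ?\<mu> k = sqrt (?\<mu> k)" using that by (simp add: K_def real_div_sqrt)
    finally show ?thesis by (simp add: sqrt_powr)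
  qed
  then have "(\<Sum>k\<in>K. cmod (ip R (u k) (fmv C x (?v k))) powr p) = (\<Sum>k\<in>K. ?\<mu> k powr (p/2))" by simp
  also have "\<dots> = schatten_sum p R C x" unfolding schatten_sum_def
    by (rule sum.mono_neutral_left) (use assms in \<open>auto simp: K_def less_le\<close>)
  finally show ?thesis using that[of K ?v u] 1 2 assms by (simp add: K_def)
qed

section \<open>Submatrices, sums and row scalings\<close>

lemma ip_transport:
  assumes "finite C'" "inj_on f C" "f ` C \<subseteq> C'"
    and "\<And>j. j \<in> C \<Longrightarrow> v' (f j) = v j" and "\<And>j'. j' \<in> C' - f ` C \<Longrightarrow> v' j' = 0"
    and "\<And>j. j \<in> C \<Longrightarrow> w' (f j) = w j"
  shows "ip C' v' w' = ip C v w"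
proof -
  have "ip C' v' w' = (\<Sum>j'\<in>f ` C. cnj (v' j') * w' j')"
    unfolding ip_def using assms by (intro sum.mono_neutral_right) auto
  also have "\<dots> = ip C v w" unfolding ip_def using assms by (simp add: sum.reindex)
  finally show ?thesis .
qed

text \<open>
  Extending an extremal pair of families by zero keeps it orthonormal.
\<close>

lemma schatten_sum_transport:
  fixes x :: "'i mat" and x' :: "'j mat"
  assumes p: "1 \<le> p" and fin: "finite R'" "finite C'"
    and f: "inj_on f C" "f ` C \<subseteq> C'" and g: "inj_on g R" "g ` R \<subseteq> R'"
    and x: "\<And>i j. i \<in> R \<Longrightarrow> j \<in> C \<Longrightarrow> x' (g i) (f j) = x i j"
  shows "schatten_sum p R C x \<le> schatten_sum p R' C' x'"
proof -
  have fin': "finite R" "finite C" using fin f g by (auto intro: inj_on_finite)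
  obtain K v u where K: "finite (K :: 'i set)" "orthonormal K C v" "orthonormal K R u"
    and schatten_sum: "schatten_sum p R C x = (\<Sum>k\<in>K. cmod (ip R (u k) (fmv C x (v k))) powr p)"
    by (rule schatten_sum_attained[OF fin', where p = p and x = x])
  define v' where "v' k = (\<lambda>j'. if j' \<in> f ` C then v k (inv_into C f j') else 0)" for k
  define u' where "u' k = (\<lambda>j'. if j' \<in> g ` R then u k (inv_into R g j') else 0)" for k
  have v'1: "v' k (f j) = v k j" if "j \<in> C" for k j using that f by (simp add: v'_def)
  have u'1: "u' k (g j) = u k j" if "j \<in> R" for k j using that g by (simp add: u'_def)
  have "ip C' (v' k) (v' l) = ip C (v k) (v l)" for k l
    by (rule ip_transport[where f = f]) (use fin f in \<open>auto simp: v'1 v'_def\<close>)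
  then have ov: "orthonormal K C' v'" using K(2) by (simp add: orthonormal_def)
  have "ip R' (u' k) (u' l) = ip R (u k) (u l)" for k l
    by (rule ip_transport[where f = g]) (use fin g in \<open>auto simp: u'1 u'_def\<close>)
  then have ou: "orthonormal K R' u'" using K(3) by (simp add: orthonormal_def)
  have fm: "fmv C' x' (v' k) (g i) = fmv C x (v k) i" if "i \<in> R" for k i
  proof -
    have "fmv C' x' (v' k) (g i) = (\<Sum>j'\<in>f ` C. x' (g i) j' * v' k j')"
      unfolding fmv_def using fin f by (intro sum.mono_neutral_right) (auto simp: v'_def)
    also have "\<dots> = fmv C x (v k) i" unfolding fmv_def using f x[OF that] by (simp add: sum.reindex v'1)
    finally show ?thesis .
  qed
  have "ip R' (u' k) (fmv C' x' (v' k)) = ip R (u k) (fmv C x (v k))" for k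
    by (rule ip_transport[where f = g]) (use fin g in \<open>auto simp: u'1 u'_def fm\<close>)
  then have "schatten_sum p R C x = (\<Sum>k\<in>K. cmod (ip R' (u' k) (fmv C' x' (v' k))) powr p)" by (simp add: schatten_sum)
  also have "\<dots> \<le> schatten_sum p R' C' x'" by (rule schatten_sum_ge_bilinear[OF p fin K(1) ov ou])
  finally show ?thesis .
qed

lemma schatten_sum_mono:
  assumes "1 \<le> p" "finite R'" "finite C'" "R \<subseteq> R'" "C \<subseteq> C'"
  shows "schatten_sum p R C x \<le> schatten_sum p R' C' x"
  using assms by (intro schatten_sum_transport[where f = id and g = id]) auto

lemma orthonormal_extend:
  assumes "finite G" "F \<subseteq> G" "orthonormal K F v"
  shows "orthonormal K G (\<lambda>k i. if i \<in> F then v k i else 0)"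
proof -
  have "ip G (\<lambda>i. if i \<in> F then a i else 0) (\<lambda>i. if i \<in> F then b i else 0) = ip F a b" for a b
    by (rule ip_transport[OF assms(1), of id]) (use assms(2) in auto)
  with assms(3) show ?thesis unfolding orthonormal_def by simp
qed

text \<open>
  The left-hand side depends on the section \<open>F\<close> alone, the right-hand side on the diagonal entries in \<open>F\<close>
  of functions of the larger section \<open>G\<close>.  The estimate therefore survives the limit over \<open>G\<close>.
\<close>

lemma schatten_sum_le_diagonal:
  fixes x :: "'i mat"
  assumes p: "1 \<le> p" and G: "finite G" "F \<subseteq> G"
  shows "schatten_sum p F F x \<le> ((\<Sum>i\<in>F. Re (gram_fun (\<lambda>t. t powr (p/2)) G G x i i)) +
      (\<Sum>i\<in>F. Re (gram_fun (\<lambda>t. t powr (p/2)) G G (mat_adjoint x) i i))) / 2"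
proof -
  have fF: "finite F" using G finite_subset by auto
  obtain K v u where K: "finite (K :: 'i set)" "orthonormal K F v" "orthonormal K F u"
    and schatten_sum: "schatten_sum p F F x = (\<Sum>k\<in>K. cmod (ip F (u k) (fmv F x (v k))) powr p)"
    by (rule schatten_sum_attained[OF fF fF, where p = p and x = x])
  let ?e = "\<lambda>v k i. if i \<in> F then v k i else (0::complex)"
  have ov: "orthonormal K G (?e v)" and ou: "orthonormal K G (?e u)"
    using orthonormal_extend[OF G] K by auto
  have ie: "ip G (?e v k) w = ip F (v k) w" for v :: "'i \<Rightarrow> 'i \<Rightarrow> complex" and k w
    by (rule ip_transport[OF G(1), of id]) (use G in auto)
  have "fmv G x (?e v k) i = fmv F x (v k) i" for k i
    unfolding fmv_def by (rule sum.mono_neutral_cong_right) (use G in auto)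
  then have "schatten_sum p F F x = (\<Sum>k\<in>K. cmod (ip G (?e u k) (fmv G x (?e v k))) powr p)"
    unfolding ie schatten_sum by (simp add: ip_def)
  also have "\<dots> \<le> ((\<Sum>l\<in>G. (\<Sum>k\<in>K. (cmod (ip G (?e v k) (sbasis G G x l)))\<^sup>2) * sq_sval G G x l powr (p/2)) +
      (\<Sum>m\<in>G. (\<Sum>k\<in>K. (cmod (ip G (?e u k) (sbasis G G (mat_adjoint x) m)))\<^sup>2) * sq_sval G G (mat_adjoint x) m powr (p/2))) / 2"
    unfolding sq_sval_def by (rule bilinear_sum_le[OF p G(1,1) K(1) sbasis[OF G(1)] sbasis[OF G(1)] ov ou])
  also have "\<dots> \<le> ((\<Sum>i\<in>F. Re (gram_fun (\<lambda>t. t powr (p/2)) G G x i i)) +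
      (\<Sum>i\<in>F. Re (gram_fun (\<lambda>t. t powr (p/2)) G G (mat_adjoint x) i i))) / 2"
  proof -
    have *: "(\<Sum>l\<in>G. (\<Sum>k\<in>K. (cmod (ip G (?e v k) (sbasis G G x l)))\<^sup>2) * sq_sval G G x l powr (p/2))
       \<le> (\<Sum>i\<in>F. Re (gram_fun (\<lambda>t. t powr (p/2)) G G x i i))" if "orthonormal K F v" for v x
    proof -
      have "(\<Sum>l\<in>G. (\<Sum>k\<in>K. (cmod (ip G (?e v k) (sbasis G G x l)))\<^sup>2) * sq_sval G G x l powr (p/2))
         \<le> (\<Sum>l\<in>G. nsq F (sbasis G G x l) * sq_sval G G x l powr (p/2))"
        unfolding ie by (intro sum_mono mult_right_mono bessel[OF K(1) that]) auto
      also have "\<dots> = (\<Sum>i\<in>F. \<Sum>l\<in>G. (cmod (sbasis G G x l i))\<^sup>2 * sq_sval G G x l powr (p/2))"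
        unfolding nsq_def sum_distrib_right by (rule sum.swap)
      also have "\<dots> = (\<Sum>i\<in>F. Re (gram_fun (\<lambda>t. t powr (p/2)) G G x i i))"
      proof (intro sum.cong refl)
        fix i assume "i \<in> F"
        then have i: "i \<in> G" using G by auto
        have e: "of_real a * z * cnj z = of_real ((cmod z)\<^sup>2 * a)" for a z
          by (simp add: complex_norm_square mult_ac del: of_real_power)
        have "gram_fun (\<lambda>t. t powr (p/2)) G G x i i = of_real (\<Sum>l\<in>G. (cmod (sbasis G G x l i))\<^sup>2 * sq_sval G G x l powr (p/2))"
          by (simp only: gram_fun_def e of_real_sum i simp_thms if_True)
        then show "(\<Sum>l\<in>G. (cmod (sbasis G G x l i))\<^sup>2 * sq_sval G G x l powr (p/2)) = Re (gram_fun (\<lambda>t. t powr (p/2)) G G x i i)"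
          by simp
      qed
      finally show ?thesis .
    qed
    from *[OF K(2)] *[OF K(3)] show ?thesis by (intro divide_right_mono add_mono) auto
  qed
  finally show ?thesis .
qed

lemma schatten_sum_add:
  fixes x y :: "'i mat"
  assumes p: "1 \<le> p" and fin: "finite R" "finite C"
  shows "schatten_sum p R C (\<lambda>i j. x i j + y i j) \<le> 2 powr p * (schatten_sum p R C x + schatten_sum p R C y)"
proof -
  let ?z = "\<lambda>i j. x i j + y i j"
  obtain K v u where K: "finite (K :: 'i set)" "orthonormal K C v" "orthonormal K R u"
    and schatten_sum: "schatten_sum p R C ?z = (\<Sum>k\<in>K. cmod (ip R (u k) (fmv C ?z (v k))) powr p)"
    by (rule schatten_sum_attained[OF fin, where p = p and x = ?z])
  have "cmod (ip R (u k) (fmv C ?z (v k))) powr p \<le>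
     2 powr p * (cmod (ip R (u k) (fmv C x (v k))) powr p + cmod (ip R (u k) (fmv C y (v k))) powr p)" for k
  proof -
    let ?a = "ip R (u k) (fmv C x (v k))" and ?b = "ip R (u k) (fmv C y (v k))"
    have "ip R (u k) (fmv C ?z (v k)) = ?a + ?b"
      unfolding fmv_def ip_def by (simp add: algebra_simps sum.distrib sum_distrib_left)
    then have "cmod (ip R (u k) (fmv C ?z (v k))) \<le> cmod ?a + cmod ?b" by (simp add: norm_triangle_ineq)
    also have "\<dots> \<le> 2 * max (cmod ?a) (cmod ?b)" by simp
    finally have "cmod (ip R (u k) (fmv C ?z (v k))) powr p \<le> (2 * max (cmod ?a) (cmod ?b)) powr p"
      by (intro powr_mono2) (use p in auto)
    also have "\<dots> = 2 powr p * (max (cmod ?a) (cmod ?b)) powr p" by (subst powr_mult) auto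
    also have "\<dots> \<le> 2 powr p * (cmod ?a powr p + cmod ?b powr p)"
      by (intro mult_left_mono) (auto simp: max_def)
    finally show ?thesis .
  qed
  then have "schatten_sum p R C ?z \<le> (\<Sum>k\<in>K. 2 powr p * (cmod (ip R (u k) (fmv C x (v k))) powr p + cmod (ip R (u k) (fmv C y (v k))) powr p))"
    unfolding schatten_sum by (intro sum_mono)
  also have "\<dots> = 2 powr p * ((\<Sum>k\<in>K. cmod (ip R (u k) (fmv C x (v k))) powr p) + (\<Sum>k\<in>K. cmod (ip R (u k) (fmv C y (v k))) powr p))"
    by (simp add: sum_distrib_left sum.distrib algebra_simps)
  also have "\<dots> \<le> 2 powr p * (schatten_sum p R C x + schatten_sum p R C y)"
    using schatten_sum_ge_bilinear[OF p fin K] by (intro mult_left_mono add_mono) auto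
  finally show ?thesis .
qed

text \<open>
  Right singular bases and eigenvalues depend on a matrix only through its Gram matrix.
\<close>

lemma schatten_sum_scaled_gram:
  assumes "finite C" "0 \<le> c"
    and ip: "\<And>v w. ip R' (fmv C x' v) (fmv C x' w) = of_real (c\<^sup>2) * ip R (fmv C x v) (fmv C x w)"
  shows "schatten_sum p R' C x' = c powr p * schatten_sum p R C x"
proof -
  let ?v = "sbasis R C x"
  have v: "right_singular R C x ?v" by (rule sbasis[OF assms(1)])
  have "right_singular R' C x' ?v" using v by (simp add: right_singular_def ip)
  note schatten_sum_eq[OF assms(1) this]
  moreover have "nsq R' (fmv C x' w) = c\<^sup>2 * nsq R (fmv C x w)" for w
    using ip[of w w] by (simp only: ip_self of_real_mult[symmetric] of_real_eq_iff)
  moreover have "(c\<^sup>2 * t) powr (p/2) = c powr p * t powr (p/2)" if "t \<ge> 0" for t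
    using that assms(2) by (simp add: powr_mult sqrt_powr[symmetric])
  ultimately show ?thesis unfolding schatten_sum_eq[OF assms(1) v] by (simp add: sum_distrib_left)
qed

lemma schatten_sum_row_scale:
  assumes "finite C" "0 \<le> c"
    and "\<And>i j. i \<in> R \<Longrightarrow> j \<in> C \<Longrightarrow> x' i j = d i * x i j" "\<And>i. i \<in> R \<Longrightarrow> cmod (d i) = c"
  shows "schatten_sum p R C x' = c powr p * schatten_sum p R C x"
proof (rule schatten_sum_scaled_gram[OF assms(1,2)])
  fix v w
  have f: "fmv C x' v i = d i * fmv C x v i" if "i \<in> R" for i v
    unfolding fmv_def using assms(3)[OF that] by (simp add: sum_distrib_left mult.assoc)
  have d: "cnj (d i) * d i = of_real (c\<^sup>2)" if "i \<in> R" for i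
    using assms(4)[OF that] by (metis complex_norm_square mult.commute)
  have "ip R (fmv C x' v) (fmv C x' w) = (\<Sum>i\<in>R. (cnj (d i) * d i) * (cnj (fmv C x v i) * fmv C x w i))"
    unfolding ip_def by (intro sum.cong refl) (simp add: f)
  also have "\<dots> = of_real (c\<^sup>2) * ip R (fmv C x v) (fmv C x w)"
    unfolding ip_def sum_distrib_left by (intro sum.cong refl) (simp only: d)
  finally show "ip R (fmv C x' v) (fmv C x' w) = of_real (c\<^sup>2) * ip R (fmv C x v) (fmv C x w)" .
qed

lemma schatten_sum_cong:
  assumes "finite C" "\<And>i j. i \<in> R \<Longrightarrow> j \<in> C \<Longrightarrow> x' i j = x i j"
  shows "schatten_sum p R C x' = schatten_sum p R C x"
  using schatten_sum_row_scale[of C 1 R x' "\<lambda>_. 1" x p] assms by simp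

lemma schatten_sum_zero:
  assumes "finite C" "0 < p" "\<And>i j. i \<in> R \<Longrightarrow> j \<in> C \<Longrightarrow> x i j = 0"
  shows "schatten_sum p R C x = 0"
  using schatten_sum_row_scale[of C 0 R x "\<lambda>_. 0" x p] assms by simp

lemma schatten_sum_zero_rows:
  assumes "finite R" "finite C" "R' \<subseteq> R" "\<And>i j. i \<in> R - R' \<Longrightarrow> j \<in> C \<Longrightarrow> x i j = 0"
  shows "schatten_sum p R C x = schatten_sum p R' C x"
proof -
  have "ip R (fmv C x v) (fmv C x w) = ip R' (fmv C x v) (fmv C x w)" for v w
    unfolding ip_def by (rule sum.mono_neutral_right) (use assms in \<open>auto simp: fmv_def\<close>)
  then show ?thesis using schatten_sum_scaled_gram[of C 1 R x R' x p] assms by simp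
qed

section \<open>Column classes\<close>

text \<open>
  Right singular bases of the column classes are glued together.  If every row meets at most one class,
  the images of vectors from different classes have disjoint supports.
\<close>

lemma class_basis:
  fixes \<beta> :: "'i \<Rightarrow> 'b" and x :: "'i mat"
  assumes fin: "finite R" "finite C"
  defines "cl \<equiv> \<lambda>b. {j \<in> C. \<beta> j = b}"
  obtains v where "orthonormal C C v"
    "(\<Sum>k\<in>C. nsq R (fmv C x (v k)) powr (p/2)) = (\<Sum>b\<in>\<beta> ` C. schatten_sum p R (cl b) x)"
    "(\<forall>i\<in>R. \<forall>j\<in>C. \<forall>j'\<in>C. \<beta> j \<noteq> \<beta> j' \<longrightarrow> x i j = 0 \<or> x i j' = 0) \<longrightarrow>
       right_singular R C x v"
proof -
  define s where "s k = sbasis R (cl (\<beta> k)) x k" for k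
  define v where "v k = (\<lambda>i. if \<beta> i = \<beta> k then s k i else 0)" for k
  have fcl: "finite (cl b)" and sub: "cl b \<subseteq> C" for b using fin by (auto simp: cl_def)
  have rs: "right_singular R (cl b) x (sbasis R (cl b) x)" for b by (rule sbasis[OF fcl])
  have ipv: "ip C (v k) w = ip (cl (\<beta> k)) (s k) w" for k w
    unfolding ip_def v_def by (rule sum.mono_neutral_cong_right) (use fin in \<open>auto simp: cl_def\<close>)
  have fv: "fmv C x (v k) = fmv (cl (\<beta> k)) x (s k)" for k
    unfolding fmv_def v_def by (intro ext sum.mono_neutral_cong_right) (use fin in \<open>auto simp: cl_def\<close>)
  have on: "orthonormal C C v"
    unfolding orthonormal_def
  proof (intro ballI)
    fix k l assume kl: "k \<in> C" "l \<in> C"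
    show "ip C (v k) (v l) = (if k = l then 1 else 0)"
    proof (cases "\<beta> k = \<beta> l")
      case True
      then have "ip C (v k) (v l) = ip (cl (\<beta> k)) (sbasis R (cl (\<beta> k)) x k) (sbasis R (cl (\<beta> k)) x l)"
        unfolding ipv by (intro ip_cong) (auto simp: s_def v_def cl_def)
      then show ?thesis using right_singular_orthonormal[OF rs[of "\<beta> k"]] kl True
        by (simp add: orthonormal_def cl_def)
    next
      case False
      then have "ip C (v k) (v l) = ip (cl (\<beta> k)) (s k) (\<lambda>_. 0)"
        unfolding ipv by (intro ip_cong) (auto simp: v_def cl_def)
      then show ?thesis using False by (auto simp: ip_def)
    qed
  qed
  have nv: "nsq R (fmv C x (v k)) = sq_sval R (cl (\<beta> k)) x k" for k
    unfolding fv s_def sq_sval_def ..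
  have "(\<Sum>k\<in>C. nsq R (fmv C x (v k)) powr (p/2)) = (\<Sum>b\<in>\<beta> ` C. \<Sum>k\<in>{k\<in>C. \<beta> k = b}. nsq R (fmv C x (v k)) powr (p/2))"
    by (rule sum.image_gen[OF fin(2)])
  also have "\<dots> = (\<Sum>b\<in>\<beta> ` C. schatten_sum p R (cl b) x)"
    unfolding schatten_sum_def cl_def[symmetric] by (intro sum.cong refl) (auto simp: nv cl_def)
  finally have sum: "(\<Sum>k\<in>C. nsq R (fmv C x (v k)) powr (p/2)) = (\<Sum>b\<in>\<beta> ` C. schatten_sum p R (cl b) x)" .
  have "right_singular R C x v" if H: "\<And>i j j'. i \<in> R \<Longrightarrow> j \<in> C \<Longrightarrow> j' \<in> C \<Longrightarrow> \<beta> j \<noteq> \<beta> j' \<Longrightarrow> x i j = 0 \<or> x i j' = 0"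
    unfolding right_singular_def
  proof (intro conjI on ballI impI)
    fix k l assume kl: "k \<in> C" "l \<in> C" "k \<noteq> l"
    show "ip R (fmv C x (v k)) (fmv C x (v l)) = 0"
    proof (cases "\<beta> k = \<beta> l")
      case True
      then show ?thesis using rs[of "\<beta> k"] kl unfolding fv s_def by (simp add: right_singular_def cl_def)
    next
      case False
      have "cnj (fmv C x (v k) i) * fmv C x (v l) i = 0" if i: "i \<in> R" for i
      proof (cases "\<exists>j\<in>cl (\<beta> k). x i j \<noteq> 0")
        case True
        then obtain j where j: "j \<in> cl (\<beta> k)" "x i j \<noteq> 0" by auto
        have "x i j' = 0" if "j' \<in> cl (\<beta> l)" for j' using H[OF i, of j j'] j that False by (auto simp: cl_def)
        then have "fmv C x (v l) i = 0" by (simp only: fv) (simp add: fmv_def)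
        then show ?thesis by simp
      next
        case False
        then have "fmv C x (v k) i = 0" by (simp only: fv) (simp add: fmv_def)
        then show ?thesis by simp
      qed
      then show ?thesis unfolding ip_def by (intro sum.neutral) blast
    qed
  qed
  then have "(\<forall>i\<in>R. \<forall>j\<in>C. \<forall>j'\<in>C. \<beta> j \<noteq> \<beta> j' \<longrightarrow> x i j = 0 \<or> x i j' = 0) \<longrightarrow>
       right_singular R C x v" by blast
  from that[OF on sum this] show ?thesis .
qed

lemma schatten_sum_classes_le:
  fixes \<beta> :: "'i \<Rightarrow> 'b"
  assumes "2 \<le> p" "finite R" "finite C"
  shows "(\<Sum>b\<in>\<beta> ` C. schatten_sum p R {j \<in> C. \<beta> j = b} x) \<le> schatten_sum p R C x"
  by (rule class_basis[OF assms(2,3), of x p \<beta>]) (use schatten_sum_ge_orthonormal[OF assms(1,3,3)] in metis)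

lemma schatten_sum_classes_ge:
  fixes \<beta> :: "'i \<Rightarrow> 'b"
  assumes "0 < p" "p \<le> 2" "finite R" "finite C"
  shows "schatten_sum p R C x \<le> (\<Sum>b\<in>\<beta> ` C. schatten_sum p R {j \<in> C. \<beta> j = b} x)"
  by (rule class_basis[OF assms(3,4), of x p \<beta>]) (use schatten_sum_le_orthonormal[OF assms(1,2,4)] in metis)

lemma schatten_sum_block_diagonal:
  fixes \<beta> :: "'i \<Rightarrow> 'b"
  assumes "finite R" "finite C"
    and "\<And>i j j'. i \<in> R \<Longrightarrow> j \<in> C \<Longrightarrow> j' \<in> C \<Longrightarrow> \<beta> j \<noteq> \<beta> j' \<Longrightarrow> x i j = 0 \<or> x i j' = 0"
  shows "schatten_sum p R C x = (\<Sum>b\<in>\<beta> ` C. schatten_sum p R {j \<in> C. \<beta> j = b} x)"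
proof -
  obtain v where "(\<Sum>k\<in>C. nsq R (fmv C x (v k)) powr (p/2)) = (\<Sum>b\<in>\<beta> ` C. schatten_sum p R {j \<in> C. \<beta> j = b} x)"
    "(\<forall>i\<in>R. \<forall>j\<in>C. \<forall>j'\<in>C. \<beta> j \<noteq> \<beta> j' \<longrightarrow> x i j = 0 \<or> x i j' = 0) \<longrightarrow> right_singular R C x v"
    by (rule class_basis[OF assms(1,2), of x p \<beta>])
  moreover have "\<forall>i\<in>R. \<forall>j\<in>C. \<forall>j'\<in>C. \<beta> j \<noteq> \<beta> j' \<longrightarrow> x i j = 0 \<or> x i j' = 0" using assms(3) by blast
  ultimately show ?thesis by (simp add: schatten_sum_eq[OF assms(2)])
qed

lemma nsq_classes:
  assumes "finite C" shows "nsq C v = (\<Sum>b\<in>\<beta> ` C. nsq {j \<in> C. \<beta> j = b} v)"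
  unfolding nsq_def by (rule sum.image_gen[OF assms])

text \<open>
  The eigenvalues of \<open>x x\<^sup>*\<close>, written so that they can be split over the columns.
\<close>

lemma schatten_sum_left_basis:
  assumes "finite R" "finite C"
  shows "schatten_sum p R C x = (\<Sum>k\<in>R. nsq C (fmv R (mat_adjoint x) (sbasis C R (mat_adjoint x) k)) powr (p/2))"
  by (subst schatten_sum_adjoint[OF assms, symmetric]) (simp add: schatten_sum_def sq_sval_def)

lemma sum_powr_le_card:
  fixes t :: "'b \<Rightarrow> real"
  assumes "1 \<le> r" "finite B" "\<And>b. b \<in> B \<Longrightarrow> 0 \<le> t b"
  shows "(\<Sum>b\<in>B. t b) powr r \<le> real (card B) powr (r - 1) * (\<Sum>b\<in>B. t b powr r)"
proof (cases "B = {}")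
  case False
  define n where "n = real (card B)"
  have n: "n > 0" using False assms(2) by (simp add: n_def card_gt_0_iff)
  have "(\<Sum>b\<in>B. (1/n) * t b) powr r \<le> (\<Sum>b\<in>B. (1/n) * t b powr r)"
    by (rule sum_powr_Jensen) (use assms n in \<open>auto simp: n_def\<close>)
  then have "((1/n) * (\<Sum>b\<in>B. t b)) powr r \<le> (1/n) * (\<Sum>b\<in>B. t b powr r)"
    by (simp add: sum_distrib_left)
  moreover have "((1/n) * (\<Sum>b\<in>B. t b)) powr r = (\<Sum>b\<in>B. t b) powr r / n powr r"
    using n assms(3) by (subst powr_mult) (auto simp: powr_divide sum_nonneg)
  ultimately have "(\<Sum>b\<in>B. t b) powr r / n powr r \<le> (1/n) * (\<Sum>b\<in>B. t b powr r)" by simp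
  then have "(\<Sum>b\<in>B. t b) powr r \<le> n powr r * ((1/n) * (\<Sum>b\<in>B. t b powr r))"
    using n by (simp add: pos_divide_le_eq mult.commute)
  also have "\<dots> = n powr (r - 1) * (\<Sum>b\<in>B. t b powr r)" using n by (simp add: powr_diff)
  finally show ?thesis by (simp add: n_def)
qed simp

lemma sum_powr_ge_card:
  fixes t :: "'b \<Rightarrow> real"
  assumes "0 < r" "r \<le> 1" "finite B" "\<And>b. b \<in> B \<Longrightarrow> 0 \<le> t b"
  shows "real (card B) powr (r - 1) * (\<Sum>b\<in>B. t b powr r) \<le> (\<Sum>b\<in>B. t b) powr r"
proof (cases "B = {}")
  case False
  define n where "n = real (card B)"
  have n: "n > 0" using False assms(3) by (simp add: n_def card_gt_0_iff)
  have "(\<Sum>b\<in>B. (1/n) * t b powr r) \<le> (\<Sum>b\<in>B. (1/n) * t b) powr r"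
    by (rule sum_powr_Jensen_concave) (use assms n in \<open>auto simp: n_def\<close>)
  then have "(1/n) * (\<Sum>b\<in>B. t b powr r) \<le> ((1/n) * (\<Sum>b\<in>B. t b)) powr r"
    by (simp add: sum_distrib_left)
  moreover have "((1/n) * (\<Sum>b\<in>B. t b)) powr r = (\<Sum>b\<in>B. t b) powr r / n powr r"
    using n assms(4) by (subst powr_mult) (auto simp: powr_divide sum_nonneg)
  ultimately have "(1/n) * (\<Sum>b\<in>B. t b powr r) \<le> (\<Sum>b\<in>B. t b) powr r / n powr r" by simp
  then have "n powr r * ((1/n) * (\<Sum>b\<in>B. t b powr r)) \<le> (\<Sum>b\<in>B. t b) powr r"
    using n by (simp add: pos_le_divide_eq mult.commute)
  moreover have "n powr r * ((1/n) * (\<Sum>b\<in>B. t b powr r)) = n powr (r - 1) * (\<Sum>b\<in>B. t b powr r)"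
    using n by (simp add: powr_diff)
  ultimately show ?thesis by (simp add: n_def)
qed simp

text \<open>
  In an eigenbasis of \<open>x x\<^sup>* = \<Sum>\<^sub>b x\<^sub>b x\<^sub>b\<^sup>*\<close>, with \<open>x\<^sub>b\<close> the submatrix of the columns of class \<open>b\<close>, every
  eigenvalue is a sum of as many terms as there are classes.  Power means compare the powers, and Peierls'
  inequality bounds the contribution of each class.
\<close>

lemma schatten_sum_le_classes:
  fixes \<beta> :: "'i \<Rightarrow> 'b"
  assumes "2 \<le> p" "finite R" "finite C"
  shows "schatten_sum p R C x \<le> real (card (\<beta> ` C)) powr (p/2 - 1) * (\<Sum>b\<in>\<beta> ` C. schatten_sum p R {j \<in> C. \<beta> j = b} x)"
proof -
  let ?e = "sbasis C R (mat_adjoint x)" and ?cl = "\<lambda>b. {j \<in> C. \<beta> j = b}"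
  let ?n = "real (card (\<beta> ` C)) powr (p/2 - 1)"
  have on: "orthonormal R R ?e" by (rule right_singular_orthonormal[OF sbasis[OF assms(2)]])
  have "schatten_sum p R C x = (\<Sum>k\<in>R. (\<Sum>b\<in>\<beta> ` C. nsq (?cl b) (fmv R (mat_adjoint x) (?e k))) powr (p/2))"
    unfolding schatten_sum_left_basis[OF assms(2,3)] by (simp add: nsq_classes[OF assms(3), of _ \<beta>])
  also have "\<dots> \<le> (\<Sum>k\<in>R. ?n * (\<Sum>b\<in>\<beta> ` C. nsq (?cl b) (fmv R (mat_adjoint x) (?e k)) powr (p/2)))"
    by (intro sum_mono sum_powr_le_card) (use assms in auto)
  also have "\<dots> = ?n * (\<Sum>b\<in>\<beta> ` C. \<Sum>k\<in>R. nsq (?cl b) (fmv R (mat_adjoint x) (?e k)) powr (p/2))"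
    unfolding sum_distrib_left[symmetric] by (subst sum.swap) (rule refl)
  also have "\<dots> \<le> ?n * (\<Sum>b\<in>\<beta> ` C. schatten_sum p (?cl b) R (mat_adjoint x))"
    by (intro mult_left_mono sum_mono schatten_sum_ge_orthonormal on) (use assms in auto)
  finally show ?thesis using assms by (simp add: schatten_sum_adjoint)
qed

lemma schatten_sum_ge_classes:
  fixes \<beta> :: "'i \<Rightarrow> 'b"
  assumes "0 < p" "p \<le> 2" "finite R" "finite C"
  shows "real (card (\<beta> ` C)) powr (p/2 - 1) * (\<Sum>b\<in>\<beta> ` C. schatten_sum p R {j \<in> C. \<beta> j = b} x) \<le> schatten_sum p R C x"
proof -
  let ?e = "sbasis C R (mat_adjoint x)" and ?cl = "\<lambda>b. {j \<in> C. \<beta> j = b}"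
  let ?n = "real (card (\<beta> ` C)) powr (p/2 - 1)"
  have on: "orthonormal R R ?e" by (rule right_singular_orthonormal[OF sbasis[OF assms(3)]])
  have "?n * (\<Sum>b\<in>\<beta> ` C. schatten_sum p (?cl b) R (mat_adjoint x)) \<le>
      ?n * (\<Sum>b\<in>\<beta> ` C. \<Sum>k\<in>R. nsq (?cl b) (fmv R (mat_adjoint x) (?e k)) powr (p/2))"
    by (intro mult_left_mono sum_mono schatten_sum_le_orthonormal on) (use assms in auto)
  also have "\<dots> = (\<Sum>k\<in>R. ?n * (\<Sum>b\<in>\<beta> ` C. nsq (?cl b) (fmv R (mat_adjoint x) (?e k)) powr (p/2)))"
    unfolding sum_distrib_left[symmetric] by (subst sum.swap) (rule refl)
  also have "\<dots> \<le> (\<Sum>k\<in>R. (\<Sum>b\<in>\<beta> ` C. nsq (?cl b) (fmv R (mat_adjoint x) (?e k))) powr (p/2))"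
    by (intro sum_mono sum_powr_ge_card) (use assms in auto)
  also have "\<dots> = schatten_sum p R C x"
    unfolding schatten_sum_left_basis[OF assms(3,4)] by (simp add: nsq_classes[OF assms(4), of _ \<beta>])
  finally show ?thesis using assms by (simp add: schatten_sum_adjoint)
qed

section \<open>Column tails\<close>

lemma schatten_sum_tail_le_large:
  assumes "2 \<le> p" "finite R" "finite C" "C' \<subseteq> C"
  shows "schatten_sum p R (C - C') x \<le> schatten_sum p R C x - schatten_sum p R C' x"
proof -
  have "(\<Sum>b\<in>(\<lambda>j. j \<in> C') ` C. schatten_sum p R {j \<in> C. (j \<in> C') = b} x) \<le> schatten_sum p R C x"
    by (rule schatten_sum_classes_le[OF assms(1-3)])
  moreover have "(\<Sum>b\<in>(\<lambda>j. j \<in> C') ` C. schatten_sum p R {j \<in> C. (j \<in> C') = b} x)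
     = (\<Sum>b\<in>UNIV. schatten_sum p R {j \<in> C. (j \<in> C') = b} x)"
  proof (rule sum.mono_neutral_left; (simp; fail)?; intro ballI)
    fix b assume "b \<in> UNIV - (\<lambda>j. j \<in> C') ` C"
    then have "{j \<in> C. (j \<in> C') = b} = {}" by auto
    then show "schatten_sum p R {j \<in> C. (j \<in> C') = b} x = 0" by (simp only: schatten_sum_def sum.empty)
  qed
  moreover have "{j \<in> C. (j \<in> C') = True} = C'" "{j \<in> C. (j \<in> C') = False} = C - C'" using assms(4) by auto
  ultimately show ?thesis by (simp add: UNIV_bool)
qed

text \<open>
  If \<open>b\<close> is a small fraction of \<open>a + b\<close>, the first term suffices.  Otherwise \<open>b\<close> is comparable to \<open>a + b\<close>,
  and the tangent of the concave power at \<open>a + b\<close> shows that the power drops noticeably from \<open>a + b\<close> to \<open>a\<close>.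
\<close>

lemma powr_tail_le:
  fixes a b t r :: real
  assumes r: "0 < r" "r \<le> 1" and t: "0 < t" "t < 1" and ab: "0 \<le> a" "0 \<le> b"
  shows "b powr r \<le> t powr r * (a + b) powr r + ((a + b) powr r - a powr r) / (r * t)"
proof (cases "b \<le> t * (a + b)")
  case True
  then have "b powr r \<le> (t * (a + b)) powr r" using r ab by (intro powr_mono2) auto
  also have "\<dots> = t powr r * (a + b) powr r" using t ab by (simp add: powr_mult)
  moreover have "a powr r \<le> (a + b) powr r" using r ab by (intro powr_mono2) auto
  ultimately show ?thesis using r t by (simp add: add_increasing2)
next
  case False
  define s where "s = a + b"
  have b: "b > t * s" using False by (simp add: s_def)
  then have s: "s > 0" using ab t unfolding s_def by (smt (verit) mult_nonneg_nonneg)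
  have "(a / s) powr r \<le> 1 + r * (a / s - 1)" by (rule powr_le_tangent) (use r ab s in auto)
  then have "s powr r * (a / s) powr r \<le> s powr r * (1 - r * (b / s))"
    using s by (intro mult_left_mono) (auto simp: s_def field_simps)
  then have "a powr r \<le> s powr r - s powr r * (r * (b / s))"
    using s ab by (simp add: powr_divide algebra_simps)
  moreover have "s powr r * (r * t) \<le> s powr r * (r * (b / s))"
    using s b r by (intro mult_left_mono) (auto simp: field_simps)
  ultimately have "s powr r * (r * t) \<le> s powr r - a powr r" by linarith
  then have "s powr r \<le> (s powr r - a powr r) / (r * t)" using r t by (simp add: field_simps)
  moreover have "b powr r \<le> s powr r" using r ab by (intro powr_mono2) (auto simp: s_def)
  moreover have "t powr r * s powr r \<ge> 0" by simp
  ultimately show ?thesis unfolding s_def[symmetric] by linarith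
qed

text \<open>
  For \<open>p < 2\<close> the sum over the column classes bounds the whole from above, so subtracting gives nothing.
  Instead, every eigenvalue of \<open>x x\<^sup>*\<close> is split into the contributions of \<open>C'\<close> and of the remaining columns,
  and the scalar inequality is applied to each eigenvalue.
\<close>

lemma schatten_sum_tail_le_small:
  assumes p: "0 < p" "p \<le> 2" and fin: "finite R" "finite C" and sub: "C' \<subseteq> C" and t: "0 < t" "t < 1"
  shows "schatten_sum p R (C - C') x \<le> t powr (p/2) * schatten_sum p R C x + (schatten_sum p R C x - schatten_sum p R C' x) / (p/2 * t)"
proof -
  let ?e = "sbasis C R (mat_adjoint x)"
  define s a b where "s k = nsq C (fmv R (mat_adjoint x) (?e k))"
    and "a k = nsq C' (fmv R (mat_adjoint x) (?e k))"
    and "b k = nsq (C - C') (fmv R (mat_adjoint x) (?e k))" for k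
  have on: "orthonormal R R ?e" by (rule right_singular_orthonormal[OF sbasis[OF fin(1)]])
  have fC': "finite C'" using fin sub finite_subset by auto
  have s: "s k = a k + b k" for k
    unfolding s_def a_def b_def nsq_def by (subst sum.subset_diff[OF sub fin(2)]) (rule add.commute)
  have S: "schatten_sum p R C x = (\<Sum>k\<in>R. s k powr (p/2))"
    unfolding s_def by (rule schatten_sum_left_basis[OF fin])
  have A: "schatten_sum p R C' x \<le> (\<Sum>k\<in>R. a k powr (p/2))"
    unfolding a_def schatten_sum_adjoint[OF fin(1) fC', symmetric] by (rule schatten_sum_le_orthonormal[OF p fin(1) on])
  have B: "schatten_sum p R (C - C') x \<le> (\<Sum>k\<in>R. b k powr (p/2))"
    unfolding b_def schatten_sum_adjoint[OF fin(1) finite_Diff[OF fin(2)], symmetric] by (rule schatten_sum_le_orthonormal[OF p fin(1) on])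
  have "(\<Sum>k\<in>R. b k powr (p/2)) \<le> (\<Sum>k\<in>R. t powr (p/2) * s k powr (p/2) + (s k powr (p/2) - a k powr (p/2)) / (p/2 * t))"
    unfolding s by (intro sum_mono powr_tail_le) (use p t in \<open>auto simp: a_def b_def\<close>)
  also have "\<dots> = t powr (p/2) * schatten_sum p R C x + (schatten_sum p R C x - (\<Sum>k\<in>R. a k powr (p/2))) / (p/2 * t)"
    unfolding S by (simp only: sum.distrib sum_distrib_left[symmetric] sum_divide_distrib[symmetric] sum_subtractf)
  also have "\<dots> \<le> t powr (p/2) * schatten_sum p R C x + (schatten_sum p R C x - schatten_sum p R C' x) / (p/2 * t)"
    using A p t by (intro add_mono divide_right_mono diff_mono) auto
  finally show ?thesis using B by linarith
qed

section \<open>Square-summable functions\<close>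

text \<open>
  The norm of \<open>v\<close> in \<open>ell2 A\<close> is at most \<open>e\<close>, in terms of finite sums only.  In this form the bound
  passes to pointwise limits, and it only involves the entries of \<open>v\<close> in \<open>A\<close>.
\<close>

definition l2le :: "'i set \<Rightarrow> real \<Rightarrow> ('i \<Rightarrow> complex) \<Rightarrow> bool" where
  "l2le A e v \<longleftrightarrow> (\<forall>H. finite H \<and> H \<subseteq> A \<longrightarrow> sqrt (nsq H v) \<le> e)"

text \<open>
  The operator norm of \<open>x\<close> is at most \<open>K\<close>, tested on finitely supported vectors.
\<close>

definition opbound :: "'i set \<Rightarrow> real \<Rightarrow> 'i mat \<Rightarrow> bool" where
  "opbound A K x \<longleftrightarrow> (\<forall>C v. finite C \<and> C \<subseteq> A \<longrightarrow> l2le A (K * sqrt (nsq C v)) (fmv C x v))"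

definition l2conv :: "'i set \<Rightarrow> ('i set \<Rightarrow> 'i \<Rightarrow> complex) \<Rightarrow> ('i \<Rightarrow> complex) \<Rightarrow> bool" where
  "l2conv A f v \<longleftrightarrow> (\<forall>e>0. \<forall>\<^sub>F F in finite_subsets_at_top A. l2le A e (\<lambda>i. f F i - v i))"

lemma l2leD: "l2le A e v \<Longrightarrow> finite H \<Longrightarrow> H \<subseteq> A \<Longrightarrow> sqrt (nsq H v) \<le> e"
  unfolding l2le_def by blast

lemma l2le_nonneg: "l2le A e v \<Longrightarrow> 0 \<le> e"
  using l2leD[of A e v "{}"] by (simp add: nsq_def)

lemma l2le_mono: "l2le A e v \<Longrightarrow> e \<le> e' \<Longrightarrow> l2le A e' v"
  unfolding l2le_def by force

lemma l2le_cong: "(\<And>i. i \<in> A \<Longrightarrow> v i = w i) \<Longrightarrow> l2le A e v = l2le A e w"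
  unfolding l2le_def by (metis nsq_cong subsetD)

lemma l2le_coord: assumes "l2le A e v" "i \<in> A" shows "cmod (v i) \<le> e"
  using l2leD[OF assms(1), of "{i}"] assms(2) by (simp add: nsq_def)

lemma l2le_add: assumes "l2le A a v" "l2le A b w" shows "l2le A (a + b) (\<lambda>i. v i + w i)"
  unfolding l2le_def
proof (intro allI impI)
  fix H assume H: "finite H \<and> H \<subseteq> A"
  have "sqrt (nsq H (\<lambda>i. v i + w i)) \<le> L2_set (\<lambda>i. cmod (v i) + cmod (w i)) H"
    unfolding nsq_def L2_set_def[symmetric] by (rule L2_set_mono) (auto intro: norm_triangle_ineq)
  also have "\<dots> \<le> L2_set (\<lambda>i. cmod (v i)) H + L2_set (\<lambda>i. cmod (w i)) H" by (rule L2_set_triangle_ineq)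
  also have "\<dots> \<le> a + b" using l2leD[OF assms(1), of H] l2leD[OF assms(2), of H] H
    by (simp add: nsq_def L2_set_def)
  finally show "sqrt (nsq H (\<lambda>i. v i + w i)) \<le> a + b" .
qed

lemma l2le_scale: assumes "l2le A a v" shows "l2le A (cmod c * a) (\<lambda>i. c * v i)"
  using assms unfolding l2le_def by (simp add: nsq_scale real_sqrt_mult mult_left_mono)

lemma l2le_diff: assumes "l2le A a v" "l2le A b w" shows "l2le A (a + b) (\<lambda>i. v i - w i)"
proof -
  have "l2le A (a + cmod (-1) * b) (\<lambda>i. v i + (-1) * w i)" by (intro l2le_add l2le_scale assms)
  then show ?thesis by simp
qed

lemma l2le_sum:
  assumes "finite K" "\<And>k. k \<in> K \<Longrightarrow> l2le A (a k) (v k)"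
  shows "l2le A (\<Sum>k\<in>K. a k) (\<lambda>i. \<Sum>k\<in>K. v k i)"
  using assms
proof (induction K rule: finite_induct)
  case empty show ?case by (simp add: l2le_def nsq_def)
next
  case (insert k K) then show ?case by (simp add: l2le_add)
qed

lemma l2le_limit:
  assumes "Fl \<noteq> bot" "\<And>i. i \<in> A \<Longrightarrow> ((\<lambda>F. f F i) \<longlongrightarrow> v i) Fl" "(e \<longlongrightarrow> d) Fl" "\<forall>\<^sub>F F in Fl. l2le A (e F) (f F)"
  shows "l2le A d v"
  unfolding l2le_def
proof (intro allI impI)
  fix H assume H: "finite H \<and> H \<subseteq> A"
  have "((\<lambda>F. sqrt (nsq H (f F))) \<longlongrightarrow> sqrt (nsq H v)) Fl"
    unfolding nsq_def using H assms(2) by (intro tendsto_intros) auto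
  moreover have "\<forall>\<^sub>F F in Fl. sqrt (nsq H (f F)) \<le> e F"
    using assms(4) by eventually_elim (use H in \<open>auto intro: l2leD\<close>)
  ultimately show "sqrt (nsq H v) \<le> d" by (rule tendsto_le[OF assms(1,3)])
qed

lemma l2le_finite:
  assumes "finite C" "\<And>i. i \<in> A - C \<Longrightarrow> v i = 0" shows "l2le A (sqrt (nsq C v)) v"
  unfolding l2le_def
proof (intro allI impI, rule real_sqrt_le_mono)
  fix H assume H: "finite H \<and> H \<subseteq> A"
  have "nsq H v = (\<Sum>i\<in>H \<inter> C. (cmod (v i))\<^sup>2)"
    unfolding nsq_def by (rule sum.mono_neutral_right) (use assms H in auto)
  also have "\<dots> \<le> nsq C v" unfolding nsq_def by (rule sum_mono2) (use assms in auto)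
  finally show "nsq H v \<le> nsq C v" .
qed

lemma l2le_ell2:
  assumes "l2le A e v" "\<And>i. i \<notin> A \<Longrightarrow> v i = 0"
  shows "v \<in> ell2 A" "ell2_norm A v \<le> e"
proof -
  have b: "(\<Sum>i\<in>H. (cmod (v i))\<^sup>2) \<le> e\<^sup>2" if "finite H" "H \<subseteq> A" for H
    using l2leD[OF assms(1) that] by (simp add: nsq_def sqrt_le_D)
  have s: "(\<lambda>i. (cmod (v i))\<^sup>2) summable_on A"
    by (rule nonneg_bdd_above_summable_on) (use b in \<open>auto intro!: bdd_aboveI[of _ "e\<^sup>2"]\<close>)
  then show "v \<in> ell2 A" using assms(2) by (simp add: ell2_def)
  have "(\<Sum>\<^sub>\<infinity>i\<in>A. (cmod (v i))\<^sup>2) \<le> e\<^sup>2"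
    by (rule infsum_le_finite_sums[OF s]) (use b in auto)
  then have "ell2_norm A v \<le> sqrt (e\<^sup>2)" unfolding ell2_norm_def by (rule real_sqrt_le_mono)
  then show "ell2_norm A v \<le> e" using l2le_nonneg[OF assms(1)] by simp
qed

lemma ell2_l2le: assumes "v \<in> ell2 A" shows "l2le A (ell2_norm A v) v"
  unfolding l2le_def ell2_norm_def nsq_def
proof (intro allI impI real_sqrt_le_mono)
  fix H assume H: "finite H \<and> H \<subseteq> A"
  show "(\<Sum>i\<in>H. (cmod (v i))\<^sup>2) \<le> (\<Sum>\<^sub>\<infinity>i\<in>A. (cmod (v i))\<^sup>2)"
    by (rule finite_sum_le_infsum) (use H assms in \<open>auto simp: ell2_def\<close>)
qed

lemma ell2_norm_le_iff: "v \<in> ell2 A \<Longrightarrow> ell2_norm A v \<le> e \<longleftrightarrow> l2le A e v"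
  using ell2_l2le l2le_ell2(2) l2le_mono by (metis (mono_tags, lifting) ell2_def mem_Collect_eq)

lemma l2le_tail:
  assumes "l2le A b w" "0 < d"
  shows "\<exists>G. finite G \<and> G \<subseteq> A \<and> l2le A d (\<lambda>i. if i \<in> G then 0 else w i)"
proof -
  let ?S = "(\<lambda>F. nsq F w) ` {F. finite F \<and> F \<subseteq> A}"
  have bdd: "bdd_above ?S"
    using l2leD[OF assms(1)] by (intro bdd_aboveI[of _ "b\<^sup>2"]) (auto simp: sqrt_le_D)
  have "?S \<noteq> {}" by auto
  then obtain G where G: "finite G" "G \<subseteq> A" "Sup ?S - d\<^sup>2 < nsq G w"
    using less_cSup_iff[OF _ bdd, of "Sup ?S - d\<^sup>2"] assms(2) by auto
  have "l2le A d (\<lambda>i. if i \<in> G then 0 else w i)"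
    unfolding l2le_def
  proof (intro allI impI)
    fix H assume H: "finite H \<and> H \<subseteq> A"
    have "nsq H (\<lambda>i. if i \<in> G then 0 else w i) = nsq (H - G) w"
      unfolding nsq_def by (rule sum.mono_neutral_cong_right) (use H in auto)
    also have "\<dots> = nsq (G \<union> (H - G)) w - nsq G w"
      unfolding nsq_def by (subst sum.union_disjoint) (use G H in auto)
    also have "nsq (G \<union> (H - G)) w \<le> Sup ?S" by (rule cSup_upper[OF _ bdd]) (use G H in auto)
    finally have "nsq H (\<lambda>i. if i \<in> G then 0 else w i) \<le> d\<^sup>2" using G(3) by linarith
    then show "sqrt (nsq H (\<lambda>i. if i \<in> G then 0 else w i)) \<le> d" using assms(2) by (simp add: real_le_lsqrt)
  qed
  with G show ?thesis by blast
qed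

lemma l2le_mult_summable:
  assumes "l2le A a u" "l2le A b v" shows "(\<lambda>j. u j * v j) summable_on A"
proof (rule abs_summable_summable, rule nonneg_bdd_above_summable_on)
  show "bdd_above (sum (\<lambda>x. cmod (u x * v x)) ` {F. F \<subseteq> A \<and> finite F})"
  proof (rule bdd_aboveI[of _ "a * b"], clarsimp)
    fix F assume F: "F \<subseteq> A" "finite F"
    have "(\<Sum>x\<in>F. cmod (u x * v x)) = (\<Sum>x\<in>F. \<bar>cmod (u x)\<bar> * \<bar>cmod (v x)\<bar>)" by (simp add: norm_mult)
    also have "\<dots> \<le> L2_set (\<lambda>x. cmod (u x)) F * L2_set (\<lambda>x. cmod (v x)) F" by (rule L2_set_mult_ineq)
    also have "\<dots> \<le> a * b"
      using l2leD[OF assms(1) F(2,1)] l2leD[OF assms(2) F(2,1)] l2le_nonneg[OF assms(1)]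
      by (intro mult_mono) (auto simp: nsq_def L2_set_def sum_nonneg)
    finally show "(\<Sum>x\<in>F. cmod (u x * v x)) \<le> a * b" .
  qed
qed simp

section \<open>Bounded matrices\<close>

lemma opboundD: "opbound A K x \<Longrightarrow> finite C \<Longrightarrow> C \<subseteq> A \<Longrightarrow> l2le A (K * sqrt (nsq C v)) (fmv C x v)"
  unfolding opbound_def by blast

lemma opbound_cong: "(\<And>i j. i \<in> A \<Longrightarrow> j \<in> A \<Longrightarrow> x i j = y i j) \<Longrightarrow> opbound A K x = opbound A K y"
proof -
  assume a: "\<And>i j. i \<in> A \<Longrightarrow> j \<in> A \<Longrightarrow> x i j = y i j"
  have "l2le A e (fmv C x v) = l2le A e (fmv C y v)" if "C \<subseteq> A" for C v e
    by (rule l2le_cong) (use a that in \<open>auto simp: fmv_def intro!: sum.cong\<close>)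
  then show ?thesis unfolding opbound_def by blast
qed

lemma opbound_column: assumes "opbound A K x" "j \<in> A" shows "l2le A K (\<lambda>i. x i j)"
  using opboundD[OF assms(1), of "{j}" "\<lambda>_. 1"] assms(2) by (simp add: fmv_def nsq_def)

lemma opbound_row: assumes "opbound A K x" "i \<in> A" shows "l2le A K (\<lambda>j. x i j)"
  unfolding l2le_def
proof (intro allI impI)
  fix H assume H: "finite H \<and> H \<subseteq> A"
  let ?v = "\<lambda>j. cnj (x i j)"
  let ?s = "sqrt (nsq H (\<lambda>j. x i j))"
  have n: "nsq H ?v = nsq H (\<lambda>j. x i j)" by (simp add: nsq_def)
  have "fmv H x ?v i = of_real (nsq H (\<lambda>j. x i j))"
    unfolding fmv_def nsq_def of_real_sum complex_norm_square ..
  then have "?s * ?s \<le> K * ?s"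
    using l2le_coord[OF opboundD[OF assms(1), of H ?v] assms(2)] H by (simp add: n)
  moreover have "0 \<le> K" using l2le_nonneg[OF opbound_column[OF assms]] .
  ultimately show "?s \<le> K" by (metis mult_right_le_imp_le nsq_nonneg order_le_less real_sqrt_ge_zero)
qed

lemma opbound_add:
  assumes "opbound A K x" "opbound A L y" shows "opbound A (K + L) (\<lambda>i j. x i j + y i j)"
  unfolding opbound_def
proof (intro allI impI)
  fix C v assume C: "finite C \<and> C \<subseteq> A"
  have "fmv C (\<lambda>i j. x i j + y i j) v = (\<lambda>i. fmv C x v i + fmv C y v i)"
    by (simp add: fmv_def sum.distrib algebra_simps)
  then show "l2le A ((K + L) * sqrt (nsq C v)) (fmv C (\<lambda>i j. x i j + y i j) v)"
    using l2le_add[OF opboundD[OF assms(1)] opboundD[OF assms(2)]] C by (simp add: distrib_right)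
qed

lemma opbound_scale:
  assumes "opbound A K x" shows "opbound A (cmod c * K) (\<lambda>i j. c * x i j)"
  unfolding opbound_def
proof (intro allI impI)
  fix C v assume C: "finite C \<and> C \<subseteq> A"
  have "fmv C (\<lambda>i j. c * x i j) v = (\<lambda>i. c * fmv C x v i)"
    by (simp add: fmv_def sum_distrib_left mult.assoc)
  then show "l2le A (cmod c * K * sqrt (nsq C v)) (fmv C (\<lambda>i j. c * x i j) v)"
    using l2le_scale[OF opboundD[OF assms]] C by (simp add: mult.assoc)
qed

lemma opbound_diff:
  assumes "opbound A K x" "opbound A L y" shows "opbound A (K + L) (\<lambda>i j. x i j - y i j)"
  proof -
  have "opbound A (K + cmod (-1) * L) (\<lambda>i j. x i j + (-1) * y i j)" by (intro opbound_add opbound_scale assms)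
  then show ?thesis by simp
qed

lemma opbound_limit:
  assumes "Fl \<noteq> bot" "\<And>i j. i \<in> A \<Longrightarrow> j \<in> A \<Longrightarrow> ((\<lambda>F. f F i j) \<longlongrightarrow> x i j) Fl"
    "(K \<longlongrightarrow> L) Fl" "\<forall>\<^sub>F F in Fl. opbound A (K F) (f F)"
  shows "opbound A L x"
  unfolding opbound_def
proof (intro allI impI)
  fix C v assume C: "finite C \<and> C \<subseteq> A"
  show "l2le A (L * sqrt (nsq C v)) (fmv C x v)"
  proof (rule l2le_limit[OF assms(1)])
    show "((\<lambda>F. fmv C (f F) v i) \<longlongrightarrow> fmv C x v i) Fl" if "i \<in> A" for i
      unfolding fmv_def using C that by (intro tendsto_intros assms(2)) auto
    show "((\<lambda>F. K F * sqrt (nsq C v)) \<longlongrightarrow> L * sqrt (nsq C v)) Fl" by (intro tendsto_intros assms)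
    show "\<forall>\<^sub>F F in Fl. l2le A (K F * sqrt (nsq C v)) (fmv C (f F) v)"
      using assms(4) by eventually_elim (use C in \<open>auto intro: opboundD\<close>)
  qed
qed

lemma opbound_adjoint:
  assumes "opbound A K x" "0 \<le> K" shows "opbound A K (mat_adjoint x)"
  unfolding opbound_def l2le_def
proof (intro allI impI)
  fix C v H assume C: "finite C \<and> C \<subseteq> A" and H: "finite H \<and> H \<subseteq> A"
  let ?z = "fmv C (mat_adjoint x) v"
  have "complex_of_real (nsq H ?z) = ip C (fmv H x ?z) v"
    unfolding ip_self[symmetric] by (subst ip_fmv_adjoint) simp
  then have "nsq H ?z = cmod (ip C (fmv H x ?z) v)" by (metis norm_of_real abs_of_nonneg nsq_nonneg)
  also have "\<dots> \<le> sqrt (nsq C (fmv H x ?z)) * sqrt (nsq C v)"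
    using cauchy_schwarz[of C "fmv H x ?z" v] C by (simp add: real_le_rsqrt real_sqrt_mult[symmetric])
  also have "\<dots> \<le> (K * sqrt (nsq H ?z)) * sqrt (nsq C v)"
    by (intro mult_right_mono l2leD[OF opboundD[OF assms(1)]]) (use C H in auto)
  finally have "sqrt (nsq H ?z) * sqrt (nsq H ?z) \<le> K * sqrt (nsq C v) * sqrt (nsq H ?z)" by (simp add: mult_ac)
  moreover have "0 \<le> K * sqrt (nsq C v)" using assms(2) by simp
  ultimately show "sqrt (nsq H ?z) \<le> K * sqrt (nsq C v)"
    by (metis mult_right_le_imp_le nsq_nonneg order_le_less real_sqrt_ge_zero)
qed

lemma mat_vec_tendsto:
  assumes "opbound A K x" "l2le A b w" "i \<in> A"
  shows "(\<lambda>j. x i j * w j) summable_on A"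
    "((\<lambda>C. fmv C x w i) \<longlongrightarrow> mat_vec A x w i) (finite_subsets_at_top A)"
proof -
  show s: "(\<lambda>j. x i j * w j) summable_on A"
    by (rule l2le_mult_summable[OF opbound_row[OF assms(1,3)] assms(2)])
  show "((\<lambda>C. fmv C x w i) \<longlongrightarrow> mat_vec A x w i) (finite_subsets_at_top A)"
    unfolding fmv_def mat_vec_def by (rule infsum_tendsto[OF s])
qed

lemma opbound_mat_vec:
  assumes "opbound A K x" "0 \<le> K" "l2le A b w"
  shows "l2le A (K * b) (mat_vec A x w)"
proof (rule l2le_limit[OF finite_subsets_at_top_neq_bot])
  show "((\<lambda>C. fmv C x w i) \<longlongrightarrow> mat_vec A x w i) (finite_subsets_at_top A)" if "i \<in> A" for i
    by (rule mat_vec_tendsto[OF assms(1,3) that])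
  show "((\<lambda>_. K * b) \<longlongrightarrow> K * b) (finite_subsets_at_top A)" by simp
  show "\<forall>\<^sub>F F in finite_subsets_at_top A. l2le A (K * b) (fmv F x w)"
  proof (rule eventually_finite_subsets_at_top_weakI)
    fix F assume F: "finite F" "F \<subseteq> A"
    show "l2le A (K * b) (fmv F x w)"
      by (rule l2le_mono[OF opboundD[OF assms(1) F]]) (intro mult_left_mono l2leD[OF assms(3) F] assms(2))
  qed
qed

definition matsupp :: "'i set \<Rightarrow> 'i mat \<Rightarrow> bool" where
  "matsupp A x \<longleftrightarrow> (\<forall>i j. i \<notin> A \<or> j \<notin> A \<longrightarrow> x i j = 0)"

lemma mat_vec_outside: "matsupp A x \<Longrightarrow> i \<notin> A \<Longrightarrow> mat_vec A x v i = 0"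
  unfolding matsupp_def mat_vec_def by simp

lemma opbound_bounded_ops:
  assumes "matsupp A x" "opbound A K x" "0 \<le> K"
  shows "x \<in> bounded_ops A" "op_norm A x \<le> K"
proof -
  have *: "(\<forall>i\<in>A. (\<lambda>j. x i j * v j) summable_on A) \<and>
        mat_vec A x v \<in> ell2 A \<and> ell2_norm A (mat_vec A x v) \<le> K * ell2_norm A v" if v: "v \<in> ell2 A" for v
    using mat_vec_tendsto(1)[OF assms(2) ell2_l2le[OF v]] l2le_ell2[OF opbound_mat_vec[OF assms(2,3) ell2_l2le[OF v]]]
      mat_vec_outside[OF assms(1)] by blast
  then show "x \<in> bounded_ops A" using assms(1) unfolding bounded_ops_def matsupp_def by blast
  have z: "(\<lambda>_. 0) \<in> ell2 A" by (simp add: ell2_def)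
  have "ell2_norm A (\<lambda>_. 0) \<le> 1" by (simp add: ell2_norm_def)
  show "op_norm A x \<le> K" unfolding op_norm_def
  proof (rule cSUP_least)
    show "{v \<in> ell2 A. ell2_norm A v \<le> 1} \<noteq> {}" using z \<open>ell2_norm A (\<lambda>_. 0) \<le> 1\<close> by blast
    fix v assume "v \<in> {v \<in> ell2 A. ell2_norm A v \<le> 1}"
    then show "ell2_norm A (mat_vec A x v) \<le> K" using *[of v] assms(3)
      by (smt (verit) mem_Collect_eq mult_left_le)
  qed
qed

lemma mat_vec_finite:
  assumes "finite C" "C \<subseteq> A" "\<And>j. j \<in> A - C \<Longrightarrow> v j = 0"
  shows "mat_vec A x v = fmv C x v"
  unfolding mat_vec_def fmv_def
proof
  fix i
  have "(\<Sum>\<^sub>\<infinity>j\<in>A. x i j * v j) = (\<Sum>\<^sub>\<infinity>j\<in>C. x i j * v j)"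
    by (rule infsum_cong_neutral) (use assms in auto)
  then show "(\<Sum>\<^sub>\<infinity>j\<in>A. x i j * v j) = (\<Sum>j\<in>C. x i j * v j)" using assms(1) by simp
qed

lemma bounded_ops_opbound:
  assumes "x \<in> bounded_ops A"
  shows "matsupp A x" "opbound A (op_norm A x) x" "0 \<le> op_norm A x"
proof -
  show ms: "matsupp A x" using assms by (simp add: bounded_ops_def matsupp_def)
  obtain C0 where C0: "\<And>v. v \<in> ell2 A \<Longrightarrow> mat_vec A x v \<in> ell2 A \<and> ell2_norm A (mat_vec A x v) \<le> C0 * ell2_norm A v"
    using assms unfolding bounded_ops_def by blast
  have n0: "0 \<le> ell2_norm A v" for v unfolding ell2_norm_def by (simp add: infsum_nonneg)
  let ?S = "{v \<in> ell2 A. ell2_norm A v \<le> 1}"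
  have bdd: "bdd_above ((\<lambda>v. ell2_norm A (mat_vec A x v)) ` ?S)"
  proof (rule bdd_aboveI[of _ "\<bar>C0\<bar>"], clarsimp)
    fix v assume v: "v \<in> ell2 A" "ell2_norm A v \<le> 1"
    have "ell2_norm A (mat_vec A x v) \<le> \<bar>C0\<bar> * ell2_norm A v" using C0[OF v(1)] n0[of v]
      by (smt (verit) mult_right_mono)
    also have "\<dots> \<le> \<bar>C0\<bar> * 1" using v by (intro mult_left_mono) auto
    finally show "ell2_norm A (mat_vec A x v) \<le> \<bar>C0\<bar>" by simp
  qed
  have z: "(\<lambda>_. 0) \<in> ?S" by (simp add: ell2_def ell2_norm_def)
  show op0: "0 \<le> op_norm A x" unfolding op_norm_def
    by (rule order_trans[OF n0 cSUP_upper[OF z bdd]])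
  show "opbound A (op_norm A x) x"
    unfolding opbound_def
  proof (intro allI impI)
    fix C and v :: "'a \<Rightarrow> complex" assume C: "finite C \<and> C \<subseteq> A"
    define s where "s = sqrt (nsq C v)"
    show "l2le A (op_norm A x * sqrt (nsq C v)) (fmv C x v)"
    proof (cases "s = 0")
      case True
      then have "v j = 0" if "j \<in> C" for j using nsq_eq_0[of C v j] C that by (simp add: s_def)
      then have "fmv C x v = (\<lambda>_. 0)" by (simp add: fmv_def)
      then show ?thesis using True by (simp add: s_def l2le_def nsq_def)
    next
      case False
      then have s: "s > 0" by (simp add: s_def less_le)
      define w where "w = (\<lambda>j. if j \<in> C then of_real (1 / s) * v j else 0)"
      have nw: "nsq C w = nsq C (\<lambda>j. of_real (1 / s) * v j)" by (rule nsq_cong) (simp add: w_def)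
      have "sqrt (nsq C w) = 1" unfolding nw nsq_scale real_sqrt_mult using s
        by (simp add: s_def[symmetric] norm_divide)
      then have l: "l2le A 1 w" using l2le_finite[of C A w] C by (simp add: w_def)
      have "w i = 0" if "i \<notin> A" for i using C that by (auto simp: w_def)
      then have "w \<in> ?S" using l2le_ell2[OF l] by blast
      then have "ell2_norm A (mat_vec A x w) \<le> op_norm A x" unfolding op_norm_def by (rule cSUP_upper[OF _ bdd])
      moreover have "mat_vec A x w \<in> ell2 A" using C0 \<open>w \<in> ?S\<close> by blast
      ultimately have "l2le A (op_norm A x) (mat_vec A x w)" by (simp add: ell2_norm_le_iff)
      from l2le_scale[OF this, of "of_real s"] have "l2le A (s * op_norm A x) (\<lambda>i. of_real s * mat_vec A x w i)"
        using s by simp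
      moreover have "mat_vec A x w = fmv C x w" by (rule mat_vec_finite) (use C in \<open>auto simp: w_def\<close>)
      moreover have "fmv C x w = fmv C x (\<lambda>j. of_real (1 / s) * v j)" by (rule fmv_cong) (simp add: w_def)
      ultimately have "l2le A (s * op_norm A x) (\<lambda>i. of_real s * (of_real (1 / s) * fmv C x v i))"
        by (simp add: fmv_scale del: of_real_divide)
      moreover have "complex_of_real s * (of_real (1 / s) * z) = z" for z using s by simp
      ultimately show ?thesis by (simp only: s_def mult.commute)
    qed
  qed
qed

section \<open>Columnwise convergence\<close>

abbreviation fsat :: "'i set \<Rightarrow> 'i set filter" where "fsat \<equiv> finite_subsets_at_top"

lemma l2convD: "l2conv A f v \<Longrightarrow> 0 < e \<Longrightarrow> \<forall>\<^sub>F F in fsat A. l2le A e (\<lambda>i. f F i - v i)"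
  unfolding l2conv_def by blast

lemma l2conv_coord:
  assumes "l2conv A f v" "i \<in> A" shows "((\<lambda>F. f F i) \<longlongrightarrow> v i) (fsat A)"
proof (rule tendstoI)
  fix e :: real assume "e > 0"
  then have "\<forall>\<^sub>F F in fsat A. l2le A (e/2) (\<lambda>i. f F i - v i)" by (intro l2convD[OF assms(1)]) auto
  then show "\<forall>\<^sub>F F in fsat A. dist (f F i) (v i) < e"
  proof eventually_elim
    case (elim F)
    from l2le_coord[OF elim assms(2)] \<open>e > 0\<close> show ?case by (simp add: dist_norm)
  qed
qed

lemma l2conv_add:
  assumes "l2conv A f v" "l2conv A g w" shows "l2conv A (\<lambda>F i. f F i + g F i) (\<lambda>i. v i + w i)"
  unfolding l2conv_def
proof (intro allI impI)
  fix e :: real assume "e > 0"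
  then have h: "e/2 > 0" by simp
  from l2convD[OF assms(1) h] l2convD[OF assms(2) h]
  show "\<forall>\<^sub>F F in fsat A. l2le A e (\<lambda>i. f F i + g F i - (v i + w i))"
  proof eventually_elim
    case (elim F)
    from l2le_add[OF this] show ?case by (simp add: algebra_simps)
  qed
qed

lemma l2conv_scale:
  assumes "l2conv A f v" shows "l2conv A (\<lambda>F i. c * f F i) (\<lambda>i. c * v i)"
  unfolding l2conv_def
proof (intro allI impI)
  fix e :: real assume e: "e > 0"
  then have h: "e / (cmod c + 1) > 0" by (simp add: add_nonneg_pos)
  from l2convD[OF assms(1) h]
  show "\<forall>\<^sub>F F in fsat A. l2le A e (\<lambda>i. c * f F i - c * v i)"
  proof eventually_elim
    case (elim F)
    have "cmod c / (cmod c + 1) \<le> 1" by (smt (verit) divide_le_eq_1 norm_ge_zero)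
    then have "cmod c * (e / (cmod c + 1)) \<le> e" using mult_left_mono[of "cmod c / (cmod c + 1)" 1 e] e by (simp add: mult.commute)
    from l2le_mono[OF l2le_scale[OF elim] this] show ?case by (simp add: right_diff_distrib)
  qed
qed

lemma l2conv_const: "l2conv A (\<lambda>F. v) v"
  unfolding l2conv_def by (auto simp: l2le_def nsq_def)

lemma l2conv_sum:
  assumes "finite K" "\<And>k. k \<in> K \<Longrightarrow> l2conv A (f k) (v k)"
  shows "l2conv A (\<lambda>F i. \<Sum>k\<in>K. f k F i) (\<lambda>i. \<Sum>k\<in>K. v k i)"
  using assms
proof (induction K rule: finite_induct)
  case empty show ?case using l2conv_const[of A "\<lambda>_. 0"] by simp
next
  case (insert k K) then show ?case by (simp add: l2conv_add)
qed

lemma l2conv_cong: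
  assumes "\<forall>\<^sub>F F in fsat A. \<forall>i\<in>A. f F i = g F i" "\<And>i. i \<in> A \<Longrightarrow> v i = w i" "l2conv A f v"
  shows "l2conv A g w"
  unfolding l2conv_def
proof (intro allI impI)
  fix e :: real assume e: "e > 0"
  from l2convD[OF assms(3) e] assms(1)
  show "\<forall>\<^sub>F F in fsat A. l2le A e (\<lambda>i. g F i - w i)"
  proof eventually_elim
    case (elim F)
    have "l2le A e (\<lambda>i. f F i - v i) = l2le A e (\<lambda>i. g F i - w i)"
      by (rule l2le_cong) (use elim assms(2) in auto)
    with elim show ?case by simp
  qed
qed

lemma eventually_fsat_member: "j \<in> A \<Longrightarrow> \<forall>\<^sub>F F in fsat A. finite F \<and> F \<subseteq> A \<and> j \<in> F"
  unfolding eventually_finite_subsets_at_top by (intro exI[of _ "{j}"]) auto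

lemma eventually_fsat_superset: "finite G \<Longrightarrow> G \<subseteq> A \<Longrightarrow> \<forall>\<^sub>F F in fsat A. finite F \<and> F \<subseteq> A \<and> G \<subseteq> F"
  unfolding eventually_finite_subsets_at_top by (intro exI[of _ G]) auto

lemma mat_vec_cong: "(\<And>j. j \<in> A \<Longrightarrow> v j = w j) \<Longrightarrow> mat_vec A x v = mat_vec A x w"
  unfolding mat_vec_def by (intro ext infsum_cong) auto

lemma mat_vec_add:
  assumes "opbound A K x" "l2le A b v" "l2le A c w" "i \<in> A"
  shows "mat_vec A x (\<lambda>j. v j + w j) i = mat_vec A x v i + mat_vec A x w i"
  unfolding mat_vec_def distrib_left
  by (rule infsum_add[OF mat_vec_tendsto(1)[OF assms(1,2,4)] mat_vec_tendsto(1)[OF assms(1,3,4)]])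

text \<open>
  The vector \<open>w\<close> is split into a finitely supported part and a small tail.  On the former only finitely many
  columns matter, on the latter the uniform bound \<open>K\<close> takes over.
\<close>

lemma l2conv_mat_vec:
  assumes K: "0 \<le> K" and X: "\<And>F. finite F \<Longrightarrow> F \<subseteq> A \<Longrightarrow> opbound A K (X F)" and x: "opbound A K x"
    and Xx: "\<And>j. j \<in> A \<Longrightarrow> l2conv A (\<lambda>F i. X F i j) (\<lambda>i. x i j)"
    and w: "l2le A b w" and W: "l2conv A W w"
  shows "l2conv A (\<lambda>F. fmv F (X F) (W F)) (mat_vec A x w)"
  unfolding l2conv_def
proof (intro allI impI)
  fix e :: real assume e: "e > 0"
  define d where "d = e / (4 * (K + 1))"
  have d: "d > 0" using e K by (simp add: d_def)
  have Kd: "K * d \<le> e / 4" using e K by (simp add: d_def field_simps)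
  obtain G where G: "finite G" "G \<subseteq> A" and tail: "l2le A d (\<lambda>i. if i \<in> G then 0 else w i)"
    using l2le_tail[OF w d] by blast
  let ?wG = "\<lambda>i. if i \<in> G then w i else 0" and ?wT = "\<lambda>i. if i \<in> G then 0 else w i"
  have wG: "l2le A (sqrt (nsq G ?wG)) ?wG" by (rule l2le_finite[OF G(1)]) auto
  have "l2conv A (\<lambda>F i. \<Sum>j\<in>G. w j * X F i j) (\<lambda>i. \<Sum>j\<in>G. w j * x i j)"
    using G by (intro l2conv_sum l2conv_scale Xx) auto
  then have c2: "l2conv A (\<lambda>F. fmv G (X F) w) (fmv G x w)" by (simp add: fmv_def mult.commute)
  have e4: "e / 4 > 0" using e by simp
  from l2convD[OF c2 e4] l2convD[OF W d] eventually_fsat_superset[OF G]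
  show "\<forall>\<^sub>F F in fsat A. l2le A e (\<lambda>i. fmv F (X F) (W F) i - mat_vec A x w i)"
  proof eventually_elim
    case (elim F)
    then have F: "finite F" "F \<subseteq> A" "G \<subseteq> F" by auto
    have "l2le A (d + d) (\<lambda>i. (W F i - w i) + ?wT i)" by (rule l2le_add[OF elim(2) tail])
    then have "sqrt (nsq F (\<lambda>i. (W F i - w i) + ?wT i)) \<le> d + d" using F by (rule_tac l2leD)
    then have "K * sqrt (nsq F (\<lambda>i. (W F i - w i) + ?wT i)) \<le> K * (d + d)"
      using K by (rule mult_left_mono)
    then have "K * sqrt (nsq F (\<lambda>i. (W F i - w i) + ?wT i)) \<le> e / 4 + e / 4" using Kd by (simp add: distrib_left)
    from l2le_mono[OF opboundD[OF X[OF F(1,2)] F(1,2)] this]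
    have 1: "l2le A (e/4 + e/4) (fmv F (X F) (\<lambda>i. (W F i - w i) + ?wT i))" .
    have 3: "l2le A (e/4) (mat_vec A x ?wT)"
      by (rule l2le_mono[OF opbound_mat_vec[OF x K tail] Kd])
    have "l2le A (((e/4 + e/4) + e/4) + e/4) (\<lambda>i. (fmv F (X F) (\<lambda>i. (W F i - w i) + ?wT i) i
        + (fmv G (X F) w i - fmv G x w i)) - mat_vec A x ?wT i)"
      by (intro l2le_diff l2le_add 1 3 elim(1))
    moreover have "(fmv F (X F) (\<lambda>i. (W F i - w i) + ?wT i) i
        + (fmv G (X F) w i - fmv G x w i)) - mat_vec A x ?wT i = fmv F (X F) (W F) i - mat_vec A x w i" if "i \<in> A" for i
    proof -
      have "mat_vec A x w = mat_vec A x (\<lambda>j. ?wG j + ?wT j)" by (rule mat_vec_cong) auto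
      then have "mat_vec A x w i = mat_vec A x ?wG i + mat_vec A x ?wT i"
        using mat_vec_add[OF x wG tail that] by simp
      moreover have "mat_vec A x ?wG = fmv G x ?wG" by (rule mat_vec_finite[OF G]) auto
      moreover have "fmv G x ?wG = fmv G x w" by (rule fmv_cong) auto
      moreover have "fmv F (X F) (\<lambda>i. (W F i - w i) + ?wT i) i + fmv G (X F) w i = fmv F (X F) (W F) i"
      proof -
        have "fmv G (X F) w i = fmv F (X F) ?wG i"
          unfolding fmv_def by (rule sum.mono_neutral_cong_left) (use F in auto)
        then have "fmv F (X F) (\<lambda>i. (W F i - w i) + ?wT i) i + fmv G (X F) w i
          = fmv F (X F) (\<lambda>i. ((W F i - w i) + ?wT i) + ?wG i) i"
          by (simp add: fmv_def sum.distrib[symmetric] distrib_left)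
        also have "\<dots> = fmv F (X F) (W F) i" by (subst fmv_cong[of F _ "W F"]) auto
        finally show ?thesis .
      qed
      ultimately show ?thesis by (simp add: algebra_simps)
    qed
    ultimately show ?case by (subst (asm) l2le_cong) (auto simp: field_simps)
  qed
qed

lemma l2conv_truncate:
  assumes "l2le A b w"
  shows "l2conv A (\<lambda>F i. if i \<in> F then w i else 0) w"
  unfolding l2conv_def
proof (intro allI impI)
  fix e :: real assume e: "e > 0"
  obtain G where G: "finite G" "G \<subseteq> A" and tail: "l2le A e (\<lambda>i. if i \<in> G then 0 else w i)"
    using l2le_tail[OF assms e] by blast
  from eventually_fsat_superset[OF G]
  show "\<forall>\<^sub>F F in fsat A. l2le A e (\<lambda>i. (if i \<in> F then w i else 0) - w i)"
  proof eventually_elim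
    case (elim F)
    show ?case unfolding l2le_def
    proof (intro allI impI)
      fix H assume H: "finite H \<and> H \<subseteq> A"
      have "nsq H (\<lambda>i. (if i \<in> F then w i else 0) - w i) \<le> nsq H (\<lambda>i. if i \<in> G then 0 else w i)"
        unfolding nsq_def by (rule sum_mono) (use elim in auto)
      also have "sqrt \<dots> \<le> e" using tail H by (auto intro: l2leD)
      finally show "sqrt (nsq H (\<lambda>i. (if i \<in> F then w i else 0) - w i)) \<le> e" by simp
    qed
  qed
qed

text \<open>
  Finite sections are extended by zero to matrices of the same type, so that they can be compared with
  \<open>x\<close>.
\<close>

definition sect :: "'i set \<Rightarrow> 'i mat \<Rightarrow> 'i mat" where
  "sect F x i j = (if i \<in> F \<and> j \<in> F then x i j else 0)"

lemma opbound_sect: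
  assumes "opbound A K x" "0 \<le> K" "finite F" "F \<subseteq> A" shows "opbound A K (sect F x)"
  unfolding opbound_def
proof (intro allI impI)
  fix C v assume C: "finite C \<and> C \<subseteq> A"
  have f: "fmv C (sect F x) v i = (if i \<in> F then fmv (C \<inter> F) x v i else 0)" for i
    unfolding fmv_def sect_def using C
    by (auto simp: if_distrib[of "\<lambda>t. t * _"] sum.inter_restrict intro!: sum.cong)
  have "l2le A (sqrt (nsq F (fmv C (sect F x) v))) (fmv C (sect F x) v)"
    by (rule l2le_finite[OF assms(3)]) (simp add: f)
  moreover have "sqrt (nsq F (fmv C (sect F x) v)) \<le> K * sqrt (nsq C v)"
  proof -
    have "nsq F (fmv C (sect F x) v) = nsq F (fmv (C \<inter> F) x v)" by (rule nsq_cong) (simp add: f)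
    also have "sqrt \<dots> \<le> K * sqrt (nsq (C \<inter> F) v)"
      by (rule l2leD[OF opboundD[OF assms(1)]]) (use C assms in auto)
    also have "\<dots> \<le> K * sqrt (nsq C v)"
      unfolding nsq_def using C assms(2) by (intro mult_left_mono real_sqrt_le_mono sum_mono2) auto
    finally show ?thesis by simp
  qed
  ultimately show "l2le A (K * sqrt (nsq C v)) (fmv C (sect F x) v)" by (rule l2le_mono)
qed

lemma l2conv_sect:
  assumes "opbound A K x" "j \<in> A" shows "l2conv A (\<lambda>F i. sect F x i j) (\<lambda>i. x i j)"
proof (rule l2conv_cong[OF _ refl l2conv_truncate[OF opbound_column[OF assms]]])
  from eventually_fsat_member[OF assms(2)]
  show "\<forall>\<^sub>F F in fsat A. \<forall>i\<in>A. (if i \<in> F then x i j else 0) = sect F x i j"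
    by eventually_elim (auto simp: sect_def)
qed

section \<open>Functions of finite Gram matrices\<close>

lemma gram_fun_apply:
  assumes "finite C" "i \<in> C"
  shows "fmv C (gram_fun f R C x) v i = (\<Sum>k\<in>C. (of_real (f (sq_sval R C x k)) * ip C (sbasis R C x k) v) * sbasis R C x k i)"
proof -
  have "fmv C (gram_fun f R C x) v i = (\<Sum>j\<in>C. \<Sum>k\<in>C. (of_real (f (sq_sval R C x k)) * (cnj (sbasis R C x k j) * v j)) * sbasis R C x k i)"
    unfolding fmv_def gram_fun_def using assms by (auto simp: sum_distrib_left sum_distrib_right mult_ac intro!: sum.cong)
  also have "\<dots> = (\<Sum>k\<in>C. \<Sum>j\<in>C. (of_real (f (sq_sval R C x k)) * (cnj (sbasis R C x k j) * v j)) * sbasis R C x k i)"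
    by (rule sum.swap)
  also have "\<dots> = (\<Sum>k\<in>C. (of_real (f (sq_sval R C x k)) * ip C (sbasis R C x k) v) * sbasis R C x k i)"
    by (simp add: ip_def sum_distrib_left sum_distrib_right)
  finally show ?thesis .
qed

lemma nsq_gram_fun:
  assumes "finite C" "0 \<le> K" "\<And>k. k \<in> C \<Longrightarrow> \<bar>f (sq_sval R C x k)\<bar> \<le> K"
  shows "nsq C (fmv C (gram_fun f R C x) v) \<le> K\<^sup>2 * nsq C v"
proof -
  note on = right_singular_orthonormal[OF sbasis[OF assms(1), of R x]]
  have "nsq C (fmv C (gram_fun f R C x) v) =
     nsq C (\<lambda>i. \<Sum>k\<in>C. (of_real (f (sq_sval R C x k)) * ip C (sbasis R C x k) v) * sbasis R C x k i)"
    by (rule nsq_cong) (rule gram_fun_apply[OF assms(1)])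
  also have "\<dots> = (\<Sum>k\<in>C. (f (sq_sval R C x k))\<^sup>2 * (cmod (ip C (sbasis R C x k) v))\<^sup>2)"
    by (subst nsq_sum_orthonormal[OF assms(1) on]) (simp add: norm_mult power_mult_distrib)
  also have "\<dots> \<le> (\<Sum>k\<in>C. K\<^sup>2 * (cmod (ip C (sbasis R C x k) v))\<^sup>2)"
    using assms(3) by (intro sum_mono mult_right_mono) (auto simp: abs_le_square_iff[symmetric] assms(2))
  also have "\<dots> = K\<^sup>2 * nsq C v"
    unfolding sum_distrib_left[symmetric] parseval[OF assms(1,1) on refl] ..
  finally show ?thesis .
qed

lemma opbound_gram_fun:
  assumes "finite F" "F \<subseteq> A" "0 \<le> K" "\<And>k. k \<in> F \<Longrightarrow> \<bar>f (sq_sval R F x k)\<bar> \<le> K"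
  shows "opbound A K (gram_fun f R F x)"
  unfolding opbound_def
proof (intro allI impI)
  fix C and v :: "'a \<Rightarrow> complex" assume C: "finite C \<and> C \<subseteq> A"
  define v' where "v' = (\<lambda>j. if j \<in> C then v j else 0)"
  have f: "fmv C (gram_fun f R F x) v = fmv F (gram_fun f R F x) v'"
  proof
    fix i
    have "fmv C (gram_fun f R F x) v i = (\<Sum>j\<in>C \<inter> F. gram_fun f R F x i j * v j)"
      unfolding fmv_def by (rule sum.mono_neutral_right) (use C in \<open>auto simp: gram_fun_def\<close>)
    also have "\<dots> = fmv F (gram_fun f R F x) v' i"
      unfolding fmv_def by (rule sum.mono_neutral_cong_left) (use C assms in \<open>auto simp: v'_def\<close>)
    finally show "fmv C (gram_fun f R F x) v i = fmv F (gram_fun f R F x) v' i" .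
  qed
  have "l2le A (sqrt (nsq F (fmv F (gram_fun f R F x) v'))) (fmv F (gram_fun f R F x) v')"
    by (rule l2le_finite[OF assms(1)]) (simp add: fmv_def gram_fun_def)
  moreover have "sqrt (nsq F (fmv F (gram_fun f R F x) v')) \<le> K * sqrt (nsq C v)"
  proof -
    have "nsq F (fmv F (gram_fun f R F x) v') \<le> K\<^sup>2 * nsq F v'" by (rule nsq_gram_fun) (use assms in auto)
    also have "nsq F v' \<le> nsq C v"
    proof -
      have "nsq F v' = (\<Sum>j\<in>F \<inter> C. (cmod (v j))\<^sup>2)"
        unfolding nsq_def by (rule sum.mono_neutral_cong_right) (use assms in \<open>auto simp: v'_def\<close>)
      also have "\<dots> \<le> nsq C v" unfolding nsq_def by (rule sum_mono2) (use C in auto)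
      finally show ?thesis .
    qed
    finally have "sqrt (nsq F (fmv F (gram_fun f R F x) v')) \<le> sqrt (K\<^sup>2 * nsq C v)"
      by (simp add: mult_left_mono)
    then show ?thesis using assms(3) by (simp add: real_sqrt_mult)
  qed
  ultimately show "l2le A (K * sqrt (nsq C v)) (fmv C (gram_fun f R F x) v)" unfolding f by (rule l2le_mono)
qed

lemma gram_fun_mult:
  assumes "finite C" "i \<in> C" "j \<in> C"
  shows "fmv C (gram_fun f R C x) (\<lambda>k. gram_fun g R C x k j) i = gram_fun (\<lambda>t. f t * g t) R C x i j"
proof -
  let ?v = "sbasis R C x"
  note on = right_singular_orthonormal[OF sbasis[OF assms(1), of R x]]
  have "ip C (?v k) (\<lambda>i. gram_fun g R C x i j) = of_real (g (sq_sval R C x k)) * cnj (?v k j)" if k: "k \<in> C" for k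
  proof -
    have "ip C (?v k) (\<lambda>i. gram_fun g R C x i j) = ip C (?v k) (\<lambda>i. \<Sum>l\<in>C. (of_real (g (sq_sval R C x l)) * cnj (?v l j)) * ?v l i)"
      by (rule ip_cong) (auto simp: gram_fun_def assms mult_ac)
    also have "\<dots> = (\<Sum>l\<in>C. if l = k then of_real (g (sq_sval R C x l)) * cnj (?v l j) else 0)"
      unfolding ip_sum_right using on k by (intro sum.cong) (auto simp: orthonormal_def)
    also have "\<dots> = of_real (g (sq_sval R C x k)) * cnj (?v k j)" using k assms by simp
    finally show ?thesis .
  qed
  then show ?thesis
    unfolding gram_fun_apply[OF assms(1,2)] by (simp add: gram_fun_def assms mult_ac)
qed

lemma gram_fun_id:
  assumes "finite C" "i \<in> C" "j \<in> C"
  shows "gram_fun (\<lambda>t. t) R C x i j = (\<Sum>k\<in>R. cnj (x k i) * x k j)"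
proof -
  let ?v = "sbasis R C x"
  have v: "right_singular R C x ?v" by (rule sbasis[OF assms(1)])
  note on = right_singular_orthonormal[OF v]
  let ?e = "\<lambda>i j. if j = i then 1 else 0 :: complex"
  have ce: "fmv C x (?e i) = (\<lambda>k. x k i)" if "i \<in> C" for i
    unfolding fmv_def using assms(1) that by (simp add: if_distrib cong: if_cong)
  have "(\<Sum>k\<in>R. cnj (x k i) * x k j) = ip R (fmv C x (?e i)) (fmv C x (?e j))"
    unfolding ip_def by (simp add: ce assms)
  also have "fmv C x (?e i) = fmv C x (\<lambda>m. \<Sum>k\<in>C. ip C (?v k) (?e i) * ?v k m)"
    by (rule fmv_cong) (simp add: orthonormal_expand[OF assms(1,1) on refl])
  also have "ip R \<dots> (fmv C x (?e j)) = (\<Sum>k\<in>C. ?v k i * (of_real (sq_sval R C x k) * cnj (?v k j)))"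
    unfolding fmv_sum ip_sum_left
    by (intro sum.cong refl) (simp add: right_singular_gram[OF assms(1) v] ip_indicator assms sq_sval_def)
  also have "\<dots> = gram_fun (\<lambda>t. t) R C x i j" by (simp add: gram_fun_def assms mult_ac)
  finally show ?thesis by simp
qed

lemma gram_fun_one:
  assumes "finite C" "i \<in> C" "j \<in> C"
  shows "gram_fun (\<lambda>t. 1) R C x i j = (if i = j then 1 else 0)"
  using orthonormal_kernel[OF assms(1,1) right_singular_orthonormal[OF sbasis[OF assms(1)]] refl assms(2,3), of R x]
  by (simp add: gram_fun_def assms)

lemma gram_fun_cong:
  assumes "\<And>k. k \<in> C \<Longrightarrow> f (sq_sval R C x k) = g (sq_sval R C x k)"
  shows "gram_fun f R C x i j = gram_fun g R C x i j"
  unfolding gram_fun_def using assms by auto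

lemma gram_fun_diff: "gram_fun f R C x i j - gram_fun g R C x i j = gram_fun (\<lambda>t. f t - g t) R C x i j"
  unfolding gram_fun_def by (simp add: sum_subtractf algebra_simps)

lemma gram_fun_sum: "(\<Sum>m\<in>M. of_real (c m) * gram_fun (f m) R C x i j) = gram_fun (\<lambda>t. \<Sum>m\<in>M. c m * f m t) R C x i j"
proof (cases "i \<in> C \<and> j \<in> C")
  case True
  then show ?thesis unfolding gram_fun_def
    by (simp add: sum_distrib_left sum_distrib_right mult_ac) (subst sum.swap, simp)
qed (auto simp: gram_fun_def)

section \<open>Continuous functional calculus\<close>

lemma weierstrass_poly:
  fixes f :: "real \<Rightarrow> real"
  assumes "continuous_on {0..M} f" "0 < e"
  shows "\<exists>P :: real poly. \<forall>t\<in>{0..M}. \<bar>poly P t - f t\<bar> < e"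
proof -
  obtain g where g: "real_polynomial_function g" "\<And>t. t \<in> {0..M} \<Longrightarrow> \<bar>f t - g t\<bar> < e"
    using Stone_Weierstrass_real_polynomial_function[OF _ assms] by (metis compact_Icc)
  obtain a n where a: "g = (\<lambda>t. \<Sum>i\<le>n. a i * t ^ i)"
    using g(1) unfolding real_polynomial_function_iff_sum by blast
  have "poly (\<Sum>i\<le>n. monom (a i) i) t = g t" for t by (simp add: a poly_sum poly_monom)
  then show ?thesis using g(2) by (intro exI[of _ "\<Sum>i\<le>n. monom (a i) i"]) (auto simp: abs_minus_commute)
qed

lemma mat_mult_mat_vec: "mat_mult A y x i j = mat_vec A y (\<lambda>k. x k j) i"
  by (simp add: mat_mult_def mat_vec_def)

lemma matsupp_mat_mult: "matsupp A y \<Longrightarrow> matsupp A x \<Longrightarrow> matsupp A (mat_mult A y x)"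
  unfolding matsupp_def mat_mult_def by auto

lemma matsupp_adjoint: "matsupp A x \<Longrightarrow> matsupp A (mat_adjoint x)"
  unfolding matsupp_def mat_adjoint_def by auto

lemma mat_vec_scale:
  assumes "opbound A K x" "l2le A b v" "i \<in> A"
  shows "mat_vec A x (\<lambda>j. c * v j) i = c * mat_vec A x v i"
proof -
  have "mat_vec A x (\<lambda>j. c * v j) i = (\<Sum>\<^sub>\<infinity>j\<in>A. c * (x i j * v j))"
    by (simp add: mat_vec_def mult.left_commute)
  also have "\<dots> = c * mat_vec A x v i"
    unfolding mat_vec_def by (rule infsum_cmult_right) (rule mat_vec_tendsto(1)[OF assms])
  finally show ?thesis .
qed

lemma mat_vec_sum:
  assumes "opbound A K x" "finite C" "\<And>j. j \<in> C \<Longrightarrow> l2le A b (v j)" "i \<in> A"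
  shows "mat_vec A x (\<lambda>k. \<Sum>j\<in>C. c j * v j k) i = (\<Sum>j\<in>C. c j * mat_vec A x (v j) i)"
  using assms(2,3)
proof (induction C rule: finite_induct)
  case empty show ?case by (simp add: mat_vec_def)
next
  case (insert j C)
  have 1: "l2le A (cmod (c j) * b) (\<lambda>k. c j * v j k)" using insert by (intro l2le_scale) auto
  have 2: "l2le A (\<Sum>j\<in>C. cmod (c j) * b) (\<lambda>k. \<Sum>j\<in>C. c j * v j k)"
    using insert by (intro l2le_sum l2le_scale) auto
  have 3: "l2le A b (v j)" using insert by auto
  show ?case using insert
    by (simp add: mat_vec_add[OF assms(1) 1 2 assms(4)] mat_vec_scale[OF assms(1) 3 assms(4)])
qed

lemma opbound_mat_mult:
  assumes "opbound A K y" "0 \<le> K" "opbound A L x"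
  shows "opbound A (K * L) (mat_mult A y x)"
  unfolding opbound_def
proof (intro allI impI)
  fix C v assume C: "finite C \<and> C \<subseteq> A"
  have "l2le A (K * (L * sqrt (nsq C v))) (mat_vec A y (fmv C x v))"
    using opbound_mat_vec[OF assms(1,2) opboundD[OF assms(3)]] C by blast
  moreover have "mat_vec A y (fmv C x v) i = fmv C (mat_mult A y x) v i" if "i \<in> A" for i
  proof -
    have "mat_vec A y (fmv C x v) i = mat_vec A y (\<lambda>k. \<Sum>j\<in>C. v j * x k j) i"
      by (simp add: fmv_def mult.commute)
    also have "\<dots> = (\<Sum>j\<in>C. v j * mat_vec A y (\<lambda>k. x k j) i)"
      by (rule mat_vec_sum[OF assms(1) _ _ that]) (use C opbound_column[OF assms(3)] in auto)
    finally show ?thesis by (simp add: fmv_def mat_mult_mat_vec mult.commute)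
  qed
  ultimately show "l2le A (K * L * sqrt (nsq C v)) (fmv C (mat_mult A y x) v)"
    by (subst (asm) l2le_cong) (auto simp: mult.assoc)
qed

text \<open>
  The matrix \<open>b\<close> is \<open>f(x\<^sup>* x)\<close>, obtained as the limit of the same function of finite sections.
\<close>

definition gram_conv :: "'i set \<Rightarrow> 'i mat \<Rightarrow> (real \<Rightarrow> real) \<Rightarrow> 'i mat \<Rightarrow> bool" where
  "gram_conv A x f b \<longleftrightarrow> matsupp A b \<and> (\<forall>j\<in>A. l2conv A (\<lambda>F i. gram_fun f F F x i j) (\<lambda>i. b i j))"

lemma gram_conv_coord:
  assumes "gram_conv A x f b" "i \<in> A" "j \<in> A"
  shows "((\<lambda>F. gram_fun f F F x i j) \<longlongrightarrow> b i j) (fsat A)"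
  using l2conv_coord[of A "\<lambda>F i. gram_fun f F F x i j" "\<lambda>i. b i j" i] assms unfolding gram_conv_def by blast

lemma gram_conv_unique:
  assumes "gram_conv A x f b" "gram_conv A x f c" shows "b = c"
proof (intro ext)
  fix i j
  show "b i j = c i j"
  proof (cases "i \<in> A \<and> j \<in> A")
    case True
    then show ?thesis
      using tendsto_unique[OF finite_subsets_at_top_neq_bot gram_conv_coord[OF assms(1)] gram_conv_coord[OF assms(2)]] by blast
  next
    case False then show ?thesis using assms by (auto simp: gram_conv_def matsupp_def)
  qed
qed

locale bounded_matrix =
  fixes A :: "'i set" and x :: "'i mat"
  assumes bounded: "x \<in> bounded_ops A"
begin

definition gram where "gram = mat_mult A (mat_adjoint x) x"
definition gram_norm where "gram_norm = op_norm A gram"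

lemmas x_supp = bounded_ops_opbound(1)[OF bounded]
lemmas x_bound = bounded_ops_opbound(2)[OF bounded]
lemmas x_norm = bounded_ops_opbound(3)[OF bounded]
lemmas adj_bound = opbound_adjoint[OF x_bound x_norm]

lemma gram_bounded: "gram \<in> bounded_ops A"
  unfolding gram_def
  by (rule opbound_bounded_ops(1)[OF matsupp_mat_mult[OF matsupp_adjoint[OF x_supp] x_supp]
      opbound_mat_mult[OF adj_bound x_norm x_bound]]) (simp add: x_norm)

lemmas gram_supp = bounded_ops_opbound(1)[OF gram_bounded, folded gram_norm_def]
lemmas gram_bound = bounded_ops_opbound(2)[OF gram_bounded, folded gram_norm_def]
lemmas gram_norm_nonneg = bounded_ops_opbound(3)[OF gram_bounded, folded gram_norm_def]

lemma gram_conv_id: "gram_conv A x (\<lambda>t. t) gram"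
  unfolding gram_conv_def
proof (intro conjI gram_supp ballI)
  fix j assume j: "j \<in> A"
  have "l2conv A (\<lambda>F. fmv F (sect F (mat_adjoint x)) (\<lambda>k. sect F x k j)) (mat_vec A (mat_adjoint x) (\<lambda>k. x k j))"
    by (rule l2conv_mat_vec[OF x_norm opbound_sect[OF adj_bound x_norm] adj_bound l2conv_sect[OF adj_bound]
          opbound_column[OF x_bound j] l2conv_sect[OF x_bound j]])
  then show "l2conv A (\<lambda>F i. gram_fun (\<lambda>t. t) F F x i j) (\<lambda>i. gram i j)"
  proof (rule l2conv_cong[rotated 2])
    show "mat_vec A (mat_adjoint x) (\<lambda>k. x k j) i = gram i j" for i by (simp add: gram_def mat_mult_mat_vec)
    from eventually_fsat_member[OF j]
    show "\<forall>\<^sub>F F in fsat A. \<forall>i\<in>A. fmv F (sect F (mat_adjoint x)) (\<lambda>k. sect F x k j) i = gram_fun (\<lambda>t. t) F F x i j"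
    proof eventually_elim
      case (elim F)
      show ?case
      proof
        fix i
        show "fmv F (sect F (mat_adjoint x)) (\<lambda>k. sect F x k j) i = gram_fun (\<lambda>t. t) F F x i j"
        proof (cases "i \<in> F")
          case True
          with elim show ?thesis by (simp add: gram_fun_id fmv_def sect_def mat_adjoint_def)
        qed (simp add: gram_fun_def fmv_def sect_def)
      qed
    qed
  qed
qed

text \<open>
  For a vector \<open>v\<close> supported on \<open>F\<close>, the norm of the truncation of \<open>x v\<close> to \<open>F\<close> is at most that of \<open>x v\<close>,
  whose square is \<open>\<langle>v, x\<^sup>* x v\<rangle>\<close>.
\<close>

lemma sq_sval_le: assumes F: "finite F" "F \<subseteq> A" and k: "k \<in> F" shows "sq_sval F F x k \<le> gram_norm"
proof -
  let ?v = "sbasis F F x k"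
  have v1: "nsq F ?v = 1" using orthonormalD(2)[OF right_singular_orthonormal[OF sbasis[OF F(1)]] k] .
  have eq: "nsq G (fmv F x ?v) = Re (ip F ?v (fmv F (gram_fun (\<lambda>t. t) G G x) ?v))" if G: "finite G" "F \<subseteq> G" for G
  proof -
    have "complex_of_real (nsq G (fmv F x ?v)) = ip F (fmv G (mat_adjoint x) (fmv F x ?v)) ?v"
      unfolding ip_self[symmetric] by (rule ip_fmv_adjoint)
    also have "\<dots> = cnj (ip F ?v (fmv G (mat_adjoint x) (fmv F x ?v)))" by (simp add: ip_cnj)
    also have "ip F ?v (fmv G (mat_adjoint x) (fmv F x ?v)) = ip F ?v (fmv F (gram_fun (\<lambda>t. t) G G x) ?v)"
    proof (rule ip_cong)
      fix i assume i: "i \<in> F"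
      have "fmv G (mat_adjoint x) (fmv F x ?v) i = (\<Sum>j\<in>F. (\<Sum>m\<in>G. cnj (x m i) * x m j) * ?v j)"
        unfolding fmv_def mat_adjoint_def
        by (simp add: sum_distrib_left sum_distrib_right mult_ac) (rule sum.swap)
      also have "\<dots> = fmv F (gram_fun (\<lambda>t. t) G G x) ?v i"
        unfolding fmv_def using i G by (intro sum.cong refl) (simp add: gram_fun_id subsetD)
      finally show "fmv G (mat_adjoint x) (fmv F x ?v) i = fmv F (gram_fun (\<lambda>t. t) G G x) ?v i" .
    qed simp
    finally show ?thesis by (metis complex_cnj_cnj complex_cnj_complex_of_real Re_complex_of_real)
  qed
  have lim: "((\<lambda>G. Re (ip F ?v (fmv F (gram_fun (\<lambda>t. t) G G x) ?v))) \<longlongrightarrow> Re (ip F ?v (fmv F gram ?v))) (fsat A)"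
    unfolding ip_def fmv_def
    by (intro tendsto_intros gram_conv_coord[OF gram_conv_id]) (use F in auto)
  have "sq_sval F F x k \<le> Re (ip F ?v (fmv F gram ?v))"
  proof (rule tendsto_lowerbound[OF lim _ finite_subsets_at_top_neq_bot])
    from eventually_fsat_superset[OF F]
    show "\<forall>\<^sub>F G in fsat A. sq_sval F F x k \<le> Re (ip F ?v (fmv F (gram_fun (\<lambda>t. t) G G x) ?v))"
    proof eventually_elim
      case (elim G)
      then have "sq_sval F F x k \<le> nsq G (fmv F x ?v)"
        unfolding sq_sval_def nsq_def by (intro sum_mono2) auto
      then show ?case using eq[of G] elim by simp
    qed
  qed
  also have "\<dots> \<le> cmod (ip F ?v (fmv F gram ?v))" by (rule complex_Re_le_cmod)
  also have "\<dots> \<le> sqrt (nsq F ?v) * sqrt (nsq F (fmv F gram ?v))"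
    using cauchy_schwarz[OF F(1), of ?v "fmv F gram ?v"] by (simp add: real_le_rsqrt real_sqrt_mult[symmetric])
  also have "sqrt (nsq F (fmv F gram ?v)) \<le> gram_norm * sqrt (nsq F ?v)"
    by (rule l2leD[OF opboundD[OF gram_bound F] F])
  finally show ?thesis by (simp add: v1)
qed

lemma sq_sval_range: "finite F \<Longrightarrow> F \<subseteq> A \<Longrightarrow> k \<in> F \<Longrightarrow> sq_sval F F x k \<in> {0..gram_norm}"
  by (simp add: sq_sval_le)

lemma opbound_gram:
  assumes "\<And>t. t \<in> {0..gram_norm} \<Longrightarrow> \<bar>f t\<bar> \<le> K" "finite F" "F \<subseteq> A"
  shows "opbound A K (gram_fun f F F x)"
proof (rule opbound_gram_fun[OF assms(2,3)])
  show "0 \<le> K" using assms(1)[of 0] gram_norm_nonneg by force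
qed (use assms(1) sq_sval_range[OF assms(2,3)] in blast)

lemma gram_conv_opbound:
  assumes "gram_conv A x f b" "\<And>t. t \<in> {0..gram_norm} \<Longrightarrow> \<bar>f t\<bar> \<le> K"
  shows "opbound A K b"
proof (rule opbound_limit[OF finite_subsets_at_top_neq_bot gram_conv_coord[OF assms(1)]])
  show "\<forall>\<^sub>F F in fsat A. opbound A K (gram_fun f F F x)"
    by (rule eventually_finite_subsets_at_top_weakI) (rule opbound_gram[OF assms(2)])
qed auto

lemma gram_conv_one: "gram_conv A x (\<lambda>t. 1) (mat_id A)"
  unfolding gram_conv_def
proof (intro conjI ballI)
  show "matsupp A (mat_id A)" by (auto simp: matsupp_def mat_id_def)
  fix j assume j: "j \<in> A"
  show "l2conv A (\<lambda>F i. gram_fun (\<lambda>t. 1) F F x i j) (\<lambda>i. mat_id A i j)"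
  proof (rule l2conv_cong[OF _ refl l2conv_const])
    from eventually_fsat_member[OF j]
    show "\<forall>\<^sub>F F in fsat A. \<forall>i\<in>A. mat_id A i j = gram_fun (\<lambda>t. 1) F F x i j"
    proof eventually_elim
      case (elim F)
      show ?case
      proof
        fix i assume "i \<in> A"
        with elim j show "mat_id A i j = gram_fun (\<lambda>t. 1) F F x i j"
          by (cases "i \<in> F") (simp add: gram_fun_one mat_id_def, auto simp: mat_id_def gram_fun_def)
      qed
    qed
  qed
qed

lemma gram_conv_mult:
  assumes f: "gram_conv A x f b" "\<And>t. t \<in> {0..gram_norm} \<Longrightarrow> \<bar>f t\<bar> \<le> K"
    and g: "gram_conv A x g c" "\<And>t. t \<in> {0..gram_norm} \<Longrightarrow> \<bar>g t\<bar> \<le> L"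
  shows "gram_conv A x (\<lambda>t. f t * g t) (mat_mult A b c)"
  unfolding gram_conv_def
proof (intro conjI ballI)
  show "matsupp A (mat_mult A b c)" using f(1) g(1) by (intro matsupp_mat_mult) (auto simp: gram_conv_def)
  have K: "0 \<le> K" using f(2)[of 0] gram_norm_nonneg by force
  fix j assume j: "j \<in> A"
  have "l2conv A (\<lambda>F. fmv F (gram_fun f F F x) (\<lambda>k. gram_fun g F F x k j)) (mat_vec A b (\<lambda>k. c k j))"
    by (rule l2conv_mat_vec[OF K opbound_gram[OF f(2)] gram_conv_opbound[OF f] _
          opbound_column[OF gram_conv_opbound[OF g] j]])
       (use f(1) g(1) j in \<open>auto simp: gram_conv_def\<close>)
  then show "l2conv A (\<lambda>F i. gram_fun (\<lambda>t. f t * g t) F F x i j) (\<lambda>i. mat_mult A b c i j)"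
  proof (rule l2conv_cong[rotated 2])
    show "mat_vec A b (\<lambda>k. c k j) i = mat_mult A b c i j" for i by (simp add: mat_mult_mat_vec)
    from eventually_fsat_member[OF j]
    show "\<forall>\<^sub>F F in fsat A. \<forall>i\<in>A. fmv F (gram_fun f F F x) (\<lambda>k. gram_fun g F F x k j) i = gram_fun (\<lambda>t. f t * g t) F F x i j"
    proof eventually_elim
      case (elim F)
      show ?case
      proof
        fix i
        show "fmv F (gram_fun f F F x) (\<lambda>k. gram_fun g F F x k j) i = gram_fun (\<lambda>t. f t * g t) F F x i j"
          using elim by (cases "i \<in> F") (simp add: gram_fun_mult, simp add: gram_fun_def fmv_def)
      qed
    qed
  qed
qed

lemma gram_conv_sum:
  assumes "finite K" "\<And>k. k \<in> K \<Longrightarrow> gram_conv A x (f k) (b k)"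
  shows "gram_conv A x (\<lambda>t. \<Sum>k\<in>K. c k * f k t) (\<lambda>i j. \<Sum>k\<in>K. of_real (c k) * b k i j)"
  unfolding gram_conv_def gram_fun_sum[symmetric]
proof (intro conjI ballI)
  show "matsupp A (\<lambda>i j. \<Sum>k\<in>K. of_real (c k) * b k i j)"
    using assms(2) by (auto simp: gram_conv_def matsupp_def intro!: sum.neutral)
  show "l2conv A (\<lambda>F i. \<Sum>k\<in>K. of_real (c k) * gram_fun (f k) F F x i j) (\<lambda>i. \<Sum>k\<in>K. of_real (c k) * b k i j)"
    if "j \<in> A" for j
    using assms that by (intro l2conv_sum l2conv_scale) (auto simp: gram_conv_def)
qed

lemma gram_conv_diff:
  assumes "gram_conv A x f b" "gram_conv A x g c"
  shows "gram_conv A x (\<lambda>t. f t - g t) (\<lambda>i j. b i j - c i j)"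
proof -
  have "gram_conv A x (\<lambda>t. \<Sum>k\<in>UNIV. (if k then 1 else -1) * (if k then f else g) t)
     (\<lambda>i j. \<Sum>k\<in>UNIV. of_real (if k then 1 else -1) * (if k then b else c) i j)"
    by (rule gram_conv_sum) (use assms in \<open>auto split: if_splits\<close>)
  then show ?thesis by (simp add: UNIV_bool)
qed

lemma gram_conv_power:
  assumes "gram_conv A x h c" "\<And>t. t \<in> {0..gram_norm} \<Longrightarrow> \<bar>h t\<bar> \<le> N"
  shows "gram_conv A x (\<lambda>t. h t ^ k) (mat_power A c k)"
proof (induction k)
  case 0 show ?case using gram_conv_one by simp
next
  case (Suc k)
  have "\<bar>h t ^ k\<bar> \<le> N ^ k" if "t \<in> {0..gram_norm}" for t
    unfolding power_abs by (intro power_mono assms(2) that) simp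
  from gram_conv_mult[OF assms Suc this] show ?case by simp
qed

lemma gram_conv_poly:
  assumes "gram_conv A x h c" "\<And>t. t \<in> {0..gram_norm} \<Longrightarrow> \<bar>h t\<bar> \<le> N"
  shows "gram_conv A x (\<lambda>t. poly P (h t)) (mat_poly A P c)"
  unfolding mat_poly_def poly_altdef
  by (rule gram_conv_sum) (auto intro: gram_conv_power[OF assms])

text \<open>
  By the Weierstrass theorem \<open>f\<close> is a uniform limit of polynomials \<open>P\<^sub>n\<close>.  The matrices \<open>P\<^sub>n(x\<^sup>* x)\<close> form a Cauchy
  sequence in operator norm, and the convergence for \<open>f\<close> follows by approximation, uniformly over all finite
  sections.
\<close>

lemma gram_conv_exists:
  assumes "continuous_on {0..gram_norm} f"
  shows "\<exists>b. gram_conv A x f b"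
proof -
  have "\<forall>n. \<exists>P :: real poly. \<forall>t\<in>{0..gram_norm}. \<bar>poly P t - f t\<bar> < 1 / Suc n"
    using weierstrass_poly[OF assms] by simp
  then obtain P :: "nat \<Rightarrow> real poly" where P: "\<And>n t. t \<in> {0..gram_norm} \<Longrightarrow> \<bar>poly (P n) t - f t\<bar> < 1 / Suc n"
    by metis
  define B where "B n = mat_poly A (P n) gram" for n
  have conv: "gram_conv A x (\<lambda>t. poly (P n) t) (B n)" for n
    unfolding B_def by (rule gram_conv_poly[OF gram_conv_id, of gram_norm]) auto
  have BB: "opbound A (1 / Suc n + 1 / Suc m) (\<lambda>i j. B n i j - B m i j)" for n m
  proof (rule gram_conv_opbound[OF gram_conv_diff[OF conv conv]])
    fix t assume "t \<in> {0..gram_norm}"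
    from P[OF this, of n] P[OF this, of m] show "\<bar>poly (P n) t - poly (P m) t\<bar> \<le> 1 / Suc n + 1 / Suc m" by linarith
  qed
  have lim0: "(\<lambda>n. 1 / real (Suc n)) \<longlonglongrightarrow> 0" using LIMSEQ_inverse_real_of_nat by (simp add: inverse_eq_divide)
  have conv_entry: "convergent (\<lambda>n. B n i j)" for i j
  proof (cases "i \<in> A \<and> j \<in> A")
    case True
    have *: "cmod (B n i j - B m i j) \<le> 1 / Suc n + 1 / Suc m" for n m
      using l2le_coord[OF opbound_column[OF BB]] True by blast
    have "Cauchy (\<lambda>n. B n i j)"
    proof (rule CauchyI)
      fix e :: real assume "e > 0"
      then have "\<forall>\<^sub>F n in sequentially. 1 / real (Suc n) < e / 2" using order_tendstoD(2)[OF lim0, of "e/2"] by simp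
      then obtain N0 where N0: "\<And>n. n \<ge> N0 \<Longrightarrow> 1 / real (Suc n) < e / 2" by (auto simp: eventually_sequentially)
      show "\<exists>L. \<forall>m\<ge>L. \<forall>n\<ge>L. cmod (B m i j - B n i j) < e"
      proof (intro exI allI impI)
        fix m n assume "m \<ge> N0" "n \<ge> N0"
        from *[of m n] N0[OF this(1)] N0[OF this(2)] show "cmod (B m i j - B n i j) < e" by linarith
      qed
    qed
    then show ?thesis by (simp add: Cauchy_convergent_iff)
  next
    case False
    then have "B n i j = 0" for n using conv[of n] by (auto simp: gram_conv_def matsupp_def)
    then show ?thesis by (simp add: convergent_const)
  qed
  define b where "b i j = lim (\<lambda>n. B n i j)" for i j
  have lim: "(\<lambda>n. B n i j) \<longlonglongrightarrow> b i j" for i j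
    using conv_entry unfolding b_def by (simp add: convergent_LIMSEQ_iff)
  have supp: "matsupp A b"
    unfolding matsupp_def
  proof (intro allI impI)
    fix i j assume "i \<notin> A \<or> j \<notin> A"
    then have "B n i j = 0" for n using conv[of n] by (auto simp: gram_conv_def matsupp_def)
    then show "b i j = 0" by (simp add: b_def)
  qed
  have Bb: "opbound A (1 / Suc n) (\<lambda>i j. B n i j - b i j)" for n
  proof (rule opbound_limit[OF sequentially_bot])
    show "(\<lambda>m. B n i j - B m i j) \<longlonglongrightarrow> B n i j - b i j" for i j by (intro tendsto_intros lim)
    show "(\<lambda>m. 1 / real (Suc n) + 1 / real (Suc m)) \<longlonglongrightarrow> 1 / real (Suc n)"
      using tendsto_add[OF tendsto_const lim0] by simp
    show "\<forall>\<^sub>F m in sequentially. opbound A (1 / real (Suc n) + 1 / real (Suc m)) (\<lambda>i j. B n i j - B m i j)"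
      by (intro always_eventually allI BB)
  qed
  have "gram_conv A x f b"
    unfolding gram_conv_def
  proof (intro conjI supp ballI)
    fix j assume j: "j \<in> A"
    show "l2conv A (\<lambda>F i. gram_fun f F F x i j) (\<lambda>i. b i j)"
      unfolding l2conv_def
    proof (intro allI impI)
      fix e :: real assume e: "e > 0"
      then obtain n where n: "1 / real (Suc n) < e / 3"
        using order_tendstoD(2)[OF lim0, of "e/3"] by (auto simp: eventually_sequentially)
      have e3: "e/3 > 0" using e by simp
      have "l2conv A (\<lambda>F i. gram_fun (\<lambda>t. poly (P n) t) F F x i j) (\<lambda>i. B n i j)"
        using conv[of n] j by (simp add: gram_conv_def)
      from l2convD[OF this e3] eventually_fsat_member[OF j]
      show "\<forall>\<^sub>F F in fsat A. l2le A e (\<lambda>i. gram_fun f F F x i j - b i j)"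
      proof eventually_elim
        case (elim F)
        have "opbound A (e/3) (gram_fun (\<lambda>t. f t - poly (P n) t) F F x)"
        proof (rule opbound_gram)
          fix t assume "t \<in> {0..gram_norm}"
          from P[OF this, of n] n show "\<bar>f t - poly (P n) t\<bar> \<le> e/3" by linarith
        qed (use elim in auto)
        from opbound_column[OF this j] have 1: "l2le A (e/3) (\<lambda>i. gram_fun f F F x i j - gram_fun (\<lambda>t. poly (P n) t) F F x i j)"
          by (simp add: gram_fun_diff)
        have 3: "l2le A (e/3) (\<lambda>i. B n i j - b i j)"
          by (rule l2le_mono[OF opbound_column[OF Bb j]]) (use n in simp)
        from l2le_add[OF l2le_add[OF 1 elim(1)] 3] show ?case by simp
      qed
    qed
  qed
  then show ?thesis by blast
qed

text \<open>
  The functional calculus for a matrix \<open>c = h(x\<^sup>* x)\<close>.  It is used for \<open>c = x\<^sup>* x\<close> and for \<open>c = \<bar>x\<bar>\<close>, because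
  the power of the absolute value is defined by two successive applications of the calculus.
\<close>

lemma pos_fun_calc_eq:
  assumes c: "c \<in> bounded_ops A" and h: "gram_conv A x h c" "\<And>t. t \<in> {0..gram_norm} \<Longrightarrow> h t \<in> {0..op_norm A c}"
    and f: "continuous_on {0..op_norm A c} f" and b: "gram_conv A x (\<lambda>t. f (h t)) b"
  shows "pos_fun_calc A f c = b"
proof -
  have hb: "\<bar>h t\<bar> \<le> op_norm A c" if "t \<in> {0..gram_norm}" for t using h(2)[OF that] by auto
  note hp = gram_conv_poly[OF h(1) hb]
  have op0: "0 \<le> op_norm A c" by (rule bounded_ops_opbound(3)[OF c])
  have pb: "opbound A e (\<lambda>i j. mat_poly A P c i j - b i j)"
    if "\<And>t. t \<in> {0..op_norm A c} \<Longrightarrow> \<bar>poly P t - f t\<bar> \<le> e" for P e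
    by (rule gram_conv_opbound[OF gram_conv_diff[OF hp b]]) (use that h(2) in auto)
  have suppd: "matsupp A (\<lambda>i j. mat_poly A P c i j - b i j)" for P
    using hp[of P] b by (auto simp: gram_conv_def matsupp_def)
  have unif: "(\<lambda>n. op_norm A (\<lambda>i j. mat_poly A (P n) c i j - b i j)) \<longlonglongrightarrow> 0"
    if P: "uniform_limit {0..op_norm A c} (\<lambda>n t. poly (P n) t) f sequentially" for P
  proof (rule tendstoI)
    fix e :: real assume e: "e > 0"
    from uniform_limitD[OF P, of "e/2"] e
    have "\<forall>\<^sub>F n in sequentially. \<forall>t\<in>{0..op_norm A c}. dist (poly (P n) t) (f t) < e/2" by simp
    then show "\<forall>\<^sub>F n in sequentially. dist (op_norm A (\<lambda>i j. mat_poly A (P n) c i j - b i j)) 0 < e"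
    proof eventually_elim
      case (elim n)
      have o: "opbound A (e/2) (\<lambda>i j. mat_poly A (P n) c i j - b i j)"
        by (rule pb) (use elim in \<open>fastforce simp: dist_real_def\<close>)
      have "op_norm A (\<lambda>i j. mat_poly A (P n) c i j - b i j) \<le> e/2"
        "0 \<le> op_norm A (\<lambda>i j. mat_poly A (P n) c i j - b i j)"
        using opbound_bounded_ops[OF suppd o] e bounded_ops_opbound(3) by auto
      then show ?case using e by (simp add: dist_real_def)
    qed
  qed
  obtain Q :: "nat \<Rightarrow> real poly" where Q: "\<And>n t. t \<in> {0..op_norm A c} \<Longrightarrow> \<bar>poly (Q n) t - f t\<bar> < 1 / Suc n"
  proof -
    have "\<forall>n. \<exists>P :: real poly. \<forall>t\<in>{0..op_norm A c}. \<bar>poly P t - f t\<bar> < 1 / Suc n"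
      using weierstrass_poly[OF f] by simp
    with that show ?thesis by metis
  qed
  have Q1: "\<bar>poly (Q n) t - f t\<bar> \<le> 1" if "t \<in> {0..op_norm A c}" for n t
  proof -
    have "1 / real (Suc n) \<le> 1" by simp
    with Q[OF that, of n] show ?thesis by linarith
  qed
  have lim0: "(\<lambda>n. 1 / real (Suc n)) \<longlonglongrightarrow> 0" using LIMSEQ_inverse_real_of_nat by (simp add: inverse_eq_divide)
  have uQ: "uniform_limit {0..op_norm A c} (\<lambda>n t. poly (Q n) t) f sequentially"
  proof (rule uniform_limitI)
    fix e :: real assume "e > 0"
    with order_tendstoD(2)[OF lim0, of e] have "\<forall>\<^sub>F n in sequentially. 1 / real (Suc n) < e" by simp
    then show "\<forall>\<^sub>F n in sequentially. \<forall>t\<in>{0..op_norm A c}. dist (poly (Q n) t) (f t) < e"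
    proof eventually_elim
      case (elim n)
      show ?case
      proof
        fix t assume "t \<in> {0..op_norm A c}"
        from Q[OF this, of n] elim show "dist (poly (Q n) t) (f t) < e" unfolding dist_real_def by linarith
      qed
    qed
  qed
  obtain Kf where "\<forall>y\<in>f ` {0..op_norm A c}. norm y \<le> Kf"
    using compact_imp_bounded[OF compact_continuous_image[OF f compact_Icc]] unfolding bounded_iff by blast
  then have Kf: "\<bar>f t\<bar> \<le> Kf" if "t \<in> {0..op_norm A c}" for t using that by auto
  have Kf0: "0 \<le> Kf" using Kf[of 0] op0 by force
  have ob: "opbound A Kf b" by (rule gram_conv_opbound[OF b]) (use Kf h(2) in blast)
  have sb: "matsupp A b" using b by (simp add: gram_conv_def)
  show ?thesis unfolding pos_fun_calc_def
  proof (rule the_equality, intro conjI allI impI)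
    show "b \<in> bounded_ops A" by (rule opbound_bounded_ops(1)[OF sb ob Kf0])
  next
    fix P :: "nat \<Rightarrow> real poly" assume "uniform_limit {0..op_norm A c} (\<lambda>n t. poly (P n) t) f sequentially"
    then show "(\<lambda>n. op_norm A (\<lambda>i j. mat_poly A (P n) c i j - b i j)) \<longlonglongrightarrow> 0" by (rule unif)
  next
    fix b' assume b': "b' \<in> bounded_ops A \<and> (\<forall>P :: nat \<Rightarrow> real poly.
        uniform_limit {0..op_norm A c} (\<lambda>n t. poly (P n) t) f sequentially \<longrightarrow>
        (\<lambda>n. op_norm A (\<lambda>i j. mat_poly A (P n) c i j - b' i j)) \<longlonglongrightarrow> 0)"
    then have l': "(\<lambda>n. op_norm A (\<lambda>i j. mat_poly A (Q n) c i j - b' i j)) \<longlonglongrightarrow> 0" using uQ by blast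
    note bb' = bounded_ops_opbound[OF conjunct1[OF b']]
    have bdd: "(\<lambda>i j. mat_poly A (Q n) c i j - b' i j) \<in> bounded_ops A" for n
    proof -
      have "opbound A (1 + Kf + op_norm A b') (\<lambda>i j. ((mat_poly A (Q n) c i j - b i j) + b i j) - b' i j)"
        by (intro opbound_diff opbound_add pb ob bb'(2) Q1)
      moreover have "matsupp A (\<lambda>i j. mat_poly A (Q n) c i j - b' i j)"
        using bb'(1) hp[of "Q n"] by (auto simp: gram_conv_def matsupp_def)
      ultimately show ?thesis using opbound_bounded_ops(1) Kf0 bb'(3) by (smt (verit) opbound_cong diff_add_cancel)
    qed
    show "b' = b"
    proof (intro ext)
      fix i j
      show "b' i j = b i j"
      proof (cases "i \<in> A \<and> j \<in> A")
        case True
        have lim: "(\<lambda>n. mat_poly A (Q n) c i j) \<longlonglongrightarrow> z i j"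
          if "\<And>n. (\<lambda>i j. mat_poly A (Q n) c i j - z i j) \<in> bounded_ops A"
            "(\<lambda>n. op_norm A (\<lambda>i j. mat_poly A (Q n) c i j - z i j)) \<longlonglongrightarrow> 0" for z
        proof (rule LIM_zero_cancel, rule Lim_null_comparison[OF _ that(2)], rule always_eventually, rule allI)
          fix n show "cmod (mat_poly A (Q n) c i j - z i j) \<le> op_norm A (\<lambda>i j. mat_poly A (Q n) c i j - z i j)"
            using l2le_coord[OF opbound_column[OF bounded_ops_opbound(2)[OF that(1)]]] True by blast
        qed
        have "(\<lambda>n. mat_poly A (Q n) c i j) \<longlonglongrightarrow> b i j"
        proof (rule lim[OF _ unif[OF uQ]])
          fix n show "(\<lambda>i j. mat_poly A (Q n) c i j - b i j) \<in> bounded_ops A"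
            by (rule opbound_bounded_ops(1)[OF suppd pb[of "Q n" 1]]) (simp_all add: Q1)
        qed
        with lim[OF bdd l'] show ?thesis by (rule LIMSEQ_unique)
      next
        case False then show ?thesis using bb'(1) sb by (auto simp: matsupp_def)
      qed
    qed
  qed
qed

theorem gram_conv_abs_powr:
  assumes p: "0 < p"
  shows "gram_conv A x (\<lambda>t. t powr (p/2)) (abs_powr A p x)"
proof -
  have cs: "continuous_on {0..N} sqrt" for N by (intro continuous_intros)
  have cp: "continuous_on {0..N} (\<lambda>t. t powr q)" if "q > 0" for q N :: real
    by (intro continuous_on_powr' continuous_intros) (use that in auto)
  obtain c where c: "gram_conv A x sqrt c" using gram_conv_exists[OF cs] by blast
  have cc: "op_abs A x = c" unfolding op_abs_def gram_def[symmetric]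
    by (rule pos_fun_calc_eq[OF gram_bounded gram_conv_id _ cs c]) (simp add: gram_norm_def)
  have sb: "\<bar>sqrt t\<bar> \<le> sqrt gram_norm" if "t \<in> {0..gram_norm}" for t using that by simp
  have oc: "opbound A (sqrt gram_norm) c" by (rule gram_conv_opbound[OF c sb])
  have sc: "matsupp A c" using c by (simp add: gram_conv_def)
  have cb: "c \<in> bounded_ops A" by (rule opbound_bounded_ops(1)[OF sc oc]) (simp add: gram_norm_nonneg)
  note cn = bounded_ops_opbound[OF cb]
  have "gram_conv A x (\<lambda>t. t) (mat_mult A c c)"
  proof -
    have "gram_conv A x (\<lambda>t. sqrt t * sqrt t) (mat_mult A c c)" by (rule gram_conv_mult[OF c sb c sb])
    moreover have "gram_fun (\<lambda>t. sqrt t * sqrt t) F F x i j = gram_fun (\<lambda>t. t) F F x i j" for F i j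
      by (rule gram_fun_cong) simp
    ultimately show ?thesis by (simp add: gram_conv_def)
  qed
  then have acc: "gram = mat_mult A c c" by (rule gram_conv_unique[OF gram_conv_id])
  \<comment> \<open>The calculus for \<open>c\<close> only sees the interval up to the norm of \<open>c\<close>, which therefore must contain
    \<open>sqrt t\<close> for all \<open>t\<close> up to the norm of \<open>c\<^sup>2 = x\<^sup>* x\<close>.\<close>
  have "gram_norm \<le> op_norm A c * op_norm A c"
    unfolding gram_norm_def by (subst acc, rule opbound_bounded_ops(2)[OF matsupp_mat_mult[OF sc sc] opbound_mat_mult[OF cn(2,3,2)]]) (simp add: cn(3))
  then have M2: "sqrt gram_norm \<le> op_norm A c" using cn(3) by (simp add: real_le_lsqrt power2_eq_square)
  obtain b where b: "gram_conv A x (\<lambda>t. t powr (p/2)) b" using gram_conv_exists[OF cp] p by fastforce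
  have bs: "gram_conv A x (\<lambda>t. sqrt t powr p) b"
  proof -
    have "gram_fun (\<lambda>t. sqrt t powr p) F F x i j = gram_fun (\<lambda>t. t powr (p/2)) F F x i j" for F i j
      by (rule gram_fun_cong) (simp add: sqrt_powr)
    then show ?thesis using b by (simp add: gram_conv_def)
  qed
  have "abs_powr A p x = b" unfolding abs_powr_def cc
  proof (rule pos_fun_calc_eq[OF cb c _ cp[OF p] bs])
    fix t assume "t \<in> {0..gram_norm}"
    then have "sqrt t \<le> sqrt gram_norm" by simp
    with M2 have "sqrt t \<le> op_norm A c" by linarith
    with \<open>t \<in> {0..gram_norm}\<close> show "sqrt t \<in> {0..op_norm A c}" by simp
  qed
  with b show ?thesis by simp
qed

end

section \<open>The trace of a power of the absolute value\<close>

lemma gram_fun_column: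
  assumes "finite C" "j \<in> C"
  shows "fmv C x (\<lambda>m. gram_fun f R C x m j) i =
    (\<Sum>l\<in>C. (of_real (f (sq_sval R C x l)) * cnj (sbasis R C x l j)) * fmv C x (sbasis R C x l) i)"
proof -
  have "fmv C x (\<lambda>m. gram_fun f R C x m j) =
     fmv C x (\<lambda>m. \<Sum>l\<in>C. (of_real (f (sq_sval R C x l)) * cnj (sbasis R C x l j)) * sbasis R C x l m)"
    by (rule fmv_cong) (simp add: gram_fun_def assms mult_ac)
  then show ?thesis by (simp add: fmv_sum)
qed

lemma nsq_gram_fun_column:
  assumes "finite C" "j \<in> C"
  shows "nsq R (fmv C x (\<lambda>m. gram_fun f R C x m j)) = Re (gram_fun (\<lambda>t. t * (f t)\<^sup>2) R C x j j)"
proof -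
  let ?w = "sbasis R C x" and ?\<mu> = "sq_sval R C x"
  have w: "right_singular R C x ?w" by (rule sbasis[OF assms(1)])
  have "nsq R (fmv C x (\<lambda>m. gram_fun f R C x m j)) = (\<Sum>l\<in>C. (cmod (of_real (f (?\<mu> l)) * cnj (?w l j)))\<^sup>2 * ?\<mu> l)"
    unfolding sq_sval_def gram_fun_column[OF assms, unfolded sq_sval_def]
    by (rule nsq_sum_orthogonal) (use assms w in \<open>auto simp: right_singular_def\<close>)
  also have "\<dots> = (\<Sum>l\<in>C. Re (of_real (?\<mu> l * (f (?\<mu> l))\<^sup>2) * ?w l j * cnj (?w l j)))"
  proof (intro sum.cong refl)
    fix l
    have e: "of_real r * z * cnj z = of_real (r * (cmod z)\<^sup>2)" for r z
      by (simp add: complex_norm_square mult_ac del: of_real_power)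
    show "(cmod (of_real (f (?\<mu> l)) * cnj (?w l j)))\<^sup>2 * ?\<mu> l = Re (of_real (?\<mu> l * (f (?\<mu> l))\<^sup>2) * ?w l j * cnj (?w l j))"
      unfolding e by (simp add: norm_mult power_mult_distrib)
  qed
  also have "\<dots> = Re (gram_fun (\<lambda>t. t * (f t)\<^sup>2) R C x j j)" by (simp add: gram_fun_def assms)
  finally show ?thesis .
qed

text \<open>
  The identity \<open>x\<^sup>* f(x x\<^sup>*) = (x f(x\<^sup>* x))\<^sup>*\<close>, entry by entry.
\<close>

lemma gram_fun_intertwine:
  assumes "finite R" "finite C" "i \<in> R" "j \<in> C"
  shows "fmv R (mat_adjoint x) (\<lambda>m. gram_fun f C R (mat_adjoint x) m i) j = cnj (fmv C x (\<lambda>m. gram_fun f R C x m j) i)"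
proof -
  let ?w = "sbasis R C x" and ?y = "sbasis C R (mat_adjoint x)"
  let ?\<mu> = "sq_sval R C x" and ?\<nu> = "sq_sval C R (mat_adjoint x)"
  let ?c = "\<lambda>m l. ip R (?y m) (fmv C x (?w l))"
  have w: "right_singular R C x ?w" and y: "right_singular C R (mat_adjoint x) ?y"
    using assms by (auto intro: sbasis)
  note on = right_singular_orthonormal[OF w] right_singular_orthonormal[OF y]
  note cm = cross_match[OF assms(1,2) w y, folded sq_sval_def]
  have ex: "fmv R (mat_adjoint x) (?y m) j = (\<Sum>l\<in>C. cnj (?c m l) * ?w l j)" for m
  proof -
    have "fmv R (mat_adjoint x) (?y m) j = (\<Sum>l\<in>C. ip C (?w l) (fmv R (mat_adjoint x) (?y m)) * ?w l j)"
      by (rule orthonormal_expand[OF assms(2,2) on(1) refl assms(4), symmetric])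
    also have "\<dots> = (\<Sum>l\<in>C. cnj (?c m l) * ?w l j)"
      by (simp add: ip_fmv_adjoint[of R "?y m"] ip_cnj)
    finally show ?thesis .
  qed
  have ew: "fmv C x (?w l) i = (\<Sum>m\<in>R. ?c m l * ?y m i)" for l
    by (rule orthonormal_expand[OF assms(1,1) on(2) refl assms(3), symmetric])
  have "fmv R (mat_adjoint x) (\<lambda>m. gram_fun f C R (mat_adjoint x) m i) j
      = (\<Sum>m\<in>R. \<Sum>l\<in>C. (of_real (f (?\<nu> m)) * cnj (?y m i)) * (cnj (?c m l) * ?w l j))"
    unfolding gram_fun_column[OF assms(1,3)] ex sum_distrib_left ..
  also have "\<dots> = (\<Sum>m\<in>R. \<Sum>l\<in>C. (of_real (f (?\<mu> l)) * cnj (?y m i)) * (cnj (?c m l) * ?w l j))"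
    using cm by (intro sum.cong refl) fastforce
  also have "\<dots> = (\<Sum>l\<in>C. \<Sum>m\<in>R. (of_real (f (?\<mu> l)) * cnj (?y m i)) * (cnj (?c m l) * ?w l j))"
    by (rule sum.swap)
  also have "\<dots> = (\<Sum>l\<in>C. (of_real (f (?\<mu> l)) * ?w l j) * cnj (fmv C x (?w l) i))"
    unfolding ew by (simp add: sum_distrib_left mult_ac)
  also have "\<dots> = cnj (fmv C x (\<lambda>m. gram_fun f R C x m j) i)"
    unfolding gram_fun_column[OF assms(2,4)] by simp
  finally show ?thesis .
qed

text \<open>
  By monotonicity this is also the limit over the finite sections.
\<close>

definition schatten_sup :: "'i set \<Rightarrow> real \<Rightarrow> 'i mat \<Rightarrow> ennreal" where
  "schatten_sup A p x = (SUP F\<in>{F. finite F \<and> F \<subseteq> A}. ennreal (schatten_sum p F F x))"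

lemma schatten_sum_le_schatten_sup: "finite F \<Longrightarrow> F \<subseteq> A \<Longrightarrow> ennreal (schatten_sum p F F x) \<le> schatten_sup A p x"
  unfolding schatten_sup_def by (rule SUP_upper) auto

lemma schatten_sup_adjoint: "schatten_sup A p (mat_adjoint x) = schatten_sup A p x"
  unfolding schatten_sup_def by (intro SUP_cong refl) (simp add: schatten_sum_adjoint)

lemma gram_fun_diag_nonneg:
  assumes "\<And>t. 0 \<le> t \<Longrightarrow> 0 \<le> f t" shows "0 \<le> Re (gram_fun f R C x i i)"
proof -
  have e: "of_real a * z * cnj z = of_real (a * (cmod z)\<^sup>2)" for a z
    by (simp add: complex_norm_square mult_ac del: of_real_power)
  show ?thesis unfolding gram_fun_def e
    by (auto intro!: sum_nonneg mult_nonneg_nonneg assms)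
qed

lemma pos_trace_SUP:
  assumes "\<And>i. i \<in> A \<Longrightarrow> 0 \<le> Re (b i i)"
  shows "pos_trace A b = (SUP F\<in>{F. finite F \<and> F \<subseteq> A}. ennreal (\<Sum>i\<in>F. Re (b i i)))"
proof -
  have "pos_trace A b = (SUP F\<in>{F. finite F \<and> F \<subseteq> A}. \<Sum>i\<in>F. ennreal (Re (b i i)))"
    unfolding pos_trace_def by (rule nonneg_infsum_complete) simp
  also have "\<dots> = (SUP F\<in>{F. finite F \<and> F \<subseteq> A}. ennreal (\<Sum>i\<in>F. Re (b i i)))"
    using assms by (intro SUP_cong refl) (auto intro!: sum_ennreal)
  finally show ?thesis .
qed

context bounded_matrix
begin

lemma adjoint_bounded: "bounded_matrix A (mat_adjoint x)"
  by unfold_locales (rule opbound_bounded_ops(1)[OF matsupp_adjoint[OF x_supp] adj_bound x_norm])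

lemma gram_conv_diag_mono:
  assumes "gram_conv A x f b" "gram_conv A x g c" "\<And>t. 0 \<le> t \<Longrightarrow> f t \<le> g t" "i \<in> A"
  shows "Re (b i i) \<le> Re (c i i)"
proof -
  have "((\<lambda>F. Re (gram_fun (\<lambda>t. g t - f t) F F x i i)) \<longlongrightarrow> Re (c i i - b i i)) (fsat A)"
    by (intro tendsto_intros gram_conv_coord[OF gram_conv_diff[OF assms(2,1)]] assms(4))
  then have "0 \<le> Re (c i i - b i i)"
    by (rule tendsto_lowerbound[OF _ _ finite_subsets_at_top_neq_bot])
       (intro always_eventually allI gram_fun_diag_nonneg, use assms(3) in auto)
  then show ?thesis by simp
qed

lemma abs_powr_diag_nonneg:
  assumes "0 < p" "i \<in> A" shows "0 \<le> Re (abs_powr A p x i i)"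
proof -
  have "((\<lambda>F. Re (gram_fun (\<lambda>t. t powr (p/2)) F F x i i)) \<longlongrightarrow> Re (abs_powr A p x i i)) (fsat A)"
    by (intro tendsto_intros gram_conv_coord[OF gram_conv_abs_powr] assms)
  then show ?thesis
    by (rule tendsto_lowerbound[OF _ _ finite_subsets_at_top_neq_bot])
       (intro always_eventually allI gram_fun_diag_nonneg, auto)
qed

abbreviation "trace_powr p \<equiv> pos_trace A (abs_powr A p x)"

lemma trace_powr_SUP: "0 < p \<Longrightarrow> trace_powr p = (SUP F\<in>{F. finite F \<and> F \<subseteq> A}. ennreal (\<Sum>i\<in>F. Re (abs_powr A p x i i)))"
  by (rule pos_trace_SUP) (rule abs_powr_diag_nonneg)

lemma trace_powr_ge: "0 < p \<Longrightarrow> finite F \<Longrightarrow> F \<subseteq> A \<Longrightarrow> ennreal (\<Sum>i\<in>F. Re (abs_powr A p x i i)) \<le> trace_powr p"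
  unfolding trace_powr_SUP by (rule SUP_upper) auto

lemma trace_powr_le_schatten_sup: assumes "0 < p" shows "trace_powr p \<le> schatten_sup A p x"
  unfolding trace_powr_SUP[OF assms]
proof (rule SUP_least)
  fix H assume "H \<in> {F. finite F \<and> F \<subseteq> A}"
  then have H: "finite H" "H \<subseteq> A" by auto
  have "((\<lambda>F. ennreal (\<Sum>i\<in>H. Re (gram_fun (\<lambda>t. t powr (p/2)) F F x i i))) \<longlongrightarrow> ennreal (\<Sum>i\<in>H. Re (abs_powr A p x i i))) (fsat A)"
    using H by (intro tendsto_ennrealI tendsto_sum tendsto_Re gram_conv_coord[OF gram_conv_abs_powr[OF assms]]) auto
  then show "ennreal (\<Sum>i\<in>H. Re (abs_powr A p x i i)) \<le> schatten_sup A p x"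
  proof (rule tendsto_upperbound[OF _ _ finite_subsets_at_top_neq_bot])
    from eventually_fsat_superset[OF H]
    show "\<forall>\<^sub>F F in fsat A. ennreal (\<Sum>i\<in>H. Re (gram_fun (\<lambda>t. t powr (p/2)) F F x i i)) \<le> schatten_sup A p x"
    proof eventually_elim
      case (elim F)
      have "(\<Sum>i\<in>H. Re (gram_fun (\<lambda>t. t powr (p/2)) F F x i i)) \<le> schatten_sum p F F x"
        unfolding schatten_sum_trace[OF conjunct1[OF elim]] using elim
        by (intro sum_mono2 gram_fun_diag_nonneg) auto
      then show ?case using schatten_sum_le_schatten_sup[of F A p x] elim by (meson ennreal_leI order_trans)
    qed
  qed
qed

text \<open>
  Let \<open>z = x k(x\<^sup>* x) = k(x x\<^sup>*) x\<close>.  The squared norms of the rows of \<open>z\<close> are the diagonal entries of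
  \<open>g(x x\<^sup>*)\<close> for \<open>g(t) = t k(t)\<^sup>2\<close>, and those of its columns are the diagonal entries of \<open>g(x\<^sup>* x)\<close>.  Summing all
  squared entries of \<open>z\<close> in both orders compares the two traces.  The function \<open>k\<close> is continuous at 0 also for
  \<open>p < 2\<close>, and \<open>g(t) \<le> t powr (p/2)\<close>.
  
  The matrix \<open>\<zeta>\<close> is the conjugate of \<open>z\<close>.  Its rows are limits in norm of those of the finite sections, so their norms
  converge; along its columns an inequality in the limit is enough.
\<close>

lemma trace_adjoint_le_regularised:
  assumes p: "0 < p" and e: "0 < e" and H: "finite H" "H \<subseteq> A" and fin: "trace_powr p \<le> ennreal \<tau>" "0 \<le> \<tau>"
  defines "k \<equiv> \<lambda>t. sqrt (t powr (p/2) / max t e)"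
  assumes d': "gram_conv A (mat_adjoint x) (\<lambda>t. t * (k t)\<^sup>2) d'"
  shows "(\<Sum>i\<in>H. Re (d' i i)) \<le> \<tau>"
proof -
  interpret adj: bounded_matrix A "mat_adjoint x" by (rule adjoint_bounded)
  have ck: "continuous_on {0..N} k" for N
    unfolding k_def using p e by (intro continuous_on_powr' continuous_intros) auto
  have k2: "t * (k t)\<^sup>2 \<le> t powr (p/2)" if "0 \<le> t" for t
  proof -
    have "t * (k t)\<^sup>2 = t powr (p/2) * (t / max t e)" using e that by (simp add: k_def)
    also have "\<dots> \<le> t powr (p/2) * 1" using e that by (intro mult_left_mono) auto
    finally show ?thesis by simp
  qed
  obtain k' where k': "gram_conv A (mat_adjoint x) k k'" using adj.gram_conv_exists[OF ck] by blast
  have "continuous_on {0..gram_norm} (\<lambda>t. t * (k t)\<^sup>2)" by (intro continuous_intros ck)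
  then obtain d where d: "gram_conv A x (\<lambda>t. t * (k t)\<^sup>2) d" using gram_conv_exists by blast
  obtain Kk where Kk: "\<And>t. t \<in> {0..adj.gram_norm} \<Longrightarrow> \<bar>k t\<bar> \<le> Kk"
  proof -
    obtain Kk where "\<forall>y\<in>k ` {0..adj.gram_norm}. norm y \<le> Kk"
      using compact_imp_bounded[OF compact_continuous_image[OF ck compact_Icc]] unfolding bounded_iff by blast
    then show ?thesis using that[of Kk] by auto
  qed
  define Z where "Z i F = fmv F (sect F (mat_adjoint x)) (\<lambda>m. gram_fun k F F (mat_adjoint x) m i)" for i F
  define \<zeta> where "\<zeta> i = mat_vec A (mat_adjoint x) (\<lambda>m. k' m i)" for i
  have conv: "l2conv A (Z i) (\<zeta> i)" if i: "i \<in> A" for i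
    unfolding Z_def \<zeta>_def
    by (rule l2conv_mat_vec[OF x_norm opbound_sect[OF adj_bound x_norm] adj_bound l2conv_sect[OF adj_bound]
          opbound_column[OF adj.gram_conv_opbound[OF k' Kk] i]])
       (use k' i in \<open>auto simp: gram_conv_def\<close>)
  have lz: "l2le A (K * L) (\<zeta> i)" if "opbound A K (mat_adjoint x)" "0 \<le> K" "opbound A L k'" "i \<in> A" for i K L
    unfolding \<zeta>_def by (rule opbound_mat_vec[OF that(1,2) opbound_column[OF that(3,4)]])
  have lz': "\<exists>B. l2le A B (\<zeta> i)" if "i \<in> A" for i
    using lz[OF adj_bound x_norm adj.gram_conv_opbound[OF k' Kk] that] by blast
  have s: "(\<lambda>j. (cmod (\<zeta> i j))\<^sup>2) summable_on A" if i: "i \<in> A" for i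
  proof -
    obtain B where "l2le A B (\<zeta> i)" using lz'[OF i] by blast
    then have "(\<lambda>j. if j \<in> A then \<zeta> i j else 0) \<in> ell2 A"
      by (intro l2le_ell2(1)[of A B]) (simp_all cong: l2le_cong)
    then have "(\<lambda>j. (cmod (if j \<in> A then \<zeta> i j else 0))\<^sup>2) summable_on A" by (simp add: ell2_def)
    then show ?thesis by (rule summable_on_cong[THEN iffD1, rotated]) auto
  qed
  define N where "N i = (\<Sum>\<^sub>\<infinity>j\<in>A. (cmod (\<zeta> i j))\<^sup>2)" for i
  have nN: "nsq G (\<zeta> i) \<le> N i" if "finite G" "G \<subseteq> A" "i \<in> A" for G i
    unfolding nsq_def N_def by (rule finite_sum_le_infsum[OF s]) (use that in auto)
  have N0: "0 \<le> N i" for i unfolding N_def by (rule infsum_nonneg) simp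
  have colz: "nsq F (Z i F) = Re (gram_fun (\<lambda>t. t * (k t)\<^sup>2) F F (mat_adjoint x) i i)"
    if "finite F" "i \<in> F" for F i
  proof -
    have "nsq F (Z i F) = nsq F (fmv F (mat_adjoint x) (\<lambda>m. gram_fun k F F (mat_adjoint x) m i))"
      by (rule nsq_cong) (simp add: Z_def fmv_def sect_def)
    then show ?thesis by (simp add: nsq_gram_fun_column that)
  qed
  have d'N: "Re (d' i i) \<le> N i" if i: "i \<in> A" for i
  proof -
    have "sqrt (Re (d' i i)) \<le> sqrt (N i) + \<delta>" if \<delta>: "\<delta> > 0" for \<delta>
    proof (rule tendsto_upperbound[OF _ _ finite_subsets_at_top_neq_bot])
      show "((\<lambda>F. sqrt (Re (gram_fun (\<lambda>t. t * (k t)\<^sup>2) F F (mat_adjoint x) i i))) \<longlongrightarrow> sqrt (Re (d' i i))) (fsat A)"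
        by (intro tendsto_intros gram_conv_coord[OF d'] i)
      from l2convD[OF conv[OF i] \<delta>] eventually_fsat_member[OF i]
      show "\<forall>\<^sub>F F in fsat A. sqrt (Re (gram_fun (\<lambda>t. t * (k t)\<^sup>2) F F (mat_adjoint x) i i)) \<le> sqrt (N i) + \<delta>"
      proof eventually_elim
        case (elim F)
        have "l2le A (sqrt (N i)) (\<zeta> i)" unfolding l2le_def using nN i by auto
        from l2le_add[OF this elim(1)] have "l2le A (sqrt (N i) + \<delta>) (Z i F)" by simp
        then have "sqrt (nsq F (Z i F)) \<le> sqrt (N i) + \<delta>" using elim by (intro l2leD) auto
        then show ?case using elim by (simp add: colz)
      qed
    qed
    then have "sqrt (Re (d' i i)) \<le> sqrt (N i)" by (rule field_le_epsilon)
    then show ?thesis by simp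
  qed
  have row: "(\<Sum>i\<in>H. (cmod (\<zeta> i j))\<^sup>2) \<le> Re (d j j)" if j: "j \<in> A" for j
  proof (rule tendsto_le[OF finite_subsets_at_top_neq_bot])
    show "((\<lambda>F. \<Sum>i\<in>H. (cmod (Z i F j))\<^sup>2) \<longlongrightarrow> (\<Sum>i\<in>H. (cmod (\<zeta> i j))\<^sup>2)) (fsat A)"
      using H j by (intro tendsto_intros l2conv_coord[OF conv]) auto
    show "((\<lambda>F. Re (gram_fun (\<lambda>t. t * (k t)\<^sup>2) F F x j j)) \<longlongrightarrow> Re (d j j)) (fsat A)"
      by (intro tendsto_intros gram_conv_coord[OF d] j)
    from eventually_fsat_superset[OF H] eventually_fsat_member[OF j]
    show "\<forall>\<^sub>F F in fsat A. (\<Sum>i\<in>H. (cmod (Z i F j))\<^sup>2) \<le> Re (gram_fun (\<lambda>t. t * (k t)\<^sup>2) F F x j j)"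
    proof eventually_elim
      case (elim F)
      then have F: "finite F" "j \<in> F" "H \<subseteq> F" by auto
      have "Z i F j = cnj (fmv F x (\<lambda>m. gram_fun k F F x m j) i)" if "i \<in> F" for i
      proof -
        have "Z i F j = fmv F (mat_adjoint x) (\<lambda>m. gram_fun k F F (mat_adjoint x) m i) j"
          using F by (simp add: Z_def fmv_def sect_def)
        then show ?thesis using gram_fun_intertwine[OF F(1,1) that F(2)] by simp
      qed
      then have "(\<Sum>i\<in>F. (cmod (Z i F j))\<^sup>2) = nsq F (fmv F x (\<lambda>m. gram_fun k F F x m j))"
        unfolding nsq_def by simp
      also have "\<dots> = Re (gram_fun (\<lambda>t. t * (k t)\<^sup>2) F F x j j)" by (rule nsq_gram_fun_column[OF F(1,2)])
      finally show ?case using F by (metis (no_types, lifting) sum_mono2 zero_le_power2)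
    qed
  qed
  have "((\<lambda>G. \<Sum>i\<in>H. nsq G (\<zeta> i)) \<longlongrightarrow> (\<Sum>i\<in>H. N i)) (fsat A)"
    unfolding N_def nsq_def using H by (intro tendsto_sum infsum_tendsto s) auto
  then have "(\<Sum>i\<in>H. N i) \<le> \<tau>"
  proof (rule tendsto_upperbound[OF _ _ finite_subsets_at_top_neq_bot])
    show "\<forall>\<^sub>F G in fsat A. (\<Sum>i\<in>H. nsq G (\<zeta> i)) \<le> \<tau>"
    proof (rule eventually_finite_subsets_at_top_weakI)
      fix G assume G: "finite G" "G \<subseteq> A"
      have "(\<Sum>i\<in>H. nsq G (\<zeta> i)) = (\<Sum>j\<in>G. \<Sum>i\<in>H. (cmod (\<zeta> i j))\<^sup>2)"
        unfolding nsq_def by (rule sum.swap)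
      also have "\<dots> \<le> (\<Sum>j\<in>G. Re (abs_powr A p x j j))"
      proof (rule sum_mono)
        fix j assume "j \<in> G"
        then have j: "j \<in> A" using G by auto
        show "(\<Sum>i\<in>H. (cmod (\<zeta> i j))\<^sup>2) \<le> Re (abs_powr A p x j j)"
          using row[OF j] gram_conv_diag_mono[OF d gram_conv_abs_powr[OF p] k2 j] by linarith
      qed
      also have "\<dots> \<le> \<tau>" using trace_powr_ge[OF p G] fin by (metis ennreal_le_iff order_trans)
      finally show "(\<Sum>i\<in>H. nsq G (\<zeta> i)) \<le> \<tau>" .
    qed
  qed
  moreover have "(\<Sum>i\<in>H. Re (d' i i)) \<le> (\<Sum>i\<in>H. N i)" using d'N H by (intro sum_mono) auto
  ultimately show ?thesis by linarith
qed

text \<open>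
  The regularised function differs from \<open>t powr (p/2)\<close> by at most \<open>e powr (p/2)\<close>, and only finitely many
  diagonal entries are considered at a time.
\<close>

lemma trace_adjoint_le:
  assumes p: "0 < p" shows "pos_trace A (abs_powr A p (mat_adjoint x)) \<le> trace_powr p"
proof (cases "trace_powr p")
  case (real \<tau>)
  interpret adj: bounded_matrix A "mat_adjoint x" by (rule adjoint_bounded)
  show ?thesis unfolding adj.trace_powr_SUP[OF p]
  proof (rule SUP_least)
    fix H assume "H \<in> {F. finite F \<and> F \<subseteq> A}"
    then have H: "finite H" "H \<subseteq> A" by auto
    let ?b = "abs_powr A p (mat_adjoint x)"
    have "(\<Sum>i\<in>H. Re (?b i i)) \<le> \<tau> + \<delta>" if \<delta>: "\<delta> > 0" for \<delta>
    proof -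
      \<comment> \<open>The total error \<open>card H * e powr (p/2)\<close> has to stay below \<open>\<delta>\<close>.\<close>
      define e where "e = (\<delta> / (card H + 1)) powr (2/p)"
      have e: "e > 0" using \<delta> by (simp add: e_def)
      have "e powr (p/2) = \<delta> / (card H + 1)" using \<delta> p by (simp add: e_def powr_powr)
      then have "\<delta> = (card H + 1) * e powr (p/2)" by (simp add: field_simps)
      then have eH: "card H * e powr (p/2) \<le> \<delta>" by (simp add: algebra_simps)
      let ?k = "\<lambda>t. sqrt (t powr (p/2) / max t e)"
      have "continuous_on {0..adj.gram_norm} (\<lambda>t. t * (?k t)\<^sup>2)"
        using p e by (intro continuous_on_powr' continuous_intros) auto
      then obtain d' where d': "gram_conv A (mat_adjoint x) (\<lambda>t. t * (?k t)\<^sup>2) d'" using adj.gram_conv_exists by blast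
      have "trace_powr p \<le> ennreal \<tau>" "0 \<le> \<tau>" using real by auto
      then have 1: "(\<Sum>i\<in>H. Re (d' i i)) \<le> \<tau>"
        by (rule trace_adjoint_le_regularised[OF p e H _ _ d'])
      have "Re (?b i i) \<le> Re (d' i i) + e powr (p/2)" if i: "i \<in> A" for i
      proof -
        have "opbound A (e powr (p/2)) (\<lambda>i j. ?b i j - d' i j)"
        proof (rule adj.gram_conv_opbound[OF adj.gram_conv_diff[OF adj.gram_conv_abs_powr[OF p] d']])
          fix t assume "t \<in> {0..adj.gram_norm}"
          then have t: "0 \<le> t" by simp
          have eq: "t * (?k t)\<^sup>2 = t powr (p/2) * (t / max t e)" using e t by simp
          show "\<bar>t powr (p/2) - t * (?k t)\<^sup>2\<bar> \<le> e powr (p/2)"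
          proof (cases "t \<ge> e")
            case True then show ?thesis unfolding eq using e by simp
          next
            case False
            then have te: "t / max t e \<in> {0..1}" using t e by (simp add: field_simps)
            have "t powr (p/2) - t powr (p/2) * (t / max t e) = t powr (p/2) * (1 - t / max t e)"
              by (simp add: algebra_simps)
            moreover have "t powr (p/2) * (1 - t / max t e) \<le> e powr (p/2) * 1"
              using te t p False by (intro mult_mono powr_mono2) auto
            moreover have "0 \<le> t powr (p/2) * (1 - t / max t e)" using te by simp
            ultimately show ?thesis unfolding eq by simp
          qed
        qed
        from l2le_coord[OF opbound_column[OF this i] i]
        have "cmod (?b i i - d' i i) \<le> e powr (p/2)" .
        then show ?thesis using complex_Re_le_cmod[of "?b i i - d' i i"] by simp
      qed
      then have "(\<Sum>i\<in>H. Re (?b i i)) \<le> (\<Sum>i\<in>H. Re (d' i i) + e powr (p/2))" using H by (intro sum_mono) auto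
      also have "\<dots> = (\<Sum>i\<in>H. Re (d' i i)) + card H * e powr (p/2)" by (simp add: sum.distrib)
      finally show ?thesis using 1 eH by linarith
    qed
    then have "(\<Sum>i\<in>H. Re (?b i i)) \<le> \<tau>" by (rule field_le_epsilon)
    then show "ennreal (\<Sum>i\<in>H. Re (?b i i)) \<le> trace_powr p" unfolding real(2) by (rule ennreal_leI)
  qed
qed simp

text \<open>
  One direction is Fatou's lemma for the diagonal entries.  In the other one the limit of
  \<open>schatten_sum_le_diagonal\<close> bounds the sum for a finite section by the mean of the traces of the powers of
  \<open>\<bar>x\<bar>\<close> and \<open>\<bar>x\<^sup>*\<bar>\<close>, and the second trace is at most the first.
\<close>

theorem trace_powr_eq_schatten_sup:
  assumes p: "1 \<le> p" shows "trace_powr p = schatten_sup A p x"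
proof (rule antisym)
  have p0: "0 < p" using p by simp
  interpret adj: bounded_matrix A "mat_adjoint x" by (rule adjoint_bounded)
  show "trace_powr p \<le> schatten_sup A p x" by (rule trace_powr_le_schatten_sup[OF p0])
  show "schatten_sup A p x \<le> trace_powr p"
    unfolding schatten_sup_def
  proof (rule SUP_least)
    fix F assume "F \<in> {F. finite F \<and> F \<subseteq> A}"
    then have F: "finite F" "F \<subseteq> A" by auto
    let ?s = "\<Sum>i\<in>F. Re (abs_powr A p x i i)" and ?s' = "\<Sum>i\<in>F. Re (abs_powr A p (mat_adjoint x) i i)"
    have "schatten_sum p F F x \<le> (?s + ?s') / 2"
    proof (rule tendsto_lowerbound[OF _ _ finite_subsets_at_top_neq_bot])
      show "((\<lambda>G. ((\<Sum>i\<in>F. Re (gram_fun (\<lambda>t. t powr (p/2)) G G x i i)) +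
          (\<Sum>i\<in>F. Re (gram_fun (\<lambda>t. t powr (p/2)) G G (mat_adjoint x) i i))) / 2) \<longlongrightarrow> (?s + ?s') / 2) (fsat A)"
        using F by (intro tendsto_divide tendsto_add tendsto_sum tendsto_Re tendsto_const
             gram_conv_coord[OF gram_conv_abs_powr[OF p0]] gram_conv_coord[OF adj.gram_conv_abs_powr[OF p0]]) auto
      from eventually_fsat_superset[OF F]
      show "\<forall>\<^sub>F G in fsat A. schatten_sum p F F x \<le> ((\<Sum>i\<in>F. Re (gram_fun (\<lambda>t. t powr (p/2)) G G x i i)) +
          (\<Sum>i\<in>F. Re (gram_fun (\<lambda>t. t powr (p/2)) G G (mat_adjoint x) i i))) / 2"
        by eventually_elim (rule schatten_sum_le_diagonal[OF p], auto)
    qed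
    then have "schatten_sum p F F x \<le> max ?s ?s'" by (rule le_half_sum) auto
    then have "ennreal (schatten_sum p F F x) \<le> ennreal (max ?s ?s')" by (rule ennreal_leI)
    also have "\<dots> \<le> trace_powr p"
      using trace_powr_ge[OF p0 F] adj.trace_powr_ge[OF p0 F] trace_adjoint_le[OF p0] by (auto simp: max_def)
    finally show "ennreal (schatten_sum p F F x) \<le> trace_powr p" .
  qed
qed

end

section \<open>Schatten classes\<close>

lemma schatten_sup_le: "(\<And>F. finite F \<Longrightarrow> F \<subseteq> A \<Longrightarrow> schatten_sum p F F x \<le> B) \<Longrightarrow> schatten_sup A p x \<le> ennreal B"
  unfolding schatten_sup_def by (rule SUP_least) (auto intro: ennreal_leI)

lemma schatten_sum_le_enn2real_schatten_sup:
  assumes "schatten_sup A p x < \<infinity>" "finite F" "F \<subseteq> A" shows "schatten_sum p F F x \<le> enn2real (schatten_sup A p x)"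
proof -
  have "ennreal (schatten_sum p F F x) \<le> ennreal (enn2real (schatten_sup A p x))"
    using schatten_sum_le_schatten_sup[OF assms(2,3)] assms(1) by simp
  then show ?thesis by (simp add: ennreal_le_iff)
qed

text \<open>
  The bilinear description is tested on a single pair of unit vectors.
\<close>

lemma schatten_sup_finite_opbound:
  assumes p: "1 \<le> p" and fin: "schatten_sup A p x < \<infinity>"
  shows "opbound A (enn2real (schatten_sup A p x) powr (1/p)) x"
  unfolding opbound_def l2le_def
proof (intro allI impI)
  fix C v H assume C: "finite C \<and> C \<subseteq> A" and H: "finite H \<and> H \<subseteq> A"
  define s t where "s = sqrt (nsq H (fmv C x v))" and "t = sqrt (nsq C v)"
  let ?B = "enn2real (schatten_sup A p x)"
  show "sqrt (nsq H (fmv C x v)) \<le> ?B powr (1/p) * sqrt (nsq C v)"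
  proof (cases "s = 0 \<or> t = 0")
    case True
    have "s = 0"
    proof (rule disjE[OF True])
      assume "t = 0"
      then have "v j = 0" if "j \<in> C" for j using nsq_eq_0[of C v j] C that by (simp add: t_def)
      then show "s = 0" by (simp add: s_def fmv_def nsq_def)
    qed
    then show ?thesis unfolding s_def by simp
  next
    case False
    then have st: "s > 0" "t > 0" by (auto simp: s_def t_def less_le)
    have s2: "nsq H (fmv C x v) = s\<^sup>2" and t2: "nsq C v = t\<^sup>2" by (auto simp: s_def t_def)
    let ?u = "\<lambda>k::unit. \<lambda>i. of_real (1/s) * fmv C x v i" and ?v = "\<lambda>k::unit. \<lambda>i. of_real (1/t) * v i"
    have ov: "orthonormal {()} C ?v" and ou: "orthonormal {()} H ?u"
      unfolding orthonormal_def using st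
      by (simp_all only: ip_self nsq_scale s2 t2) (simp_all add: norm_divide power_divide)
    have "ip H (?u ()) (fmv C x (?v ())) = of_real (1/t) * ip H (?u ()) (fmv C x v)"
      by (simp only: fmv_scale ip_scale_right)
    also have "ip H (?u ()) (fmv C x v) = cnj (of_real (1/s) * ip H (fmv C x v) (fmv C x v))"
      by (subst ip_cnj[symmetric]) (simp only: ip_scale_right)
    also have "\<dots> = of_real s" using st by (simp add: ip_self s2 power2_eq_square)
    finally have ip: "ip H (?u ()) (fmv C x (?v ())) = of_real (s / t)" by simp
    have "(s / t) powr p = (\<Sum>k\<in>{()}. cmod (ip H (?u k) (fmv C x (?v k))) powr p)"
      using st by (simp only: ip norm_of_real) simp
    also have "\<dots> \<le> schatten_sum p H C x" by (rule schatten_sum_ge_bilinear[OF p _ _ _ ov ou]) (use C H in auto)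
    also have "\<dots> \<le> schatten_sum p (H \<union> C) (H \<union> C) x" by (rule schatten_sum_mono[OF p]) (use C H in auto)
    also have "\<dots> \<le> ?B" by (rule schatten_sum_le_enn2real_schatten_sup[OF fin]) (use C H in auto)
    finally have "((s / t) powr p) powr (1/p) \<le> ?B powr (1/p)" using p by (intro powr_mono2) auto
    then have "s / t \<le> ?B powr (1/p)" using p st by (simp add: powr_powr)
    then show ?thesis using st by (simp add: s_def t_def field_simps)
  qed
qed

lemma schatten_sup_finite_bounded:
  assumes "1 \<le> p" "matsupp A x" "schatten_sup A p x < \<infinity>" shows "x \<in> bounded_ops A"
  by (rule opbound_bounded_ops(1)[OF assms(2) schatten_sup_finite_opbound[OF assms(1,3)]]) simp

lemma schatten_sup_finite_entry:
  assumes "1 \<le> p" "schatten_sup A p x < \<infinity>" "i \<in> A" "j \<in> A" shows "cmod (x i j) \<le> enn2real (schatten_sup A p x) powr (1/p)"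
  by (rule l2le_coord[OF opbound_column[OF schatten_sup_finite_opbound[OF assms(1,2)] assms(4)] assms(3)])

context
  fixes p :: ennreal and P :: real
  assumes p: "1 \<le> p" "p \<noteq> \<infinity>" and P: "P = enn2real p"
begin

lemma exponent_ge_1: "1 \<le> P"
proof -
  have "ennreal 1 \<le> ennreal P" using p P by (simp add: top.not_eq_extremum)
  moreover have "0 \<le> P" using P by simp
  ultimately show ?thesis by (simp only: ennreal_le_iff)
qed

lemma schatten_norm_eq:
  assumes "x \<in> bounded_ops A"
  shows "schatten_norm A p x = (if schatten_sup A P x = \<infinity> then \<infinity> else ennreal (enn2real (schatten_sup A P x) powr (1/P)))"
proof -
  interpret bounded_matrix A x by unfold_locales (rule assms)
  show ?thesis using assms p trace_powr_eq_schatten_sup[OF exponent_ge_1] by (simp add: schatten_norm_def P[symmetric])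
qed

lemma schatten_class_iff: "x \<in> schatten_class A p \<longleftrightarrow> matsupp A x \<and> schatten_sup A P x < \<infinity>"
proof
  assume "x \<in> schatten_class A p"
  then have x: "x \<in> bounded_ops A" "schatten_norm A p x < \<infinity>" using p by (auto simp: schatten_class_def)
  then show "matsupp A x \<and> schatten_sup A P x < \<infinity>"
    using schatten_norm_eq[OF x(1)] bounded_ops_opbound(1)[OF x(1)] by (auto split: if_splits simp: less_top)
next
  assume x: "matsupp A x \<and> schatten_sup A P x < \<infinity>"
  then have b: "x \<in> bounded_ops A" by (intro schatten_sup_finite_bounded[OF exponent_ge_1]) auto
  then show "x \<in> schatten_class A p" using p x schatten_norm_eq[OF b] by (auto simp: schatten_class_def)
qed

lemma schatten_norm_class:
  assumes "x \<in> schatten_class A p"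
  shows "schatten_norm A p x = ennreal (enn2real (schatten_sup A P x) powr (1/P))"
proof -
  have "x \<in> bounded_ops A" using assms p by (simp add: schatten_class_def)
  then show ?thesis using assms schatten_class_iff[of x A] by (simp add: schatten_norm_eq less_top[symmetric])
qed

lemma schatten_norm_mono:
  assumes "x \<in> schatten_class A p" "y \<in> schatten_class B p" "schatten_sup A P x \<le> schatten_sup B P y"
  shows "schatten_norm A p x \<le> schatten_norm B p y"
proof -
  have "enn2real (schatten_sup A P x) \<le> enn2real (schatten_sup B P y)"
    using assms(2,3) schatten_class_iff[of y B] by (intro enn2real_mono) auto
  then show ?thesis unfolding schatten_norm_class[OF assms(1)] schatten_norm_class[OF assms(2)]
    using exponent_ge_1 by (intro ennreal_leI powr_mono2) auto
qed

end

lemma schatten_sup_add: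
  assumes p: "1 \<le> p" and x: "schatten_sup A p x < \<infinity>" and y: "schatten_sup A p y < \<infinity>"
  shows "schatten_sup A p (\<lambda>i j. x i j + y i j) \<le> ennreal (2 powr p * (enn2real (schatten_sup A p x) + enn2real (schatten_sup A p y)))"
proof (rule schatten_sup_le)
  fix F assume F: "finite F" "F \<subseteq> A"
  have "schatten_sum p F F (\<lambda>i j. x i j + y i j) \<le> 2 powr p * (schatten_sum p F F x + schatten_sum p F F y)"
    by (rule schatten_sum_add[OF p F(1,1)])
  also have "\<dots> \<le> 2 powr p * (enn2real (schatten_sup A p x) + enn2real (schatten_sup A p y))"
    by (intro mult_left_mono add_mono schatten_sum_le_enn2real_schatten_sup F x y) auto
  finally show "schatten_sum p F F (\<lambda>i j. x i j + y i j) \<le> 2 powr p * (enn2real (schatten_sup A p x) + enn2real (schatten_sup A p y))" .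
qed

lemma schatten_sup_scale:
  assumes x: "schatten_sup A p x < \<infinity>"
  shows "schatten_sup A p (\<lambda>i j. c * x i j) \<le> ennreal (cmod c powr p * enn2real (schatten_sup A p x))"
proof (rule schatten_sup_le)
  fix F assume F: "finite F" "F \<subseteq> A"
  have "schatten_sum p F F (\<lambda>i j. c * x i j) = cmod c powr p * schatten_sum p F F x"
    by (rule schatten_sum_row_scale[OF F(1)]) auto
  also have "\<dots> \<le> cmod c powr p * enn2real (schatten_sup A p x)"
    by (intro mult_left_mono schatten_sum_le_enn2real_schatten_sup F x) auto
  finally show "schatten_sum p F F (\<lambda>i j. c * x i j) \<le> cmod c powr p * enn2real (schatten_sup A p x)" .
qed

section \<open>Density of finite sections\<close>

lemma schatten_sum_zero_columns:
  assumes "finite R" "finite C" "C' \<subseteq> C" "0 < p" "\<And>i j. i \<in> R \<Longrightarrow> j \<in> C - C' \<Longrightarrow> x i j = 0"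
  shows "schatten_sum p R C x = schatten_sum p R C' x"
proof -
  have "schatten_sum p R C x = schatten_sum p C R (mat_adjoint x)" using assms by (simp add: schatten_sum_adjoint)
  also have "\<dots> = schatten_sum p C' R (mat_adjoint x)"
    by (rule schatten_sum_zero_rows) (use assms in \<open>auto simp: mat_adjoint_def\<close>)
  also have "\<dots> = schatten_sum p R C' x"
    using assms finite_subset[OF assms(3,2)] by (intro schatten_sum_adjoint) auto
  finally show ?thesis .
qed

text \<open>
  If the section \<open>F\<close> almost attains the supremum, then so does every larger set of columns, and the tail
  estimates show that little is left for the remaining columns.
\<close>

lemma schatten_sum_column_tail:
  assumes p: "1 \<le> p" and x: "schatten_sup A p x < \<infinity>" and e: "0 < e"
  shows "\<exists>F. finite F \<and> F \<subseteq> A \<and> (\<forall>G F'. finite G \<and> G \<subseteq> A \<and> F \<subseteq> F' \<and> F' \<subseteq> G \<longrightarrow> schatten_sum p G (G - F') x \<le> e)"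
proof -
  define S where "S = enn2real (schatten_sup A p x)"
  have S0: "0 \<le> S" by (simp add: S_def)
  have PS: "schatten_sum p G G x \<le> S" if "finite G" "G \<subseteq> A" for G
    using schatten_sum_le_enn2real_schatten_sup[OF x that] by (simp add: S_def)
  have ex: "\<exists>F. finite F \<and> F \<subseteq> A \<and> S - \<delta> < schatten_sum p F F x" if "\<delta> > 0" for \<delta>
  proof (rule ccontr)
    assume "\<not> ?thesis"
    then have le: "schatten_sum p F F x \<le> S - \<delta>" if "finite F" "F \<subseteq> A" for F using that by (auto simp: not_less)
    from le[of "{}"] have S\<delta>: "0 \<le> S - \<delta>" by (simp add: schatten_sum_def)
    from le have "schatten_sup A p x \<le> ennreal (S - \<delta>)" by (rule schatten_sup_le)
    then have "ennreal S \<le> ennreal (S - \<delta>)" using x by (simp add: S_def)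
    then show False using that S\<delta> by (simp add: ennreal_le_iff)
  qed
  have tl: "schatten_sum p G F' x > S - \<delta>" if "S - \<delta> < schatten_sum p F F x" "finite G" "F \<subseteq> F'" "F' \<subseteq> G" for F F' G \<delta>
  proof -
    have "finite F'" using that finite_subset by auto
    then have "schatten_sum p F F x \<le> schatten_sum p G F' x" using that by (intro schatten_sum_mono[OF p]) auto
    with that(1) show ?thesis by linarith
  qed
  show ?thesis
  proof (cases "2 \<le> p")
    case True
    obtain F where F: "finite F" "F \<subseteq> A" "S - e < schatten_sum p F F x" using ex[OF e] by blast
    have "schatten_sum p G (G - F') x \<le> e" if "finite G" "G \<subseteq> A" "F \<subseteq> F'" "F' \<subseteq> G" for G F'
      using schatten_sum_tail_le_large[OF True that(1,1,4), of x] PS[OF that(1,2)] tl[OF F(3) that(1,3,4)] by linarith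
    with F(1,2) show ?thesis by (intro exI[of _ F] conjI allI impI) auto
  next
    case False
    \<comment> \<open>With this \<open>t\<close> and \<open>\<delta>\<close> each of the two terms of the tail estimate is at most \<open>e / 2\<close>.\<close>
    define t where "t = min (1/2) ((e / (2 * (S + 1))) powr (2/p))"
    have t: "0 < t" "t < 1" using e S0 by (auto simp: t_def)
    have "t powr (p/2) \<le> ((e / (2 * (S + 1))) powr (2/p)) powr (p/2)"
      using t p by (intro powr_mono2) (auto simp: t_def)
    also have "\<dots> = e / (2 * (S + 1))" using p e S0 by (simp add: powr_powr)
    finally have "t powr (p/2) * S \<le> e / (2 * (S + 1)) * S" using S0 by (intro mult_right_mono)
    also have "\<dots> \<le> e / 2" using e S0 by (simp add: field_simps)
    finally have t1: "t powr (p/2) * S \<le> e / 2" .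
    define \<delta> where "\<delta> = e / 2 * (p/2 * t)"
    have \<delta>: "\<delta> > 0" using e p t by (simp add: \<delta>_def)
    obtain F where F: "finite F" "F \<subseteq> A" "S - \<delta> < schatten_sum p F F x" using ex[OF \<delta>] by blast
    have "schatten_sum p G (G - F') x \<le> e" if G: "finite G" "G \<subseteq> A" "F \<subseteq> F'" "F' \<subseteq> G" for G F'
    proof -
      have "schatten_sum p G (G - F') x \<le> t powr (p/2) * schatten_sum p G G x + (schatten_sum p G G x - schatten_sum p G F' x) / (p/2 * t)"
        by (rule schatten_sum_tail_le_small) (use p False G t in auto)
      also have "\<dots> \<le> t powr (p/2) * S + \<delta> / (p/2 * t)"
        using PS[OF G(1,2)] tl[OF F(3) G(1,3,4)] p t by (intro add_mono mult_left_mono divide_right_mono) auto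
      also have "\<delta> / (p/2 * t) = e / 2" using p t by (simp add: \<delta>_def)
      finally show ?thesis using t1 by linarith
    qed
    with F(1,2) show ?thesis by (intro exI[of _ F] conjI allI impI) auto
  qed
qed

text \<open>
  With \<open>P\<close> the projection to the coordinates in \<open>F\<close> and \<open>Q = 1 - P\<close>, the difference is
  \<open>x - P x P = x Q + Q x P\<close>: a column tail of \<open>x\<close> and a part of a column tail of \<open>x\<^sup>*\<close>.
\<close>

theorem finite_sections_dense:
  assumes p: "1 \<le> p" and x: "schatten_sup A p x < \<infinity>" and e: "0 < e"
  shows "\<exists>F. finite F \<and> F \<subseteq> A \<and> schatten_sup A p (\<lambda>i j. x i j - sect F x i j) \<le> ennreal e"
proof -
  define d where "d = e / (2 * 2 powr p)"
  have d: "d > 0" using e by (simp add: d_def)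
  obtain F1 where F1: "finite F1 \<and> F1 \<subseteq> A \<and> (\<forall>G F'. finite G \<and> G \<subseteq> A \<and> F1 \<subseteq> F' \<and> F' \<subseteq> G \<longrightarrow> schatten_sum p G (G - F') x \<le> d)"
    using schatten_sum_column_tail[OF p x d] by (rule exE)
  have "schatten_sup A p (mat_adjoint x) < \<infinity>" using x by (simp add: schatten_sup_adjoint)
  from schatten_sum_column_tail[OF p this d] obtain F2 where F2: "finite F2 \<and> F2 \<subseteq> A \<and>
    (\<forall>G F'. finite G \<and> G \<subseteq> A \<and> F2 \<subseteq> F' \<and> F' \<subseteq> G \<longrightarrow> schatten_sum p G (G - F') (mat_adjoint x) \<le> d)"
    by (rule exE)
  define F where "F = F1 \<union> F2"
  have F: "finite F" "F \<subseteq> A" using F1 F2 by (auto simp: F_def)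
  have "schatten_sup A p (\<lambda>i j. x i j - sect F x i j) \<le> ennreal e"
  proof (rule schatten_sup_le)
    fix H assume H: "finite H" "H \<subseteq> A"
    define G where "G = H \<union> F"
    have G: "finite G" "G \<subseteq> A" "F \<subseteq> G" "H \<subseteq> G" using F H by (auto simp: G_def)
    define y where "y i j = (if j \<in> F then 0 else x i j)" for i j
    define z where "z i j = (if j \<in> F \<and> i \<notin> F then x i j else 0)" for i j
    have eq: "(\<lambda>i j. x i j - sect F x i j) = (\<lambda>i j. y i j + z i j)"
      by (auto simp: y_def z_def sect_def fun_eq_iff)
    have "schatten_sum p H H (\<lambda>i j. x i j - sect F x i j) \<le> schatten_sum p G G (\<lambda>i j. y i j + z i j)"
      unfolding eq by (rule schatten_sum_mono[OF p G(1,1,4,4)])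
    also have "\<dots> \<le> 2 powr p * (schatten_sum p G G y + schatten_sum p G G z)" by (rule schatten_sum_add[OF p G(1,1)])
    also have "\<dots> \<le> 2 powr p * (d + d)"
    proof (intro mult_left_mono add_mono)
      have "schatten_sum p G G y = schatten_sum p G (G - F) y" using G p by (intro schatten_sum_zero_columns) (auto simp: y_def)
      also have "\<dots> = schatten_sum p G (G - F) x" using G by (intro schatten_sum_cong) (auto simp: y_def)
      also have "\<dots> \<le> d" using F1 G F_def by simp
      finally show "schatten_sum p G G y \<le> d" .
      have "schatten_sum p G G z = schatten_sum p (G - F) G z" using G by (intro schatten_sum_zero_rows) (auto simp: z_def)
      also have "\<dots> = schatten_sum p (G - F) F z" using G p F by (intro schatten_sum_zero_columns) (auto simp: z_def)
      also have "\<dots> = schatten_sum p (G - F) F x" using F by (intro schatten_sum_cong) (auto simp: z_def)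
      also have "\<dots> \<le> schatten_sum p (G - F) G x" by (rule schatten_sum_mono[OF p]) (use G in auto)
      also have "\<dots> = schatten_sum p G (G - F) (mat_adjoint x)" using G by (intro schatten_sum_adjoint[symmetric]) auto
      also have "\<dots> \<le> d" using F2 G F_def by simp
      finally show "schatten_sum p G G z \<le> d" .
    qed simp
    also have "\<dots> = e" by (simp add: d_def)
    finally show "schatten_sum p H H (\<lambda>i j. x i j - sect F x i j) \<le> e" .
  qed
  with F show ?thesis by blast
qed

section \<open>Block diagonal multipliers\<close>

text \<open>
  Extremal families for the diagonal blocks are supported on disjoint sets and together form orthonormal
  families for \<open>x\<close>.
\<close>

lemma schatten_sum_pinching:
  fixes x :: "'i mat" and \<beta> :: "'i \<Rightarrow> 'b"
  assumes p: "1 \<le> p" and F: "finite F"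
  shows "(\<Sum>b\<in>\<beta> ` F. schatten_sum p {i \<in> F. \<beta> i = b} {i \<in> F. \<beta> i = b} x) \<le> schatten_sum p F F x"
proof -
  let ?cl = "\<lambda>b. {i \<in> F. \<beta> i = b}"
  have "\<exists>(K::'i set) v u. finite K \<and> orthonormal K (?cl b) v \<and> orthonormal K (?cl b) u \<and>
    schatten_sum p (?cl b) (?cl b) x = (\<Sum>k\<in>K. cmod (ip (?cl b) (u k) (fmv (?cl b) x (v k))) powr p)" for b
  proof -
    have "finite (?cl b)" using F by simp
    show ?thesis
      by (rule schatten_sum_attained[OF \<open>finite (?cl b)\<close> \<open>finite (?cl b)\<close>, where p = p and x = x], intro exI conjI)
  qed
  then have "\<forall>b. \<exists>z :: 'i set \<times> ('i \<Rightarrow> 'i \<Rightarrow> complex) \<times> ('i \<Rightarrow> 'i \<Rightarrow> complex).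
    finite (fst z) \<and> orthonormal (fst z) (?cl b) (fst (snd z)) \<and> orthonormal (fst z) (?cl b) (snd (snd z)) \<and>
    schatten_sum p (?cl b) (?cl b) x = (\<Sum>k\<in>fst z. cmod (ip (?cl b) (snd (snd z) k) (fmv (?cl b) x (fst (snd z) k))) powr p)"
    by (simp add: split_paired_Ex)
  from choice[OF this] obtain z where z: "\<forall>b. finite (fst (z b) :: 'i set) \<and> orthonormal (fst (z b)) (?cl b) (fst (snd (z b)))
    \<and> orthonormal (fst (z b)) (?cl b) (snd (snd (z b))) \<and>
    schatten_sum p (?cl b) (?cl b) x = (\<Sum>k\<in>fst (z b). cmod (ip (?cl b) (snd (snd (z b)) k) (fmv (?cl b) x (fst (snd (z b)) k))) powr p)"
    by (rule exE)
  define K where "K b = fst (z b)" for b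
  define v where "v b = fst (snd (z b))" for b
  define u where "u b = snd (snd (z b))" for b
  have K: "finite (K b)" "orthonormal (K b) (?cl b) (v b)" "orthonormal (K b) (?cl b) (u b)"
    "schatten_sum p (?cl b) (?cl b) x = (\<Sum>k\<in>K b. cmod (ip (?cl b) (u b k) (fmv (?cl b) x (v b k))) powr p)" for b
    using spec[OF z, of b] by (auto simp only: K_def v_def u_def)
  let ?e = "\<lambda>v (b, k) i. if i \<in> ?cl b then v b k i else (0::complex)"
  let ?K = "SIGMA b:\<beta> ` F. K b"
  have ie: "ip F (?e v (b, k)) w = ip (?cl b) (v b k) w" for v :: "'b \<Rightarrow> 'i \<Rightarrow> 'i \<Rightarrow> complex" and b k w
    unfolding ip_def by (rule sum.mono_neutral_cong_right) (use F in auto)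
  have on: "orthonormal ?K F (?e v)" if "\<And>b. orthonormal (K b) (?cl b) (v b)" for v
    unfolding orthonormal_def
  proof (intro ballI)
    fix bk cl assume "bk \<in> ?K" "cl \<in> ?K"
    then obtain b k c l where bk: "bk = (b, k)" "cl = (c, l)" "k \<in> K b" "l \<in> K c" by auto
    show "ip F (?e v bk) (?e v cl) = (if bk = cl then 1 else 0)"
    proof (cases "b = c")
      case True
      have "ip F (?e v bk) (?e v cl) = ip (?cl b) (v b k) (v b l)"
        unfolding bk ie using True by (intro ip_cong) auto
      then show ?thesis using that[of b] bk True by (simp add: orthonormal_def)
    next
      case False
      have "ip F (?e v bk) (?e v cl) = ip (?cl b) (v b k) (\<lambda>_. 0)"
        unfolding bk ie using False by (intro ip_cong) auto
      then show ?thesis using bk False by (simp add: ip_def)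
    qed
  qed
  have fe: "fmv F x (?e v (b, k)) = fmv (?cl b) x (v b k)" for b k
    unfolding fmv_def by (intro ext sum.mono_neutral_cong_right) (use F in auto)
  have gen: "(\<Sum>b\<in>\<beta> ` F. \<Sum>k\<in>K b. h (b, k)) = sum h ?K" for h :: "_ \<Rightarrow> real"
    using F K(1) by (simp add: sum.Sigma)
  have "(\<Sum>b\<in>\<beta> ` F. schatten_sum p (?cl b) (?cl b) x)
      = (\<Sum>b\<in>\<beta> ` F. \<Sum>k\<in>K b. cmod (ip F (?e u (b, k)) (fmv F x (?e v (b, k)))) powr p)"
    unfolding K(4) ie fe ..
  also have "\<dots> = (\<Sum>bk\<in>?K. cmod (ip F (?e u bk) (fmv F x (?e v bk))) powr p)"
    by (rule gen)
  also have "\<dots> \<le> schatten_sum p F F x"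
    by (rule schatten_sum_ge_bilinear[OF p F F _ on[OF K(2)] on[OF K(3)]]) (use F K(1) in auto)
  finally show ?thesis .
qed

text \<open>
  The class \<open>\<sigma> j\<close> is the column of the block to which the index \<open>j\<close> belongs; with matrix coefficients many indices share a
  class.  Within a class the multiplier scales each row by a number of constant modulus, which only contributes
  the factor \<open>c powr p\<close>.  Splitting \<open>y\<close> into the classes and reassembling \<open>x\<close> from them costs the power of \<open>n\<close> that
  this factor compensates.
\<close>

lemma schatten_sum_single_block:
  fixes \<sigma> :: "'i \<Rightarrow> nat" and x :: "'i mat"
  assumes p: "1 \<le> p" and N: "finite N" and n: "\<And>j. j \<in> N \<Longrightarrow> \<sigma> j < n"
    and mu: "\<And>i j. i \<in> N \<Longrightarrow> j \<in> N \<Longrightarrow> y i j = d i (\<sigma> j) * x i j"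
    and d: "\<And>i k. i \<in> N \<Longrightarrow> cmod (d i k) = real n powr (- \<bar>1/2 - 1/p\<bar>)"
  shows "schatten_sum p N N y \<le> schatten_sum p N N x"
proof (cases "N = {}")
  case False
  then have n0: "n > 0" using n by fastforce
  define c where "c = real n powr (- \<bar>1/2 - 1/p\<bar>)"
  let ?cl = "\<lambda>k. {j \<in> N. \<sigma> j = k}"
  let ?X = "\<Sum>k\<in>\<sigma> ` N. schatten_sum p N (?cl k) x"
  have X0: "?X \<ge> 0" by (intro sum_nonneg) simp
  have "\<sigma> ` N \<subseteq> {..<n}" using n by auto
  then have "card (\<sigma> ` N) \<le> card {..<n}" by (intro card_mono) auto
  then have cn: "card (\<sigma> ` N) \<le> n" by simp
  have c0: "card (\<sigma> ` N) > 0" using False N by (simp add: card_gt_0_iff)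
  have sc: "schatten_sum p N (?cl k) y = c powr p * schatten_sum p N (?cl k) x" for k
    by (rule schatten_sum_row_scale[where d = "\<lambda>i. d i k"]) (use N mu d in \<open>auto simp: c_def\<close>)
  have Y: "(\<Sum>k\<in>\<sigma> ` N. schatten_sum p N (?cl k) y) = c powr p * ?X"
    by (simp add: sc sum_distrib_left)
  show ?thesis
  proof (cases "2 \<le> p")
    case True
    have ab: "\<bar>1/2 - 1/p\<bar> = 1/2 - 1/p" using True by (simp add: field_simps)
    have "(1/2 - 1/p) * p = p/2 - 1" using True by (simp add: left_diff_distrib)
    then have "- (1/2 - 1/p) * p = 1 - p/2" by (smt (verit) mult_minus_left)
    then have cp: "c powr p = real n powr (1 - p/2)" unfolding c_def ab powr_powr by (simp only:)
    have "schatten_sum p N N y \<le> real (card (\<sigma> ` N)) powr (p/2 - 1) * (c powr p * ?X)"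
      using schatten_sum_le_classes[OF True N N, of y \<sigma>] unfolding Y .
    also have "\<dots> \<le> real n powr (p/2 - 1) * (c powr p * ?X)"
      using cn True X0 by (intro mult_right_mono powr_mono2) auto
    also have "\<dots> = (real n powr (p/2 - 1) * real n powr (1 - p/2)) * ?X" by (simp add: cp)
    also have "real n powr (p/2 - 1) * real n powr (1 - p/2) = 1"
      using n0 by (simp add: powr_add[symmetric])
    also have "1 * ?X \<le> schatten_sum p N N x" using schatten_sum_classes_le[OF True N N, of \<sigma> x] by simp
    finally show ?thesis .
  next
    case False
    then have p2: "p \<le> 2" "0 < p" using p by auto
    have ab: "\<bar>1/2 - 1/p\<bar> = 1/p - 1/2" using p2 by (simp add: field_simps)
    have "(1/p - 1/2) * p = 1 - p/2" using p2 by (simp add: left_diff_distrib)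
    then have "- (1/p - 1/2) * p = p/2 - 1" by (smt (verit) mult_minus_left)
    then have cp: "c powr p = real n powr (p/2 - 1)" unfolding c_def ab powr_powr by (simp only:)
    have "schatten_sum p N N y \<le> c powr p * ?X"
      using schatten_sum_classes_ge[OF p2(2,1) N N, of y \<sigma>] unfolding Y .
    also have "\<dots> \<le> real (card (\<sigma> ` N)) powr (p/2 - 1) * ?X"
      unfolding cp using cn c0 X0 p2 by (intro mult_right_mono powr_mono2') auto
    also have "\<dots> \<le> schatten_sum p N N x" by (rule schatten_sum_ge_classes[OF p2(2,1) N N])
    finally show ?thesis .
  qed
qed (simp add: schatten_sum_def)

text \<open>
  The value \<open>Some (n, k)\<close> of \<open>pos\<close> is the place \<open>k\<close> in the block of size \<open>n\<close>.  The product is block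
  diagonal, so its \<open>schatten_sum\<close> splits over the blocks; each block is estimated separately, and pinching
  bounds the sum over the diagonal blocks of \<open>x\<close>.
\<close>

lemma schatten_sum_block_multiplier:
  fixes pos :: "'i \<Rightarrow> (nat \<times> nat) option" and x :: "'i mat"
  assumes p: "1 \<le> p" and F: "finite F"
    and pos: "\<And>i n k. i \<in> F \<Longrightarrow> pos i = Some (n, k) \<Longrightarrow> k < n"
    and mu: "\<And>i j n k l. pos i = Some (n, k) \<Longrightarrow> pos j = Some (n, l) \<Longrightarrow>
       \<mu> i j = \<phi> n k l \<and> cmod (\<phi> n k l) = real n powr (- \<bar>1/2 - 1/p\<bar>)"
    and off: "\<And>i j. pos i = None \<or> pos j = None \<or> map_option fst (pos i) \<noteq> map_option fst (pos j) \<Longrightarrow> \<mu> i j = 0"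
  shows "schatten_sum p F F (\<lambda>i j. \<mu> i j * x i j) \<le> schatten_sum p F F x"
proof -
  let ?y = "\<lambda>i j. \<mu> i j * x i j"
  let ?b = "\<lambda>i. map_option fst (pos i)"
  let ?cl = "\<lambda>b. {i \<in> F. ?b i = b}"
  have p0: "0 < p" using p by simp
  have "schatten_sum p F F ?y = (\<Sum>b\<in>?b ` F. schatten_sum p F (?cl b) ?y)"
  proof (rule schatten_sum_block_diagonal[OF F F])
    fix i j j' assume "?b j \<noteq> ?b j'"
    then have "?b i \<noteq> ?b j \<or> ?b i \<noteq> ?b j'" by auto
    then have "\<mu> i j = 0 \<or> \<mu> i j' = 0" using off by blast
    then show "?y i j = 0 \<or> ?y i j' = 0" by auto
  qed
  also have "\<dots> \<le> (\<Sum>b\<in>?b ` F. schatten_sum p (?cl b) (?cl b) x)"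
  proof (rule sum_mono)
    fix b
    have "schatten_sum p F (?cl b) ?y = schatten_sum p (?cl b) (?cl b) ?y"
      by (rule schatten_sum_zero_rows) (use F off in auto)
    also have "\<dots> \<le> schatten_sum p (?cl b) (?cl b) x"
    proof (cases b)
      case None
      then have "schatten_sum p (?cl b) (?cl b) ?y = 0" using F p0 off by (intro schatten_sum_zero) auto
      then show ?thesis by simp
    next
      case (Some n)
      define \<sigma> where "\<sigma> j = snd (the (pos j))" for j
      have pe: "pos j = Some (n, \<sigma> j)" if "j \<in> ?cl b" for j
        using that Some by (auto simp: \<sigma>_def)
      show ?thesis
      proof (rule schatten_sum_single_block[OF p, where \<sigma> = \<sigma> and n = n and d = "\<lambda>i k. if \<exists>j. pos j = Some (n, k) then \<phi> n (\<sigma> i) k else of_real (real n powr (- \<bar>1/2 - 1/p\<bar>))"])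
        show "finite (?cl b)" using F by simp
        show "\<sigma> j < n" if "j \<in> ?cl b" for j using pos[of j n "\<sigma> j"] pe[OF that] that by auto
        show "?y i j = (if \<exists>ja. pos ja = Some (n, \<sigma> j) then \<phi> n (\<sigma> i) (\<sigma> j) else of_real (real n powr (- \<bar>1/2 - 1/p\<bar>))) * x i j"
          if "i \<in> ?cl b" "j \<in> ?cl b" for i j
          using mu[OF pe[OF that(1)] pe[OF that(2)]] pe[OF that(2)] by auto
        show "cmod (if \<exists>j. pos j = Some (n, k) then \<phi> n (\<sigma> i) k else of_real (real n powr (- \<bar>1/2 - 1/p\<bar>))) = real n powr (- \<bar>1/2 - 1/p\<bar>)"
          if "i \<in> ?cl b" for i k
          using mu[OF pe[OF that]] by auto
      qed
    qed
    finally show "schatten_sum p F (?cl b) ?y \<le> schatten_sum p (?cl b) (?cl b) x" .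
  qed
  also have "\<dots> \<le> schatten_sum p F F x" by (rule schatten_sum_pinching[OF p F])
  finally show ?thesis .
qed

section \<open>The symbol\<close>

text \<open>
  The integers \<open>prod_encode (n, k)\<close> with \<open>k < n\<close> make up the block of size \<open>n\<close>; all other integers
  belong to no block.
\<close>

definition position :: "int \<Rightarrow> (nat \<times> nat) option" where
  "position i = (let (n, k) = prod_decode (nat i) in if 0 \<le> i \<and> k < n then Some (n, k) else None)"

definition place :: "nat \<Rightarrow> nat \<Rightarrow> int" where
  "place n k = int (prod_encode (n, k))"

definition block_matrix :: "(nat \<Rightarrow> nat \<Rightarrow> nat \<Rightarrow> complex) \<Rightarrow> int mat" where
  "block_matrix \<phi> i j = (case (position i, position j) of
     (Some (n, k), Some (n', l)) \<Rightarrow> if n = n' then \<phi> n k l else 0 | _ \<Rightarrow> 0)"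

definition dft :: "nat \<Rightarrow> nat \<Rightarrow> nat \<Rightarrow> complex" where
  "dft n k l = cis (2 * pi * real k * real l / real n)"

definition weight :: "real \<Rightarrow> nat \<Rightarrow> real" where
  "weight p n = real n powr (- \<bar>1/2 - 1/p\<bar>)"

definition symbol :: "real \<Rightarrow> int \<times> int \<Rightarrow> complex" where
  "symbol p = (\<lambda>(i, j). block_matrix (\<lambda>n k l. of_real (weight p n) * dft n k l) i j)"

lemma position_less: "position i = Some (n, k) \<Longrightarrow> k < n"
  by (auto simp: position_def Let_def split: prod.splits if_splits)

lemma position_place: "k < n \<Longrightarrow> position (place n k) = Some (n, k)"
  by (simp add: position_def place_def)

lemma place_position: "position i = Some (n, k) \<Longrightarrow> i = place n k"
  by (auto simp: position_def place_def Let_def split: prod.splits if_splits) (metis nat_0_le prod_decode_inverse)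

lemma cmod_dft [simp]: "cmod (dft n k l) = 1"
  by (simp add: dft_def)

text \<open>
  The map \<open>h\<close> is the identity for the multiplier itself and the projection to the second component for its
  amplifications.
\<close>

lemma symbol_multiplier_le:
  assumes p: "1 \<le> p" and h: "\<And>\<mu> \<nu>. y \<mu> \<nu> = symbol p (h \<mu>, h \<nu>) * x \<mu> \<nu>"
  shows "schatten_sup A p y \<le> schatten_sup A p x"
  unfolding schatten_sup_def
proof (rule SUP_mono)
  fix F assume "F \<in> {F. finite F \<and> F \<subseteq> A}"
  then have F: "finite F" by auto
  have "schatten_sum p F F (\<lambda>\<mu> \<nu>. symbol p (h \<mu>, h \<nu>) * x \<mu> \<nu>) \<le> schatten_sum p F F x"
  proof (rule schatten_sum_block_multiplier[OF p F, where pos = "\<lambda>\<mu>. position (h \<mu>)" and \<phi> = "\<lambda>n k l. of_real (weight p n) * dft n k l"])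
    show "\<And>i n k. i \<in> F \<Longrightarrow> position (h i) = Some (n, k) \<Longrightarrow> k < n" by (rule position_less)
    show "symbol p (h i, h j) = of_real (weight p n) * dft n k l \<and>
       cmod (of_real (weight p n) * dft n k l) = real n powr (- \<bar>1/2 - 1/p\<bar>)"
      if "position (h i) = Some (n, k)" "position (h j) = Some (n, l)" for i j n k l
      using that by (simp add: symbol_def block_matrix_def norm_mult weight_def)
    show "symbol p (h i, h j) = 0"
      if "position (h i) = None \<or> position (h j) = None \<or> map_option fst (position (h i)) \<noteq> map_option fst (position (h j))" for i j
      using that by (auto simp: symbol_def block_matrix_def split: option.splits)
  qed
  moreover have "y = (\<lambda>\<mu> \<nu>. symbol p (h \<mu>, h \<nu>) * x \<mu> \<nu>)" using h by (simp add: fun_eq_iff)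
  ultimately have "schatten_sum p F F y \<le> schatten_sum p F F x" by simp
  with \<open>F \<in> _\<close> show "\<exists>G\<in>{F. finite F \<and> F \<subseteq> A}. ennreal (schatten_sum p F F y) \<le> ennreal (schatten_sum p G G x)"
    by (intro bexI[of _ F] ennreal_leI)
qed

lemma schatten_sup_finite_support:
  assumes p: "1 \<le> p" and F0: "finite F0" and x: "\<And>i j. x i j \<noteq> 0 \<Longrightarrow> i \<in> F0 \<and> j \<in> F0"
  shows "schatten_sup A p x \<le> ennreal (schatten_sum p F0 F0 x)"
proof (rule schatten_sup_le)
  fix F assume F: "finite F" "F \<subseteq> A"
  let ?G = "F \<union> F0"
  have "schatten_sum p F F x \<le> schatten_sum p ?G ?G x" by (rule schatten_sum_mono[OF p]) (use F F0 in auto)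
  also have "\<dots> = schatten_sum p F0 ?G x" by (rule schatten_sum_zero_rows) (use F F0 x in auto)
  also have "\<dots> = schatten_sum p F0 F0 x" by (rule schatten_sum_zero_columns) (use p F F0 x in auto)
  finally show "schatten_sum p F F x \<le> schatten_sum p F0 F0 x" .
qed

lemma finite_support_square:
  assumes "finite {(i, j). x i j \<noteq> (0::complex)}"
  obtains F0 where "finite F0" "\<And>i j. x i j \<noteq> 0 \<Longrightarrow> i \<in> F0 \<and> j \<in> F0"
proof
  let ?S = "{(i, j). x i j \<noteq> 0}"
  show "finite (fst ` ?S \<union> snd ` ?S)" using assms by simp
  show "\<And>i j. x i j \<noteq> 0 \<Longrightarrow> i \<in> fst ` ?S \<union> snd ` ?S \<and> j \<in> fst ` ?S \<union> snd ` ?S"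
    by (force simp: image_iff)
qed

section \<open>Complete boundedness\<close>

context
  fixes p :: ennreal and P :: real
  assumes p: "1 \<le> p" "p \<noteq> \<infinity>" and P: "P = enn2real p"
begin

lemma P1: "1 \<le> P" by (rule exponent_ge_1[OF p P])

lemma class_iff: "x \<in> schatten_class A p \<longleftrightarrow> matsupp A x \<and> schatten_sup A P x < \<infinity>"
  by (rule schatten_class_iff[OF p P])

lemma class_add:
  assumes "x \<in> schatten_class A p" "y \<in> schatten_class A p"
  shows "(\<lambda>i j. x i j + y i j) \<in> schatten_class A p"
proof -
  have "schatten_sup A P (\<lambda>i j. x i j + y i j) < \<infinity>"
    using assms schatten_sup_add[OF P1, of A x y] by (auto simp: class_iff intro: le_less_trans)
  then show ?thesis using assms by (auto simp: class_iff matsupp_def)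
qed

lemma class_scale:
  assumes "x \<in> schatten_class A p" shows "(\<lambda>i j. c * x i j) \<in> schatten_class A p"
proof -
  have "schatten_sup A P (\<lambda>i j. c * x i j) < \<infinity>"
    using assms schatten_sup_scale[of A P x c] by (auto simp: class_iff intro: le_less_trans)
  then show ?thesis using assms by (auto simp: class_iff matsupp_def)
qed

lemma class_finite_support:
  assumes "finite {(i, j). x i j \<noteq> 0}" shows "x \<in> schatten_class UNIV p"
proof -
  obtain F0 where F0: "finite F0" "\<And>i j. x i j \<noteq> 0 \<Longrightarrow> i \<in> F0 \<and> j \<in> F0" by (rule finite_support_square[OF assms]) blast
  have "schatten_sup UNIV P x \<le> ennreal (schatten_sum P F0 F0 x)" by (rule schatten_sup_finite_support[OF P1 F0])
  then show ?thesis by (auto simp: class_iff matsupp_def intro: le_less_trans)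
qed

text \<open>
  A bound for the norm of \<open>T\<close>, weakened to the entries of \<open>T y\<close>, which is all that uniqueness needs.
\<close>

lemma schur_map_entry:
  assumes T: "is_schur_map p m T"
  obtains k where "0 \<le> k" "\<And>y t i j. y \<in> schatten_class UNIV p \<Longrightarrow> schatten_sup UNIV P y \<le> ennreal (t powr P) \<Longrightarrow> 0 < t \<Longrightarrow>
     cmod (T y i j) \<le> k * t"
proof
  let ?V = "schatten_class UNIV p :: int mat set"
  let ?k = "enn2real (map_norm (schatten_norm UNIV p) ?V T)"
  show "0 \<le> ?k" by simp
  fix y t i j assume y: "y \<in> ?V" and Py: "schatten_sup UNIV P y \<le> ennreal (t powr P)" and t: "0 < t"
  have lin: "linear_map_on ?V T" and fin: "map_norm (schatten_norm UNIV p) ?V T < \<infinity>" and TV: "T \<in> ?V \<rightarrow>\<^sub>E ?V"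
    using T by (auto simp: is_schur_map_def)
  define z where "z = (\<lambda>i j. of_real (1/t) * y i j)"
  have z: "z \<in> ?V" unfolding z_def by (rule class_scale[OF y])
  have "enn2real (schatten_sup UNIV P y) \<le> t powr P" using Py by (simp add: enn2real_leI)
  then have "(1/t) powr P * enn2real (schatten_sup UNIV P y) \<le> (1/t) powr P * t powr P" by (intro mult_left_mono) auto
  also have "\<dots> = 1" using t by (simp add: powr_divide)
  finally have le1: "(1/t) powr P * enn2real (schatten_sup UNIV P y) \<le> 1" .
  have "schatten_sup UNIV P z \<le> ennreal (cmod (of_real (1/t)) powr P * enn2real (schatten_sup UNIV P y))"
    unfolding z_def using y by (intro schatten_sup_scale) (simp add: class_iff)
  also have "\<dots> \<le> ennreal 1" using le1 t by (intro ennreal_leI) (simp only: norm_of_real, simp)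
  finally have "enn2real (schatten_sup UNIV P z) \<le> 1" by (simp add: enn2real_leI)
  then have "enn2real (schatten_sup UNIV P z) powr (1/P) \<le> 1 powr (1/P)" using P1 by (intro powr_mono2) auto
  then have "schatten_norm UNIV p z \<le> 1"
    unfolding schatten_norm_class[OF p P z] by (simp add: ennreal_le_1)
  then have "schatten_norm UNIV p (T z) \<le> map_norm (schatten_norm UNIV p) ?V T"
    unfolding map_norm_def using z by (intro SUP_upper) auto
  moreover have Tz: "T z \<in> ?V" using TV z by (auto simp: PiE_iff)
  ultimately have "ennreal (enn2real (schatten_sup UNIV P (T z)) powr (1/P)) \<le> ennreal ?k"
    using fin by (simp add: schatten_norm_class[OF p P])
  then have "enn2real (schatten_sup UNIV P (T z)) powr (1/P) \<le> ?k" by (simp add: ennreal_le_iff)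
  moreover have "cmod (T z i j) \<le> enn2real (schatten_sup UNIV P (T z)) powr (1/P)"
    by (rule schatten_sup_finite_entry[OF P1]) (use Tz in \<open>auto simp: class_iff\<close>)
  moreover have "T z = (\<lambda>i j. of_real (1/t) * T y i j)"
    using lin y unfolding linear_map_on_def z_def by blast
  ultimately have "1/t * cmod (T y i j) \<le> ?k" using t by (simp add: norm_divide)
  then show "cmod (T y i j) \<le> ?k * t" using t by (simp add: field_simps)
qed

text \<open>
  Two extensions agree on finite sections of \<open>x\<close>, so they differ at \<open>x\<close> as much as they differ at the remainder,
  whose norm can be made arbitrarily small.
\<close>

lemma schur_map_unique:
  assumes T: "is_schur_map p m T" and S: "is_schur_map p m S"
  shows "T = S"
proof (rule ext)
  fix x
  let ?V = "schatten_class UNIV p :: int mat set"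
  show "T x = S x"
  proof (cases "x \<in> ?V")
    case False
    then have "T x = undefined" "S x = undefined"
      using T S by (auto simp: is_schur_map_def PiE_iff extensional_def)
    then show ?thesis by simp
  next
    case True
    obtain k where k: "0 \<le> k" "\<And>y t i j. y \<in> ?V \<Longrightarrow> schatten_sup UNIV P y \<le> ennreal (t powr P) \<Longrightarrow> 0 < t \<Longrightarrow> cmod (T y i j) \<le> k * t"
      by (rule schur_map_entry[OF T]) blast
    obtain l where l: "0 \<le> l" "\<And>y t i j. y \<in> ?V \<Longrightarrow> schatten_sup UNIV P y \<le> ennreal (t powr P) \<Longrightarrow> 0 < t \<Longrightarrow> cmod (S y i j) \<le> l * t"
      by (rule schur_map_entry[OF S]) blast
    have lin: "linear_map_on ?V T" "linear_map_on ?V S"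
      and fs: "\<And>z. finite {(i, j). z i j \<noteq> 0} \<Longrightarrow> T z = S z"
      using T S by (auto simp: is_schur_map_def)
    have bound: "cmod (T x i j - S x i j) \<le> (k + l) * t" if t: "0 < t" for i j t
    proof -
      have "schatten_sup UNIV P x < \<infinity>" using True by (simp add: class_iff)
      then obtain F where F: "finite F" "schatten_sup UNIV P (\<lambda>i j. x i j - sect F x i j) \<le> ennreal (t powr P)"
        using finite_sections_dense[OF P1, of UNIV x "t powr P"] t by auto
      define y where "y = (\<lambda>i j. x i j - sect F x i j)"
      have sf: "finite {(i, j). sect F x i j \<noteq> 0}"
        by (rule finite_subset[of _ "F \<times> F"]) (use F in \<open>auto simp: sect_def split: if_splits\<close>)
      have sV: "sect F x \<in> ?V" by (rule class_finite_support[OF sf])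
      have y: "y \<in> ?V" using class_add[OF True class_scale[OF sV, of "-1"]] by (simp add: y_def)
      have xy: "x = (\<lambda>i j. sect F x i j + y i j)" by (simp add: y_def)
      have add: "R (\<lambda>i j. sect F x i j + y i j) = (\<lambda>i j. R (sect F x) i j + R y i j)" if "linear_map_on ?V R" for R
        using that sV y unfolding linear_map_on_def by blast
      have "T x i j = T (sect F x) i j + T y i j" "S x i j = S (sect F x) i j + S y i j"
        using fun_cong[OF fun_cong[OF add[OF lin(1)]]] fun_cong[OF fun_cong[OF add[OF lin(2)]]]
        unfolding xy[symmetric] by blast+
      then have "T x i j - S x i j = T y i j - S y i j" using fs[OF sf] by simp
      then have "cmod (T x i j - S x i j) \<le> cmod (T y i j) + cmod (S y i j)" by (simp add: norm_triangle_ineq4)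
      also have "\<dots> \<le> k * t + l * t" using F t y by (intro add_mono k(2) l(2)) (auto simp: y_def)
      finally show ?thesis by (simp add: distrib_right)
    qed
    have z: "cmod (T x i j - S x i j) / (k + l + 1) \<le> 0 + e" if "0 < e" for e i j
    proof -
      have "cmod (T x i j - S x i j) \<le> (k + l) * e" by (rule bound[OF that])
      also have "\<dots> \<le> e * (k + l + 1)" using that by (simp add: algebra_simps)
      finally show ?thesis using k(1) l(1) by (simp add: pos_divide_le_eq)
    qed
    have "T x i j = S x i j" for i j
    proof -
      have "cmod (T x i j - S x i j) / (k + l + 1) \<le> 0" by (rule field_le_epsilon) (rule z)
      then have "cmod (T x i j - S x i j) \<le> 0" using k(1) l(1) by (simp add: divide_le_0_iff)
      then show ?thesis by simp
    qed
    then show ?thesis by (simp add: fun_eq_iff)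
  qed
qed

definition symbol_map :: "int mat \<Rightarrow> int mat" where
  "symbol_map = (\<lambda>x\<in>schatten_class UNIV p. \<lambda>i j. symbol P (i, j) * x i j)"

lemma symbol_class:
  assumes "x \<in> schatten_class A p" "\<And>\<mu> \<nu>. y \<mu> \<nu> = symbol P (h \<mu>, h \<nu>) * x \<mu> \<nu>"
  shows "y \<in> schatten_class A p" "schatten_norm A p y \<le> schatten_norm A p x"
proof -
  have le: "schatten_sup A P y \<le> schatten_sup A P x" by (rule symbol_multiplier_le[OF P1 assms(2)])
  show y: "y \<in> schatten_class A p" using assms le by (auto simp: class_iff matsupp_def intro: le_less_trans)
  show "schatten_norm A p y \<le> schatten_norm A p x" by (rule schatten_norm_mono[OF p P y assms(1) le])
qed

lemma is_schur_map_symbol: "is_schur_map p (symbol P) symbol_map"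
  unfolding is_schur_map_def
proof (intro conjI allI impI)
  let ?V = "schatten_class UNIV p :: int mat set"
  have S: "symbol_map x = (\<lambda>i j. symbol P (i, j) * x i j)" if "x \<in> ?V" for x
    using that by (simp add: symbol_map_def)
  have SV: "symbol_map x \<in> ?V" "schatten_norm UNIV p (symbol_map x) \<le> schatten_norm UNIV p x" if "x \<in> ?V" for x
    using symbol_class[OF that, of "symbol_map x" id] S[OF that] by auto
  show "symbol_map \<in> ?V \<rightarrow>\<^sub>E ?V" using SV(1) by (auto simp: PiE_iff symbol_map_def)
  show "linear_map_on ?V symbol_map"
    unfolding linear_map_on_def
    by (intro conjI ballI allI) (simp_all add: S class_add class_scale distrib_left mult.left_commute)
  have "map_norm (schatten_norm UNIV p) ?V symbol_map \<le> 1"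
    unfolding map_norm_def using SV(2) by (intro SUP_least) (auto intro: order_trans)
  then show "map_norm (schatten_norm UNIV p) ?V symbol_map < \<infinity>" by (rule le_less_trans) simp
  show "symbol_map x = (\<lambda>i j. symbol P (i, j) * x i j)" if "finite {(i, j). x i j \<noteq> 0}" for x
    by (rule S[OF class_finite_support[OF that]])
qed

lemma schur_map_symbol: "schur_map p (symbol P) = symbol_map"
  unfolding schur_map_def
  by (rule the_equality, rule is_schur_map_symbol, rule schur_map_unique, assumption, rule is_schur_map_symbol)

lemma block_in_class:
  assumes x: "x \<in> schatten_class ({..<s} \<times> UNIV) p"
  shows "(\<lambda>i j. x (k, i) (l, j)) \<in> schatten_class UNIV p"
proof -
  let ?A = "{..<s} \<times> (UNIV :: 'b set)"
  have xs: "matsupp ?A x" "schatten_sup ?A P x < \<infinity>" using x by (auto simp: class_iff)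
  have "schatten_sup UNIV P (\<lambda>i j. x (k, i) (l, j)) \<le> schatten_sup ?A P x"
  proof (cases "k < s \<and> l < s")
    case True
    show ?thesis unfolding schatten_sup_def[of UNIV]
    proof (rule SUP_least)
      fix F :: "'b set" assume "F \<in> {F. finite F \<and> F \<subseteq> UNIV}"
      then have F: "finite F" by simp
      let ?G = "Pair k ` F \<union> Pair l ` F"
      have "schatten_sum P F F (\<lambda>i j. x (k, i) (l, j)) \<le> schatten_sum P ?G ?G x"
        by (rule schatten_sum_transport[OF P1, where f = "Pair l" and g = "Pair k"]) (use F in \<open>auto simp: inj_on_def\<close>)
      then have "ennreal (schatten_sum P F F (\<lambda>i j. x (k, i) (l, j))) \<le> ennreal (schatten_sum P ?G ?G x)" by (rule ennreal_leI)
      also have "\<dots> \<le> schatten_sup ?A P x" by (rule schatten_sum_le_schatten_sup) (use F True in auto)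
      finally show "ennreal (schatten_sum P F F (\<lambda>i j. x (k, i) (l, j))) \<le> schatten_sup ?A P x" .
    qed
  next
    case False
    then have "x (k, i) (l, j) = 0" for i j using xs(1) by (auto simp: matsupp_def)
    then have "schatten_sup UNIV P (\<lambda>i j. x (k, i) (l, j)) \<le> ennreal 0"
      using P1 by (intro schatten_sup_le) (simp add: schatten_sum_zero)
    then show ?thesis by simp
  qed
  then show ?thesis using xs by (auto simp: class_iff matsupp_def intro: le_less_trans)
qed

text \<open>
  The amplification is again entrywise multiplication by a symbol of the same block form, so the bound for a single
  block applies to all amplifications with the same constant 1.
\<close>

theorem symbol_cb_multiplier: "symbol P \<in> cb_schur_multipliers p"
proof -
  have "map_norm (schatten_norm ({..<s} \<times> UNIV) p) (schatten_tensor s p) (amplify (schur_map p (symbol P))) \<le> 1" for s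
    unfolding map_norm_def
  proof (rule SUP_least)
    fix x assume "x \<in> {x \<in> schatten_tensor s p. schatten_norm ({..<s} \<times> UNIV) p x \<le> 1}"
    then have x: "x \<in> schatten_class ({..<s} \<times> UNIV) p" "schatten_norm ({..<s} \<times> UNIV) p x \<le> 1"
      by (auto simp: schatten_tensor_def)
    have "amplify (schur_map p (symbol P)) x \<mu> \<nu> = symbol P (snd \<mu>, snd \<nu>) * x \<mu> \<nu>" for \<mu> \<nu>
      unfolding amplify_def schur_map_symbol symbol_map_def
      using block_in_class[OF x(1)] by (simp add: case_prod_unfold)
    from symbol_class(2)[OF x(1) this] x(2)
    show "schatten_norm ({..<s} \<times> UNIV) p (amplify (schur_map p (symbol P)) x) \<le> 1" by (rule order_trans)
  qed
  then have "schur_cb_norm p (symbol P) \<le> 1" unfolding schur_cb_norm_def by (intro SUP_least)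
  then have "schur_cb_norm p (symbol P) < \<infinity>" by (rule le_less_trans) simp
  then show ?thesis
    using is_schur_map_symbol unfolding cb_schur_multipliers_def schur_multipliers_def by blast
qed

end

section \<open>Norms of test matrices\<close>

definition block :: "nat \<Rightarrow> int set" where
  "block n = place n ` {..<n}"

lemma inj_place: "inj_on (place n) K"
  by (auto simp: inj_on_def place_def)

lemma finite_block [simp]: "finite (block n)"
  by (simp add: block_def)

lemma card_block: "card (block n) = n"
  by (simp add: block_def card_image[OF inj_place])

lemma sum_block: "(\<Sum>i\<in>block n. f i) = (\<Sum>k<n. f (place n k))"
  by (simp add: block_def sum.reindex[OF inj_place])

text \<open>
  The matrix with the entries \<open>\<phi> k l\<close> on the block of size \<open>n\<close> and zeros elsewhere.
\<close>

definition test_matrix :: "nat \<Rightarrow> (nat \<Rightarrow> nat \<Rightarrow> complex) \<Rightarrow> int mat" where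
  "test_matrix n \<phi> = block_matrix (\<lambda>n' k l. if n' = n then \<phi> k l else 0)"

lemma test_matrix_place: "k < n \<Longrightarrow> l < n \<Longrightarrow> test_matrix n \<phi> (place n k) (place n l) = \<phi> k l"
  by (simp add: test_matrix_def block_matrix_def position_place)

lemma mem_block: "position i = Some (n, k) \<Longrightarrow> i \<in> block n"
  unfolding block_def using place_position[of i n k] position_less[of i n k] by blast

lemma test_matrix_support:
  assumes "test_matrix n \<phi> i j \<noteq> 0" shows "i \<in> block n \<and> j \<in> block n"
proof -
  obtain k l where "position i = Some (n, k)" "position j = Some (n, l)"
    using assms by (auto simp: test_matrix_def block_matrix_def split: option.splits if_splits)
  then show ?thesis by (simp add: mem_block)
qed

lemma finite_support_test_matrix: "finite {(i, j). test_matrix n \<phi> i j \<noteq> 0}"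
  by (rule finite_subset[of _ "block n \<times> block n"]) (use test_matrix_support in auto)

lemma symbol_test_matrix:
  "symbol p (i, j) * test_matrix n \<phi> i j = test_matrix n (\<lambda>k l. of_real (weight p n) * dft n k l * \<phi> k l) i j"
  by (auto simp: symbol_def test_matrix_def block_matrix_def split: option.splits)

lemma dft_orthogonal:
  assumes "l < n" "l' < n"
  shows "(\<Sum>k<n. cnj (dft n k l) * dft n k l') = (if l = l' then of_nat n else 0)"
proof -
  define z where "z = cis (2 * pi * (real l' - real l) / real n)"
  have n: "n > 0" using assms by simp
  have e: "cnj (dft n k l) * dft n k l' = z ^ k" for k
    unfolding dft_def z_def by (simp add: cis_cnj cis_mult Complex.DeMoivre algebra_simps diff_divide_distrib)
  show ?thesis
  proof (cases "l = l'")
    case True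
    then have "z = 1" by (simp add: z_def)
    then show ?thesis unfolding e using True by simp
  next
    case False
    have "z \<noteq> 1"
    proof
      assume "z = 1"
      then have "cos (2 * pi * (real l' - real l) / real n) = 1" 
      proof -
        have "Re z = cos (2 * pi * (real l' - real l) / real n)" by (simp add: z_def)
        with \<open>z = 1\<close> show ?thesis by simp
      qed
      then obtain m :: int where "2 * pi * (real l' - real l) / real n = m * 2 * pi" by (auto simp: cos_one_2pi_int)
      then have "2 * pi * (real l' - real l) = 2 * pi * (m * real n)" using n by (simp add: field_simps)
      then have "real l' - real l = m * real n" by simp
      then have "real_of_int (int l' - int l) = real_of_int (m * int n)" by simp
      then have m: "int l' - int l = m * int n" by linarith
      have "\<bar>int l' - int l\<bar> < int n" using assms by linarith
      then have "\<bar>m\<bar> * int n < 1 * int n" using n unfolding m abs_mult by simp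
      then have "\<bar>m\<bar> < 1" using n by (simp only: mult_less_cancel_right)
      then have "m = 0" by simp
      with m False show False by simp
    qed
    moreover have "z ^ n = 1"
    proof -
      have "z ^ n = cis (2 * pi * (real l' - real l))" using n by (simp add: z_def Complex.DeMoivre)
      also have "\<dots> = cis (2 * pi * real_of_int (int l' - int l))" by simp
      also have "\<dots> = 1" by (rule cis_multiple_2pi) simp
      finally show ?thesis .
    qed
    ultimately show ?thesis using False by (simp add: e sum_gp_strict)
  qed
qed

lemma standard_basis_orthonormal: "finite B \<Longrightarrow> orthonormal B B (\<lambda>j i. if i = j then 1 else 0)"
  unfolding orthonormal_def by (simp add: ip_indicator)

lemma fmv_standard_basis: "finite B \<Longrightarrow> j \<in> B \<Longrightarrow> fmv B x (\<lambda>i. if i = j then 1 else 0) = (\<lambda>i. x i j)"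
  unfolding fmv_def by (simp add: if_distrib cong: if_cong)

lemma right_singular_unitary:
  assumes "\<And>l l'. l < n \<Longrightarrow> l' < n \<Longrightarrow> (\<Sum>k<n. cnj (\<phi> k l) * \<phi> k l') = (if l = l' then of_real r else 0)"
  shows "right_singular (block n) (block n) (test_matrix n \<phi>) (\<lambda>j i. if i = j then 1 else 0)"
    and "j \<in> block n \<Longrightarrow> nsq (block n) (fmv (block n) (test_matrix n \<phi>) (\<lambda>i. if i = j then 1 else 0)) = r"
proof -
  have ip: "ip (block n) (\<lambda>i. test_matrix n \<phi> i (place n l)) (\<lambda>i. test_matrix n \<phi> i (place n l')) = (if l = l' then of_real r else 0)"
    if "l < n" "l' < n" for l l'
    unfolding ip_def sum_block using assms[OF that] that by (simp add: test_matrix_place)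
  show "right_singular (block n) (block n) (test_matrix n \<phi>) (\<lambda>j i. if i = j then 1 else 0)"
    unfolding right_singular_def
  proof (intro conjI standard_basis_orthonormal ballI impI)
    fix j j' assume j: "j \<in> block n" "j' \<in> block n" "j \<noteq> j'"
    then obtain l l' where "j = place n l" "j' = place n l'" "l < n" "l' < n" by (auto simp: block_def)
    with j ip[of l l'] show "ip (block n) (fmv (block n) (test_matrix n \<phi>) (\<lambda>i. if i = j then 1 else 0))
        (fmv (block n) (test_matrix n \<phi>) (\<lambda>i. if i = j' then 1 else 0)) = 0"
      by (auto simp: fmv_standard_basis)
  qed simp
  assume j: "j \<in> block n"
  then obtain l where l: "j = place n l" "l < n" by (auto simp: block_def)
  have "complex_of_real (nsq (block n) (\<lambda>i. test_matrix n \<phi> i j)) = of_real r"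
    unfolding ip_self[symmetric] using ip[OF l(2,2)] l by simp
  then show "nsq (block n) (fmv (block n) (test_matrix n \<phi>) (\<lambda>i. if i = j then 1 else 0)) = r"
    using j by (simp add: fmv_standard_basis)
qed

lemma schatten_sum_unitary:
  assumes "\<And>l l'. l < n \<Longrightarrow> l' < n \<Longrightarrow> (\<Sum>k<n. cnj (\<phi> k l) * \<phi> k l') = (if l = l' then of_real r else 0)"
  shows "schatten_sum q (block n) (block n) (test_matrix n \<phi>) = real n * r powr (q/2)"
proof -
  have rs: "right_singular (block n) (block n) (test_matrix n \<phi>) (\<lambda>j i. if i = j then 1 else 0)"
    by (rule right_singular_unitary(1)) (rule assms)
  have "nsq (block n) (fmv (block n) (test_matrix n \<phi>) (\<lambda>i. if i = j then 1 else 0)) = r" if "j \<in> block n" for j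
    by (rule right_singular_unitary(2)[OF _ that]) (rule assms)
  then show ?thesis unfolding schatten_sum_eq[OF finite_block rs] by (simp add: card_block)
qed

text \<open>
  The all-ones matrix is \<open>n\<close> times the projection to the constant vectors, so every orthonormal basis that
  contains a constant vector is right singular.  The Fourier basis is one.
\<close>

lemma schatten_sum_constant:
  assumes n: "n > 0" and q: "0 < q"
  shows "schatten_sum q (block n) (block n) (test_matrix n (\<lambda>k l. a)) = (cmod a * real n) powr q"
proof -
  let ?B = "block n" and ?J = "test_matrix n (\<lambda>k l. 1)"
  define v where "v j i = of_real (1 / sqrt n) * test_matrix n (dft n) i j" for j i
  have ipv: "ip ?B (v (place n l)) (v (place n l')) = (if l = l' then 1 else 0)" if "l < n" "l' < n" for l l'
  proof -
    have "ip ?B (v (place n l)) (v (place n l')) = (\<Sum>k<n. (of_real (1 / sqrt n) * of_real (1 / sqrt n)) * (cnj (dft n k l) * dft n k l'))"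
      unfolding ip_def sum_block v_def using that by (intro sum.cong refl) (simp add: test_matrix_place mult_ac)
    also have "\<dots> = of_real (1 / real n) * (if l = l' then of_nat n else 0)"
      unfolding sum_distrib_left[symmetric] dft_orthogonal[OF that] of_real_mult[symmetric] by simp
    finally show ?thesis using n by simp
  qed
  have on: "orthonormal ?B ?B v"
    unfolding orthonormal_def
  proof (intro ballI)
    fix j j' assume "j \<in> ?B" "j' \<in> ?B"
    then obtain l l' where "j = place n l" "j' = place n l'" "l < n" "l' < n" by (auto simp: block_def)
    then show "ip ?B (v j) (v j') = (if j = j' then 1 else 0)"
      using ipv inj_place[of n UNIV] by (auto simp: inj_on_def)
  qed
  have Jv: "fmv ?B ?J (v (place n l)) (place n k) = (if l = 0 then of_real (sqrt n) else 0)" if "l < n" "k < n" for l k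
  proof -
    have "fmv ?B ?J (v (place n l)) (place n k) = of_real (1 / sqrt n) * (\<Sum>m<n. cnj (dft n m 0) * dft n m l)"
      unfolding fmv_def sum_block v_def using that
      by (simp add: test_matrix_place sum_distrib_left) (simp add: dft_def)
    also have "\<dots> = of_real (1 / sqrt n) * (if l = 0 then of_nat n else 0)"
      using dft_orthogonal[OF n that(1)] by simp
    also have "\<dots> = (if l = 0 then of_real (1 / sqrt n * n) else 0)" by simp
    also have "1 / sqrt n * n = sqrt n" using n by (simp add: real_div_sqrt)
    finally show ?thesis .
  qed
  have rs: "right_singular ?B ?B ?J v"
    unfolding right_singular_def
  proof (intro conjI on ballI impI)
    fix j j' assume "j \<in> ?B" "j' \<in> ?B" "j \<noteq> j'"
    then obtain l l' where l: "j = place n l" "j' = place n l'" "l < n" "l' < n" "l \<noteq> l'" by (auto simp: block_def)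
    show "ip ?B (fmv ?B ?J (v j)) (fmv ?B ?J (v j')) = 0"
      unfolding ip_def sum_block using l by (intro sum.neutral) (auto simp: Jv)
  qed
  have "schatten_sum q ?B ?B ?J = (\<Sum>l<n. nsq ?B (fmv ?B ?J (v (place n l))) powr (q/2))"
    unfolding schatten_sum_eq[OF finite_block rs] sum_block ..
  also have "\<dots> = (\<Sum>l<n. if l = 0 then real n powr q else 0)"
  proof (intro sum.cong refl)
    fix l assume l: "l \<in> {..<n}"
    then have "nsq ?B (fmv ?B ?J (v (place n l))) = (if l = 0 then (real n)\<^sup>2 else 0)"
      unfolding nsq_def sum_block by (simp add: Jv power2_eq_square)
    then show "nsq ?B (fmv ?B ?J (v (place n l))) powr (q/2) = (if l = 0 then real n powr q else 0)"
      by (simp add: sqrt_powr[symmetric])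
  qed
  also have "\<dots> = real n powr q" using n by simp
  finally have J: "schatten_sum q ?B ?B ?J = real n powr q" .
  have "schatten_sum q ?B ?B (test_matrix n (\<lambda>k l. a)) = cmod a powr q * schatten_sum q ?B ?B ?J"
  proof (rule schatten_sum_row_scale)
    fix i j assume "i \<in> ?B" "j \<in> ?B"
    then obtain k l where "i = place n k" "j = place n l" "k < n" "l < n" by (auto simp: block_def)
    then show "test_matrix n (\<lambda>k l. a) i j = a * ?J i j" by (simp add: test_matrix_place)
  qed auto
  then show ?thesis unfolding J by (simp add: powr_mult)
qed

lemma schatten_sup_test_matrix:
  assumes "1 \<le> q"
  shows "schatten_sup UNIV q (test_matrix n \<phi>) = ennreal (schatten_sum q (block n) (block n) (test_matrix n \<phi>))"
  by (rule antisym[OF schatten_sup_finite_support[OF assms finite_block test_matrix_support] schatten_sum_le_schatten_sup]) auto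

lemma schatten_norm_test_matrix:
  assumes q: "1 \<le> q" "q \<noteq> \<infinity>"
  shows "test_matrix n \<phi> \<in> schatten_class UNIV q"
    and "schatten_norm UNIV q (test_matrix n \<phi>) = ennreal (schatten_sum (enn2real q) (block n) (block n) (test_matrix n \<phi>) powr (1 / enn2real q))"
proof -
  show c: "test_matrix n \<phi> \<in> schatten_class UNIV q"
    by (rule class_finite_support[OF q refl finite_support_test_matrix])
  show "schatten_norm UNIV q (test_matrix n \<phi>) = ennreal (schatten_sum (enn2real q) (block n) (block n) (test_matrix n \<phi>) powr (1 / enn2real q))"
    unfolding schatten_norm_class[OF q refl c] by (simp add: schatten_sup_test_matrix[OF exponent_ge_1[OF q refl]])
qed

lemma unimodular_unitary:
  assumes "\<And>l l'. l < n \<Longrightarrow> l' < n \<Longrightarrow> (\<Sum>k<n. cnj (\<phi> k l) * \<phi> k l') = (if l = l' then of_nat n else 0)"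
    and "l < n" "l' < n"
  shows "(\<Sum>k<n. cnj (of_real a * \<phi> k l) * (of_real a * \<phi> k l')) = (if l = l' then of_real (a\<^sup>2 * real n) else 0)"
proof -
  have "(\<Sum>k<n. cnj (of_real a * \<phi> k l) * (of_real a * \<phi> k l')) = of_real (a\<^sup>2) * (\<Sum>k<n. cnj (\<phi> k l) * \<phi> k l')"
    by (simp add: sum_distrib_left power2_eq_square mult_ac)
  then show ?thesis using assms by simp
qed

lemma cnj_dft_orthogonal:
  assumes "l < n" "l' < n"
  shows "(\<Sum>k<n. cnj (cnj (dft n k l)) * cnj (dft n k l')) = (if l = l' then of_nat n else 0)"
proof -
  have "(\<Sum>k<n. cnj (cnj (dft n k l)) * cnj (dft n k l')) = cnj (\<Sum>k<n. cnj (dft n k l) * dft n k l')"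
    by simp
  then show ?thesis using dft_orthogonal[OF assms] by simp
qed

section \<open>Operator norms and compactness of test matrices\<close>

lemma opbound_unitary_test_matrix:
  assumes "\<And>l l'. l < n \<Longrightarrow> l' < n \<Longrightarrow> (\<Sum>k<n. cnj (\<phi> k l) * \<phi> k l') = (if l = l' then of_real 1 else 0)"
  shows "opbound UNIV 1 (test_matrix n \<phi>)"
  unfolding opbound_def
proof (intro allI impI)
  fix C :: "int set" and v :: "int \<Rightarrow> complex" assume C: "finite C \<and> C \<subseteq> UNIV"
  let ?B = "block n" and ?x = "test_matrix n \<phi>"
  define w where "w = (\<lambda>j. if j \<in> C then v j else 0)"
  have eq: "fmv C ?x v = fmv ?B ?x w"
  proof
    fix i
    have "fmv C ?x v i = (\<Sum>j\<in>C \<inter> ?B. ?x i j * v j)"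
      unfolding fmv_def by (rule sum.mono_neutral_right) (use C test_matrix_support in auto)
    also have "\<dots> = fmv ?B ?x w i"
      unfolding fmv_def by (rule sum.mono_neutral_cong_left) (auto simp: w_def)
    finally show "fmv C ?x v i = fmv ?B ?x w i" .
  qed
  have "nsq ?B (fmv ?B ?x w) = (\<Sum>j\<in>?B. (cmod (w j))\<^sup>2)"
  proof -
    have rs: "right_singular ?B ?B ?x (\<lambda>j i. if i = j then 1 else 0)"
      by (rule right_singular_unitary(1)) (rule assms)
    have n1: "nsq ?B (fmv ?B ?x (\<lambda>i. if i = j then 1 else 0)) = 1" if "j \<in> ?B" for j
      by (rule right_singular_unitary(2)[OF _ that]) (rule assms)
    have "cmod (ip ?B (\<lambda>i. if i = j then 1 else 0) w) = cmod (w j)" if "j \<in> ?B" for j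
      by (subst cmod_ip_commute) (simp add: ip_indicator that)
    then show ?thesis unfolding nsq_fmv_expand[OF finite_block rs, of w] by (simp add: n1)
  qed
  also have "\<dots> = (\<Sum>j\<in>?B \<inter> C. (cmod (v j))\<^sup>2)"
    by (rule sum.mono_neutral_cong_right) (auto simp: w_def)
  also have "\<dots> \<le> nsq C v" unfolding nsq_def by (rule sum_mono2) (use C in auto)
  finally have "sqrt (nsq ?B (fmv ?B ?x w)) \<le> 1 * sqrt (nsq C v)" by simp
  moreover have "l2le UNIV (sqrt (nsq ?B (fmv ?B ?x w))) (fmv ?B ?x w)"
  proof (rule l2le_finite[OF finite_block])
    fix i assume "i \<in> UNIV - ?B"
    then have "i \<notin> ?B" by simp
    then have "?x i j = 0" for j using test_matrix_support[of n \<phi> i j] by metis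
    then show "fmv ?B ?x w i = 0" by (simp add: fmv_def)
  qed
  ultimately show "l2le UNIV (1 * sqrt (nsq C v)) (fmv C ?x v)" unfolding eq by (rule l2le_mono[rotated])
qed

lemma op_norm_constant_ge:
  assumes b: "test_matrix n (\<lambda>k l. of_real a) \<in> bounded_ops UNIV" and n: "n > 0" and a: "0 \<le> a"
  shows "a * real n \<le> op_norm UNIV (test_matrix n (\<lambda>k l. of_real a))"
proof -
  let ?x = "test_matrix n (\<lambda>k l. of_real a)" and ?B = "block n"
  have "sqrt (nsq ?B (fmv ?B ?x (\<lambda>_. 1))) \<le> op_norm UNIV ?x * sqrt (nsq ?B (\<lambda>_. 1))"
    by (rule l2leD[OF opboundD[OF bounded_ops_opbound(2)[OF b]]]) auto
  moreover have "fmv ?B ?x (\<lambda>_. 1) i = of_real (a * n)" if i: "i \<in> ?B" for i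
  proof -
    obtain k where "i = place n k" "k < n" using i by (auto simp: block_def)
    then show ?thesis unfolding fmv_def sum_block by (simp add: test_matrix_place)
  qed
  then have "nsq ?B (fmv ?B ?x (\<lambda>_. 1)) = nsq ?B (\<lambda>_. of_real (a * n))" by (intro nsq_cong)
  moreover have "nsq ?B (\<lambda>_. of_real (a * n)) = (a * n)\<^sup>2 * n" "nsq ?B (\<lambda>_. 1) = n"
    unfolding nsq_def norm_of_real by (simp_all add: card_block)
  ultimately have "sqrt ((a * n)\<^sup>2 * n) \<le> op_norm UNIV ?x * sqrt n" by simp
  then have "(a * n) * sqrt n \<le> op_norm UNIV ?x * sqrt n" using a by (simp add: real_sqrt_mult)
  then show ?thesis using n by simp
qed

text \<open>
  The images of the unit ball lie in a product of discs and points, which is compact in the topology of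
  pointwise convergence; on vectors supported in \<open>F\<close> pointwise convergence is convergence in norm.
\<close>

lemma finite_support_compact:
  fixes x :: "int mat"
  assumes F: "finite F" and x: "\<And>i j. x i j \<noteq> 0 \<Longrightarrow> i \<in> F \<and> j \<in> F" and b: "x \<in> bounded_ops UNIV"
  shows "x \<in> compact_ops UNIV"
  unfolding compact_ops_def
proof (intro CollectI conjI b allI impI)
  fix v :: "nat \<Rightarrow> int \<Rightarrow> complex" assume v: "\<forall>n. v n \<in> ell2 UNIV \<and> ell2_norm UNIV (v n) \<le> 1"
  let ?N = "op_norm UNIV x"
  let ?P = "PiE UNIV (\<lambda>i. if i \<in> F then cball 0 ?N else {0}) :: (int \<Rightarrow> complex) set"
  have N0: "0 \<le> ?N" by (rule bounded_ops_opbound(3)[OF b])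
  have "compactin (product_topology (\<lambda>i. euclidean) UNIV) ?P" by (subst compactin_PiE) auto
  then have "seq_compact ?P" by (intro compact_imp_seq_compact) (simp add: euclidean_product_topology)
  moreover have "\<forall>n. mat_vec UNIV x (v n) \<in> ?P"
  proof
    fix n
    have "l2le UNIV 1 (v n)" using v by (auto simp: ell2_norm_le_iff[symmetric])
    from opbound_mat_vec[OF bounded_ops_opbound(2)[OF b] N0 this]
    have "cmod (mat_vec UNIV x (v n) i) \<le> ?N" for i using l2le_coord[of UNIV "?N * 1"] by simp
    moreover have "mat_vec UNIV x (v n) i = 0" if "i \<notin> F" for i
    proof -
      have "x i j = 0" for j using x[of i j] that by blast
      then show ?thesis by (simp add: mat_vec_def)
    qed
    ultimately show "mat_vec UNIV x (v n) \<in> ?P" by auto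
  qed
  ultimately obtain w r where w: "w \<in> ?P" and r: "strict_mono (r :: nat \<Rightarrow> nat)" and lim: "((\<lambda>n. mat_vec UNIV x (v n)) \<circ> r) \<longlonglongrightarrow> w"
    by (rule seq_compactE)
  have w0: "w i = 0" if "i \<notin> F" for i using w that by (auto simp: PiE_iff) (metis singletonD)
  have coord: "(\<lambda>n. mat_vec UNIV x (v (r n)) i) \<longlonglongrightarrow> w i" for i
  proof -
    have "continuous_on UNIV (\<lambda>w :: int \<Rightarrow> complex. w i)" by (rule continuous_on_product_coordinates)
    from continuous_on_tendsto_compose[OF this lim] show ?thesis by (simp add: o_def)
  qed
  have l: "l2le UNIV (sqrt (nsq F w)) w" by (rule l2le_finite[OF F]) (use w0 in auto)
  have d0: "mat_vec UNIV x (v n) i - w i = 0" if "i \<notin> F" for n i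
  proof -
    have "x i j = 0" for j using x[of i j] that by blast
    then show ?thesis using w0[OF that] by (simp add: mat_vec_def)
  qed
  have "(\<lambda>n. ell2_norm UNIV (\<lambda>i. mat_vec UNIV x (v (r n)) i - w i)) \<longlonglongrightarrow> 0"
  proof (rule tendsto_sandwich[OF _ _ tendsto_const])
    have "(\<lambda>n. sqrt (nsq F (\<lambda>i. mat_vec UNIV x (v (r n)) i - w i))) \<longlonglongrightarrow> sqrt (\<Sum>i\<in>F. (cmod (w i - w i))\<^sup>2)"
      unfolding nsq_def by (intro tendsto_intros coord)
    then show "(\<lambda>n. sqrt (nsq F (\<lambda>i. mat_vec UNIV x (v (r n)) i - w i))) \<longlonglongrightarrow> 0" by simp
    show "\<forall>\<^sub>F n in sequentially. ell2_norm UNIV (\<lambda>i. mat_vec UNIV x (v (r n)) i - w i) \<le> sqrt (nsq F (\<lambda>i. mat_vec UNIV x (v (r n)) i - w i))"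
      by (intro always_eventually allI l2le_ell2(2) l2le_finite[OF F]) (use d0 in auto)
    show "\<forall>\<^sub>F n in sequentially. 0 \<le> ell2_norm UNIV (\<lambda>i. mat_vec UNIV x (v (r n)) i - w i)"
      unfolding ell2_norm_def by (intro always_eventually allI real_sqrt_ge_zero infsum_nonneg) simp
  qed
  moreover have "w \<in> ell2 UNIV" using l2le_ell2(1)[OF l] by simp
  ultimately show "\<exists>r w. strict_mono r \<and> w \<in> ell2 UNIV \<and> (\<lambda>n. ell2_norm UNIV (\<lambda>i. mat_vec UNIV x (v (r n)) i - w i)) \<longlonglongrightarrow> 0"
    using r by blast
qed

section \<open>Unboundedness\<close>

text \<open>
  Any extension of the multiplier agrees with entrywise multiplication on the test matrices, so its norm bounds
  what happens to them.
\<close>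

lemma schur_multiplier_bound:
  assumes "symbol P \<in> schur_multipliers q"
  obtains k where "\<And>n \<phi>. test_matrix n \<phi> \<in> schatten_class UNIV q \<Longrightarrow> schatten_norm UNIV q (test_matrix n \<phi>) \<le> 1 \<Longrightarrow>
    schatten_norm UNIV q (test_matrix n (\<lambda>k l. of_real (weight P n) * dft n k l * \<phi> k l)) \<le> ennreal k"
proof -
  obtain T where T: "is_schur_map q (symbol P) T" using assms by (auto simp: schur_multipliers_def)
  let ?k = "map_norm (schatten_norm UNIV q) (schatten_class UNIV q) T"
  have fin: "?k < \<infinity>" and fs: "\<And>x. finite {(i, j). x i j \<noteq> 0} \<Longrightarrow> T x = (\<lambda>i j. symbol P (i, j) * x i j)"
    using T by (auto simp: is_schur_map_def)
  have "schatten_norm UNIV q (test_matrix n (\<lambda>k l. of_real (weight P n) * dft n k l * \<phi> k l)) \<le> ennreal (enn2real ?k)"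
    if "test_matrix n \<phi> \<in> schatten_class UNIV q" "schatten_norm UNIV q (test_matrix n \<phi>) \<le> 1" for n \<phi>
  proof -
    have "test_matrix n (\<lambda>k l. of_real (weight P n) * dft n k l * \<phi> k l) = T (test_matrix n \<phi>)"
      unfolding fs[OF finite_support_test_matrix] symbol_test_matrix ..
    moreover have "schatten_norm UNIV q (T (test_matrix n \<phi>)) \<le> ?k"
      unfolding map_norm_def by (rule SUP_upper) (use that in simp)
    ultimately show ?thesis using fin by simp
  qed
  with that show ?thesis by blast
qed

lemma powr_unbounded:
  assumes "0 < d" shows "\<exists>n>0. k < real n powr d"
proof -
  obtain n where n: "(\<bar>k\<bar> + 1) powr (1/d) < real n" using reals_Archimedean2 by blast
  have "((\<bar>k\<bar> + 1) powr (1/d)) powr d < real n powr d" by (rule powr_less_mono2) (use n assms in auto)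
  moreover have "((\<bar>k\<bar> + 1) powr (1/d)) powr d = \<bar>k\<bar> + 1" using assms by (simp add: powr_powr)
  moreover have "n > 0" using n by (smt (verit) gr0I of_nat_0 powr_ge_zero)
  ultimately show ?thesis by (intro exI[of _ n]) auto
qed

lemma not_multiplier_large:
  assumes q: "1 \<le> q" "q \<noteq> \<infinity>" and P: "2 \<le> P" "P < enn2real q"
  shows "symbol P \<notin> schur_multipliers q"
proof
  assume "symbol P \<in> schur_multipliers q"
  then obtain k where k: "\<And>n \<phi>. test_matrix n \<phi> \<in> schatten_class UNIV q \<Longrightarrow> schatten_norm UNIV q (test_matrix n \<phi>) \<le> 1 \<Longrightarrow>
    schatten_norm UNIV q (test_matrix n (\<lambda>k l. of_real (weight P n) * dft n k l * \<phi> k l)) \<le> ennreal k"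
    by (rule schur_multiplier_bound) blast
  define Q where "Q = enn2real q"
  have Q: "P < Q" "0 < Q" using P by (auto simp: Q_def)
  have "0 < 1/P - 1/Q" using P Q by (simp add: field_simps)
  then obtain n where n: "n > 0" "max k 0 < real n powr (1/P - 1/Q)" using powr_unbounded by blast
  \<comment> \<open>This factor gives the conjugate Fourier matrix the norm 1.\<close>
  define a where "a = real n powr (-(1/Q + 1/2))"
  let ?\<phi> = "\<lambda>k l. of_real a * cnj (dft n k l)"
  note un = unimodular_unitary[OF cnj_dft_orthogonal, of n]
  have "schatten_sum Q (block n) (block n) (test_matrix n ?\<phi>) = real n * (a\<^sup>2 * real n) powr (Q/2)"
    by (rule schatten_sum_unitary[OF un])
  also have "a\<^sup>2 * real n = real n powr (-(2/Q))"
  proof -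
    have "a\<^sup>2 * real n powr 1 = real n powr (-(1/Q + 1/2) + -(1/Q + 1/2) + 1)"
      unfolding a_def power2_eq_square powr_add by simp
    then show ?thesis using n by simp
  qed
  also have "real n * (real n powr (-(2/Q))) powr (Q/2) = 1"
  proof -
    have "(real n powr (-(2/Q))) powr (Q/2) = real n powr (-1)" unfolding powr_powr using Q by simp
    then show ?thesis using n by (simp add: powr_minus)
  qed
  finally have "schatten_norm UNIV q (test_matrix n ?\<phi>) \<le> 1"
    by (simp add: schatten_norm_test_matrix[OF q] Q_def[symmetric])
  from k[OF schatten_norm_test_matrix(1)[OF q] this]
  have le: "schatten_norm UNIV q (test_matrix n (\<lambda>k l. of_real (weight P n) * dft n k l * ?\<phi> k l)) \<le> ennreal k" .
  have "of_real (weight P n) * dft n k l * ?\<phi> k l = of_real (weight P n * a)" for k l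
  proof -
    have "dft n k l * cnj (dft n k l) = 1" by (simp add: complex_norm_square[symmetric])
    then show ?thesis by (simp add: mult_ac)
  qed
  with le have "schatten_norm UNIV q (test_matrix n (\<lambda>k l. of_real (weight P n * a))) \<le> ennreal k" by simp
  then have "ennreal (((weight P n * a * real n) powr Q) powr (1/Q)) \<le> ennreal k"
    unfolding schatten_norm_test_matrix(2)[OF q] Q_def[symmetric]
    using n Q by (simp only: schatten_sum_constant norm_of_real) (simp add: weight_def a_def)
  moreover have "0 \<le> weight P n * a * real n" by (simp add: weight_def a_def)
  ultimately have "ennreal (weight P n * a * real n) \<le> ennreal k" using Q by (simp add: powr_powr)
  moreover have "weight P n * a * real n = real n powr (1/P - 1/Q)"
  proof -
    have "\<bar>1/2 - 1/P\<bar> = 1/2 - 1/P" using P by (simp add: field_simps)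
    then have "weight P n * a * real n powr 1 = real n powr (- (1/2 - 1/P) + (-(1/Q + 1/2)) + 1)"
      unfolding weight_def a_def powr_add by simp
    then show ?thesis using n by (simp add: algebra_simps)
  qed
  ultimately show False using n by (simp add: ennreal_le_iff2)
qed

lemma not_multiplier_infinity:
  assumes P: "2 \<le> P"
  shows "symbol P \<notin> schur_multipliers \<infinity>"
proof
  assume "symbol P \<in> schur_multipliers \<infinity>"
  then obtain k where k: "\<And>n \<phi>. test_matrix n \<phi> \<in> schatten_class UNIV \<infinity> \<Longrightarrow> schatten_norm UNIV \<infinity> (test_matrix n \<phi>) \<le> 1 \<Longrightarrow>
    schatten_norm UNIV \<infinity> (test_matrix n (\<lambda>k l. of_real (weight P n) * dft n k l * \<phi> k l)) \<le> ennreal k"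
    by (rule schur_multiplier_bound) blast
  have "0 < 1/P" using P by simp
  then obtain n where n: "n > 0" "max k 0 < real n powr (1/P)" using powr_unbounded by blast
  \<comment> \<open>This factor makes the conjugate Fourier matrix unitary.\<close>
  define a where "a = real n powr (-(1/2))"
  let ?\<phi> = "\<lambda>k l. of_real a * cnj (dft n k l)"
  have a2: "a\<^sup>2 * real n = 1"
    unfolding a_def power2_eq_square using n by (simp add: powr_add[symmetric] powr_minus_divide)
  have ob: "opbound UNIV 1 (test_matrix n ?\<phi>)"
    by (rule opbound_unitary_test_matrix) (use unimodular_unitary[OF cnj_dft_orthogonal, of n _ _ a] a2 in simp)
  have ms: "matsupp UNIV x" for x :: "int mat" by (simp add: matsupp_def)
  have b: "test_matrix n ?\<phi> \<in> bounded_ops UNIV" "op_norm UNIV (test_matrix n ?\<phi>) \<le> 1"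
    using opbound_bounded_ops[OF ms ob] by auto
  have c: "test_matrix n ?\<phi> \<in> schatten_class UNIV \<infinity>"
    unfolding schatten_class_def using finite_support_compact[OF finite_block test_matrix_support b(1)] by simp
  have "schatten_norm UNIV \<infinity> (test_matrix n ?\<phi>) \<le> 1" using b by (simp add: schatten_norm_def)
  from k[OF c this]
  have le: "schatten_norm UNIV \<infinity> (test_matrix n (\<lambda>k l. of_real (weight P n) * dft n k l * ?\<phi> k l)) \<le> ennreal k" .
  have "of_real (weight P n) * dft n k l * ?\<phi> k l = of_real (weight P n * a)" for k l
  proof -
    have "dft n k l * cnj (dft n k l) = 1" by (simp add: complex_norm_square[symmetric])
    then show ?thesis by (simp add: mult_ac)
  qed
  with le have le: "schatten_norm UNIV \<infinity> (test_matrix n (\<lambda>k l. of_real (weight P n * a))) \<le> ennreal k" by simp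
  have bb: "test_matrix n (\<lambda>k l. of_real (weight P n * a)) \<in> bounded_ops UNIV"
  proof (rule ccontr)
    assume "\<not> ?thesis"
    with le show False by (simp add: schatten_norm_def top_unique)
  qed
  have "ennreal (op_norm UNIV (test_matrix n (\<lambda>k l. of_real (weight P n * a)))) \<le> ennreal k"
    using le bb by (simp add: schatten_norm_def)
  then have "ennreal (weight P n * a * real n) \<le> ennreal k"
  proof (rule order_trans[rotated])
    have "0 \<le> weight P n * a" by (simp add: a_def weight_def)
    from op_norm_constant_ge[OF bb n(1) this]
    show "ennreal (weight P n * a * real n) \<le> ennreal (op_norm UNIV (test_matrix n (\<lambda>k l. of_real (weight P n * a))))"
      by (rule ennreal_leI)
  qed
  moreover have "weight P n * a * real n = real n powr (1/P)"
  proof -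
    have "\<bar>1/2 - 1/P\<bar> = 1/2 - 1/P" using P by (simp add: field_simps)
    then have "weight P n * a * real n powr 1 = real n powr (- (1/2 - 1/P) + (-(1/2)) + 1)"
      unfolding weight_def a_def powr_add by simp
    then show ?thesis using n by (simp add: algebra_simps)
  qed
  ultimately show False using n by (simp add: ennreal_le_iff2)
qed

lemma not_multiplier_small:
  assumes q: "1 \<le> q" "q \<noteq> \<infinity>" and P: "P \<le> 2" "enn2real q < P"
  shows "symbol P \<notin> schur_multipliers q"
proof
  assume "symbol P \<in> schur_multipliers q"
  then obtain k where k: "\<And>n \<phi>. test_matrix n \<phi> \<in> schatten_class UNIV q \<Longrightarrow> schatten_norm UNIV q (test_matrix n \<phi>) \<le> 1 \<Longrightarrow>
    schatten_norm UNIV q (test_matrix n (\<lambda>k l. of_real (weight P n) * dft n k l * \<phi> k l)) \<le> ennreal k"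
    by (rule schur_multiplier_bound) blast
  define Q where "Q = enn2real q"
  have "1 \<le> Q" unfolding Q_def by (rule exponent_ge_1[OF q refl])
  then have Q: "Q < P" "0 < Q" using P by (auto simp: Q_def)
  have "0 < 1/Q - 1/P" using P Q by (simp add: field_simps)
  then obtain n where n: "n > 0" "max k 0 < real n powr (1/Q - 1/P)" using powr_unbounded by blast
  have "schatten_sum Q (block n) (block n) (test_matrix n (\<lambda>k l. of_real (1 / real n))) = 1"
    unfolding schatten_sum_constant[OF n(1) Q(2)] norm_of_real using n by simp
  then have "schatten_norm UNIV q (test_matrix n (\<lambda>k l. of_real (1 / real n))) \<le> 1"
    unfolding schatten_norm_test_matrix(2)[OF q] Q_def[symmetric] by simp
  from k[OF schatten_norm_test_matrix(1)[OF q] this]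
  have le: "schatten_norm UNIV q (test_matrix n (\<lambda>k l. of_real (weight P n) * dft n k l * of_real (1 / real n))) \<le> ennreal k" .
  define a where "a = weight P n / real n"
  have "of_real (weight P n) * dft n k l * of_real (1 / real n) = of_real a * dft n k l" for k l
    by (simp add: a_def)
  with le have "schatten_norm UNIV q (test_matrix n (\<lambda>k l. of_real a * dft n k l)) \<le> ennreal k" by simp
  then have le: "ennreal ((real n * (a\<^sup>2 * real n) powr (Q/2)) powr (1/Q)) \<le> ennreal k"
  proof -
    have "schatten_sum Q (block n) (block n) (test_matrix n (\<lambda>k l. of_real a * dft n k l)) = real n * (a\<^sup>2 * real n) powr (Q/2)"
      by (rule schatten_sum_unitary[OF unimodular_unitary[OF dft_orthogonal]])
    with \<open>schatten_norm UNIV q (test_matrix n (\<lambda>k l. of_real a * dft n k l)) \<le> ennreal k\<close> show ?thesis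
      unfolding schatten_norm_test_matrix(2)[OF q] Q_def[symmetric] by simp
  qed
  have "\<bar>1/2 - 1/P\<bar> = 1/P - 1/2" using P Q by (simp add: field_simps)
  then have "a = real n powr (-(1/P - 1/2)) / real n powr 1" using n by (simp add: a_def weight_def)
  then have "a = real n powr (-(1/P - 1/2) - 1)" by (simp only: powr_diff)
  then have "a\<^sup>2 * real n powr 1 = real n powr ((-(1/P - 1/2) - 1) + (-(1/P - 1/2) - 1) + 1)"
    unfolding power2_eq_square powr_add by simp
  then have "a\<^sup>2 * real n = real n powr (-(2/P))" using n by (simp add: algebra_simps)
  then have "real n * (a\<^sup>2 * real n) powr (Q/2) = real n powr 1 * real n powr (-(2/P) * (Q/2))"
    by (simp only: powr_powr) (use n in simp)
  also have "\<dots> = real n powr (1 - Q/P)" unfolding powr_add[symmetric] by simp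
  also have "(real n powr (1 - Q/P)) powr (1/Q) = real n powr (1/Q - 1/P)"
    using Q by (simp add: powr_powr diff_divide_distrib)
  finally have "(real n * (a\<^sup>2 * real n) powr (Q/2)) powr (1/Q) = real n powr (1/Q - 1/P)" .
  with le n show False by (simp add: ennreal_le_iff2)
qed

theorem theorem3p2:
  fixes p q :: ennreal
  assumes "1 \<le> p" and "1 \<le> q"
    and "(2 \<le> p \<and> p < q) \<or> (q < p \<and> p \<le> 2)"
  shows "\<exists>m :: int \<times> int \<Rightarrow> complex. m \<in> cb_schur_multipliers p \<and> m \<notin> schur_multipliers q"
proof -
  have pf: "p \<noteq> \<infinity>" using assms(3) by (auto simp: top_unique)
  define P where "P = enn2real p"
  have pP: "p = ennreal P" using pf by (simp add: P_def less_top)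
  have "symbol P \<notin> schur_multipliers q"
    using assms(3)
  proof
    assume a: "2 \<le> p \<and> p < q"
    then have "ennreal 2 \<le> ennreal P" by (simp add: pP)
    then have P2: "2 \<le> P" by (simp add: ennreal_le_iff2)
    show ?thesis
    proof (cases "q = \<infinity>")
      case True then show ?thesis using not_multiplier_infinity[OF P2] by simp
    next
      case False
      then have "ennreal P < ennreal (enn2real q)" using a by (simp add: pP less_top)
      then show ?thesis using P2 by (intro not_multiplier_large[OF assms(2) False P2]) (simp add: ennreal_less_iff)
    qed
  next
    assume a: "q < p \<and> p \<le> 2"
    then have qf: "q \<noteq> \<infinity>" by auto
    have "ennreal P \<le> ennreal 2" using a by (simp add: pP)
    then have P2: "P \<le> 2" by (subst (asm) ennreal_le_iff) auto
    have "ennreal (enn2real q) < ennreal P" using a qf by (simp add: pP[symmetric] less_top)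
    then show ?thesis by (intro not_multiplier_small[OF assms(2) qf P2]) (simp add: ennreal_less_iff)
  qed
  moreover have "symbol P \<in> cb_schur_multipliers p" by (rule symbol_cb_multiplier[OF assms(1) pf P_def])
  ultimately show ?thesis by blast
qed

end
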